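(* Let $(X,S)$ be a minimal topological dynamical system with $X$ compact metric and acting group $\mathbb Z$, and let $d\ge2$ be an integer. Let $\pi:(X,S)\to(X_{d-1},S)$ be the extension to the maximal factor of order $d-1$. Then there are systems $X'$, $X_{d-1}'$ and extensions $\theta':X'\to X$, $\pi':X'\to X_{d-1}'$, $\theta:X_{d-1}'\to X_{d-1}$ with $\pi\circ\theta'=\theta\circ\pi'$ such that $\theta,\theta'$ are almost one-to-one extensions and $(X_{d-1}',S)$ is (via $\pi'$) the topological cubic characteristic factor of order $d$ of $(X',S)$.
   Context: Here $T=\mathbb Z$, generated by the homeomorphism $S$. A system is minimal if all orbits are dense. An extension is a continuous equivariant surjection. An extension $\phi:X\to Y$ is almost one-to-one if there is a dense $G_\delta$ set $X_0\subseteq X$ with $\phi^{-1}(\phi(x))=\{x\}$ for all $x\in X_0$. Cubes. $X^{[k]}=X^{2^k}$ has coordinates indexed by $\{0,1\}^k$ (equivalently subsets of $\{1,\dots,k\}$, $\emptyset\leftrightarrow(0,\dots,0)$); $x^{[k]}$ has all coordinates $x$. An upper facet is a set $\{\epsilon\in\{0,1\}^k:\epsilon_i=1\}$. For $t\in T$, $t^{(\alpha)}\in T^{[k]}$ has coordinate $t$ on $\alpha$ and the identity elsewhere. $\mathcal F^{[k]}(T)$ is the subgroup of $T^{[k]}$ generated by $t^{(\alpha)}$, $t\in T$, $\alpha$ an upper facet, acting coordinatewise on $X^{[k]}$. Maximal factor of order $k$. $(x,y)\in\mathbf{RP}^{[k]}(X)$ if there are nets $(\mathbf f_\lambda)$ in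 $\mathcal F^{[k]}(T)$, $(x_\lambda),(y_\lambda)$ in $X$, and $\mathbf a_*\in X^{2^k-1}$ with $(\mathbf f_\lambda x_\lambda^{[k]},\mathbf f_\lambda y_\lambda^{[k]})\to(x,\mathbf a_*,y,\mathbf a_* )$ (first coordinate of each block is the $\emptyset$-coordinate). For minimal $X$ this is a closed invariant equivalence relation; $X_k=X/\mathbf{RP}^{[k]}(X)$ is the maximal factor of order $k$ (a system is of order $k$ if its $\mathbf{RP}^{[k]}$ is the diagonal). Characteristic factors. For a map $\phi:A\to B$, a subset $L\subseteq A$ is $\phi$-saturated if $L=\phi^{-1}(\phi(L))$. Given an extension $\phi:(X,T)\to(Y,T)$, $(Y,T)$ is a topological cubic characteristic factor of order $d$ (of $X$) if there is a dense $G_\delta$ set $X_0\subseteq X$ such that for every $x\in X_0$ the set $\rho_*(\overline{\mathcal F^{[d]}(T)x^{[d]}})\subseteq X^{2^d-1}$ is $\phi^{2^d-1}$-saturated, where $\rho_*:X^{[d]}\to X^{2^d-1}$ is the projection onto the last $2^d-1$ coordinates (all coordinates except $\emptyset$) and $\phi^{2^d-1}=\phi\times\cdots\times\phi$. *)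

theory Defs
  imports "HOL-Analysis.Analysis" "HOL-Algebra.Product_Groups" "HOL-Algebra.Generated_Groups"
begin

section \<open>Systems and extensions\<close>

text \<open>Only the topology of a compact metric space is used. Since every compact metrizable space
  embeds into the Hilbert cube, every system in this sense is isomorphic to one with carrier in
  \<^typ>\<open>nat \<Rightarrow> real\<close>, so existence of a system may be stated over that type.\<close>

definition metric_system :: "'a topology \<Rightarrow> ('a \<Rightarrow> 'a) \<Rightarrow> bool" where
  "metric_system X S \<longleftrightarrow>
     compact_space X \<and> metrizable_space X \<and> homeomorphic_map X X S"

text \<open>The action of \<open>t\<close> in the integers on \<open>X\<close>, i.e. the \<open>t\<close>-th power of \<open>S\<close>; only its values
  on \<^term>\<open>topspace X\<close> are meaningful.\<close>

definition int_iter :: "'a topology \<Rightarrow> ('a \<Rightarrow> 'a) \<Rightarrow> int \<Rightarrow> 'a \<Rightarrow> 'a" where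
  "int_iter X S t =
     (if 0 \<le> t then S ^^ nat t else inv_into (topspace X) S ^^ nat (- t))"

definition minimal_system :: "'a topology \<Rightarrow> ('a \<Rightarrow> 'a) \<Rightarrow> bool" where
  "minimal_system X S \<longleftrightarrow>
     (\<forall>x\<in>topspace X. X closure_of (range (\<lambda>t. int_iter X S t x)) = topspace X)"

definition extension ::
  "'a topology \<Rightarrow> ('a \<Rightarrow> 'a) \<Rightarrow> 'b topology \<Rightarrow> ('b \<Rightarrow> 'b) \<Rightarrow> ('a \<Rightarrow> 'b) \<Rightarrow> bool" where
  "extension X S Y R \<phi> \<longleftrightarrow>
     continuous_map X Y \<phi> \<and> \<phi> ` topspace X = topspace Y \<and>
     (\<forall>x\<in>topspace X. \<phi> (S x) = R (\<phi> x))"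

definition dense_gdelta :: "'a topology \<Rightarrow> 'a set \<Rightarrow> bool" where
  "dense_gdelta X A \<longleftrightarrow> gdelta_in X A \<and> X closure_of A = topspace X"

definition almost_one_to_one_extension ::
  "'a topology \<Rightarrow> ('a \<Rightarrow> 'a) \<Rightarrow> 'b topology \<Rightarrow> ('b \<Rightarrow> 'b) \<Rightarrow> ('a \<Rightarrow> 'b) \<Rightarrow> bool" where
  "almost_one_to_one_extension X S Y R \<phi> \<longleftrightarrow>
     extension X S Y R \<phi> \<and>
     (\<exists>X\<^sub>0. dense_gdelta X X\<^sub>0 \<and> (\<forall>x\<in>X\<^sub>0. {z \<in> topspace X. \<phi> z = \<phi> x} = {x}))"

section \<open>Cubes\<close>

text \<open>Coordinates of the \<open>k\<close>-th cube are indexed by the subsets of \<open>{1..k}\<close>; points of a cube are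
  extensional functions on this index set.\<close>

definition cube_index :: "nat \<Rightarrow> nat set set" where
  "cube_index k = Pow {1..k}"

definition cube_index_star :: "nat \<Rightarrow> nat set set" where
  "cube_index_star k = cube_index k - {{}}"

definition cube :: "nat \<Rightarrow> 'a topology \<Rightarrow> (nat set \<Rightarrow> 'a) topology" where
  "cube k X = product_topology (\<lambda>_. X) (cube_index k)"

definition diag :: "nat \<Rightarrow> 'a \<Rightarrow> nat set \<Rightarrow> 'a" where
  "diag k x = (\<lambda>\<epsilon>\<in>cube_index k. x)"

definition upper_facets :: "nat \<Rightarrow> nat set set set" where
  "upper_facets k = {{\<epsilon> \<in> cube_index k. i \<in> \<epsilon>} | i. i \<in> {1..k}}"

definition facet_elem :: "nat \<Rightarrow> int \<Rightarrow> nat set set \<Rightarrow> nat set \<Rightarrow> int" where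
  "facet_elem k t \<alpha> = (\<lambda>\<epsilon>\<in>cube_index k. if \<epsilon> \<in> \<alpha> then t else 0)"

definition face_group :: "nat \<Rightarrow> (nat set \<Rightarrow> int) set" where
  "face_group k =
     generate (product_group (cube_index k) (\<lambda>_. integer_group))
       {facet_elem k t \<alpha> | t \<alpha>. \<alpha> \<in> upper_facets k}"

definition cube_act ::
  "nat \<Rightarrow> 'a topology \<Rightarrow> ('a \<Rightarrow> 'a) \<Rightarrow> (nat set \<Rightarrow> int) \<Rightarrow> (nat set \<Rightarrow> 'a) \<Rightarrow> nat set \<Rightarrow> 'a" where
  "cube_act k X S f p = (\<lambda>\<epsilon>\<in>cube_index k. int_iter X S (f \<epsilon>) (p \<epsilon>))"

definition cube_orbit_closure ::
  "nat \<Rightarrow> 'a topology \<Rightarrow> ('a \<Rightarrow> 'a) \<Rightarrow> 'a \<Rightarrow> (nat set \<Rightarrow> 'a) set" where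
  "cube_orbit_closure k X S x =
     cube k X closure_of ((\<lambda>f. cube_act k X S f (diag k x)) ` face_group k)"

section \<open>The maximal factor of order k\<close>

text \<open>The point with \<open>{}\<close>-coordinate \<open>x\<close> and the remaining coordinates given by \<open>a\<close>.\<close>

definition cube_join :: "nat \<Rightarrow> 'a \<Rightarrow> (nat set \<Rightarrow> 'a) \<Rightarrow> nat set \<Rightarrow> 'a" where
  "cube_join k x a = (\<lambda>\<epsilon>\<in>cube_index k. if \<epsilon> = {} then x else a \<epsilon>)"

text \<open>A net of triples \<open>(f, u, v)\<close> is represented by a proper filter on the type of triples, as
  usual for \<^const>\<open>limitin\<close>. There is no loss of generality over arbitrary directed index sets:
  a net may be replaced by the image filter of its tails.\<close>

definition regionally_proximal :: "nat \<Rightarrow> 'a topology \<Rightarrow> ('a \<Rightarrow> 'a) \<Rightarrow> ('a \<times> 'a) set" where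
  "regionally_proximal k X S =
     {(x, y). x \<in> topspace X \<and> y \<in> topspace X \<and>
        (\<exists>(N :: ((nat set \<Rightarrow> int) \<times> 'a \<times> 'a) filter) a.
           N \<noteq> bot \<and>
           (\<forall>\<^sub>F (f, u, v) in N. f \<in> face_group k \<and> u \<in> topspace X \<and> v \<in> topspace X) \<and>
           a \<in> cube_index_star k \<rightarrow>\<^sub>E topspace X \<and>
           limitin (cube k X) (\<lambda>(f, u, v). cube_act k X S f (diag k u)) (cube_join k x a) N \<and>
           limitin (cube k X) (\<lambda>(f, u, v). cube_act k X S f (diag k v)) (cube_join k y a) N)}"

definition quotient_topology :: "'a topology \<Rightarrow> ('a \<times> 'a) set \<Rightarrow> 'a set topology" where
  "quotient_topology X E =
     topology (\<lambda>U. U \<subseteq> topspace X // E \<and> openin X {x \<in> topspace X. E `` {x} \<in> U})"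

lemma openin_quotient_topology:
  "openin (quotient_topology X E) U \<longleftrightarrow>
     U \<subseteq> topspace X // E \<and> openin X {x \<in> topspace X. E `` {x} \<in> U}"
proof -
  let ?P = "\<lambda>U. U \<subseteq> topspace X // E \<and> openin X {x \<in> topspace X. E `` {x} \<in> U}"
  have "?P (U \<inter> V)" if "?P U" "?P V" for U V
  proof -
    have "{x \<in> topspace X. E `` {x} \<in> U \<inter> V} =
        {x \<in> topspace X. E `` {x} \<in> U} \<inter> {x \<in> topspace X. E `` {x} \<in> V}"
      by auto
    with that show ?thesis
      by (metis (no_types, lifting) inf.coboundedI1 openin_Int)
  qed
  moreover have "?P (\<Union>K)" if "\<forall>U\<in>K. ?P U" for K
  proof -
    have "{x \<in> topspace X. E `` {x} \<in> \<Union>K} = (\<Union>U\<in>K. {x \<in> topspace X. E `` {x} \<in> U})"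
      by auto
    moreover have "openin X (\<Union>U\<in>K. {x \<in> topspace X. E `` {x} \<in> U})"
      using that by (intro openin_Union) auto
    ultimately show ?thesis
      using that by (simp add: Sup_le_iff)
  qed
  ultimately have "istopology ?P"
    unfolding istopology_def by blast
  then show ?thesis
    by (simp add: quotient_topology_def topology_inverse')
qed

lemma topspace_quotient_topology: "topspace (quotient_topology X E) = topspace X // E"
proof
  show "topspace (quotient_topology X E) \<subseteq> topspace X // E"
    by (metis openin_quotient_topology openin_topspace)
  have "{x \<in> topspace X. E `` {x} \<in> topspace X // E} = topspace X"
    by (auto intro: quotientI)
  then have "openin (quotient_topology X E) (topspace X // E)"
    by (simp add: openin_quotient_topology)
  then show "topspace X // E \<subseteq> topspace (quotient_topology X E)"
    by (rule openin_subset)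
qed

lemma quotient_map_quotient_topology:
  "quotient_map X (quotient_topology X E) (\<lambda>x. E `` {x})"
  by (auto simp: quotient_map_def topspace_quotient_topology openin_quotient_topology quotient_def)

definition max_factor :: "nat \<Rightarrow> 'a topology \<Rightarrow> ('a \<Rightarrow> 'a) \<Rightarrow> 'a set topology" where
  "max_factor k X S = quotient_topology X (regionally_proximal k X S)"

text \<open>The homeomorphism induced by \<open>S\<close> on equivalence classes is \<^term>\<open>image S\<close>.\<close>

definition max_factor_proj :: "nat \<Rightarrow> 'a topology \<Rightarrow> ('a \<Rightarrow> 'a) \<Rightarrow> 'a \<Rightarrow> 'a set" where
  "max_factor_proj k X S x = regionally_proximal k X S `` {x}"

section \<open>Characteristic factors\<close>

definition saturated :: "'a set \<Rightarrow> ('a \<Rightarrow> 'b) \<Rightarrow> 'a set \<Rightarrow> bool" where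
  "saturated A \<phi> L \<longleftrightarrow> L \<subseteq> A \<and> L = {a \<in> A. \<phi> a \<in> \<phi> ` L}"

definition cubic_characteristic_factor ::
  "nat \<Rightarrow> 'a topology \<Rightarrow> ('a \<Rightarrow> 'a) \<Rightarrow> 'b topology \<Rightarrow> ('b \<Rightarrow> 'b) \<Rightarrow> ('a \<Rightarrow> 'b) \<Rightarrow> bool" where
  "cubic_characteristic_factor d X S Y R \<phi> \<longleftrightarrow>
     extension X S Y R \<phi> \<and>
     (\<exists>X\<^sub>0. dense_gdelta X X\<^sub>0 \<and>
        (\<forall>x\<in>X\<^sub>0. saturated (cube_index_star d \<rightarrow>\<^sub>E topspace X)
           (\<lambda>p. \<lambda>\<epsilon>\<in>cube_index_star d. \<phi> (p \<epsilon>))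
           ((\<lambda>p. restrict p (cube_index_star d)) ` cube_orbit_closure d X S x)))"

end

theory Submission
  imports Defs
begin

text \<open>Let \<open>Q\<close> be the closure of the union of the face group orbits of all diagonal points. Outside a
  meagre set of \<open>x\<close> the orbit closure of the diagonal point over \<open>x\<close> is the whole slice of \<open>Q\<close> over
  \<open>x\<close>, so saturation may be tested in \<open>Q\<close>, one coordinate at a time, and by reflecting the cube at
  the coordinate \<open>{}\<close> only. If the factor map is open, there are a generic point \<open>z\<close> near the old value
  and a point \<open>y\<close> near the new value in the same fibre. As the fibres are classes of \<open>RP\<close>, the point
  with coordinate \<open>y\<close> at \<open>{}\<close> and \<open>z\<close> elsewhere lies in \<open>Q\<close>, and it can be moved along the given point
  of \<open>Q\<close>. The quotient map onto the maximal factor is made open by replacing the factor by the closure, in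
  the hyperspace of \<open>X\<close>, of the set of classes at which the class varies continuously. That \<open>RP\<close> is
  an equivalence relation follows from the minimality of diagonal points under the face group, first
  at generic points and then everywhere by means of idempotents in the enveloping semigroup.\<close>

section \<open>Compact right topological semigroups\<close>

text \<open>Two points in one fibre of the factor map of \<open>X'\<close> are known to be related
  only through their images in \<open>X\<close>: the relation \<open>RP\<close> is available
  downstairs, whereas saturation is wanted upstairs. So each correction of a coordinate descends to
  \<open>X\<close>, finds a cubical point there and lifts it back. Small neighbourhoods can be
  lifted at points whose fibre under \<open>\<theta>'\<close> is a singleton, and both points
  involved must have this property; hence the dense G-delta set \<open>D\<close> of continuity
  points has to be saturated for \<open>RP\<close>, so that a point related to one in
  \<open>D\<close> is itself in \<open>D\<close>. The generic point too is taken in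
  \<open>X\<close>, inside \<open>D\<close>, because over generic points all but one coordinate of a
  cube witnessing \<open>RP\<close> can be made equal. Replacing the classes by their limits in the
  hyperspace may shrink the fibres to proper subsets of classes, which is harmless: points of a
  fibre stay related because \<open>RP\<close> is closed. The orders match since \<open>RP k\<close>
  is a condition on cubes of dimension \<open>k + 1\<close>, and \<open>k = d - 1\<close>.\<close>

lemma compact_minimal_closed_set:
  assumes "compact_space P" and "\<A> \<noteq> {}"
    and closed: "\<And>A. A \<in> \<A> \<Longrightarrow> closedin P A \<and> A \<noteq> {}"
    and chain: "\<And>\<C>. \<C> \<subseteq> \<A> \<Longrightarrow> \<C> \<noteq> {} \<Longrightarrow> \<Inter>\<C> \<noteq> {} \<Longrightarrow> closedin P (\<Inter>\<C>) \<Longrightarrow> \<Inter>\<C> \<in> \<A>"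
  obtains M where "M \<in> \<A>" and "\<And>A. A \<in> \<A> \<Longrightarrow> A \<subseteq> M \<Longrightarrow> A = M"
proof -
  \<comment> \<open>Zorn's lemma yields maximal elements, so it is applied to the complements;
    compactness keeps the intersection of a chain nonempty.\<close>
  have "\<exists>M\<in>uminus ` \<A>. \<forall>A\<in>uminus ` \<A>. M \<subseteq> A \<longrightarrow> A = M"
  proof (rule subset_Zorn_nonempty)
    show "uminus ` \<A> \<noteq> {}"
      using assms(2) by simp
    fix \<D> assume "\<D> \<noteq> {}" and D: "subset.chain (uminus ` \<A>) \<D>"
    define \<C> where "\<C> = uminus ` \<D>"
    have C: "\<C> \<subseteq> \<A>" "\<C> \<noteq> {}"
      using D \<open>\<D> \<noteq> {}\<close> by (auto simp: \<C>_def subset_chain_def)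
    have comparable: "A \<subseteq> B \<or> B \<subseteq> A" if "A \<in> \<C>" "B \<in> \<C>" for A B
    proof -
      have "- A \<in> \<D>" "- B \<in> \<D>"
        using that by (auto simp: \<C>_def)
      then have "- A \<subseteq> - B \<or> - B \<subseteq> - A"
        using D unfolding subset_chain_def by blast
      then show ?thesis
        by blast
    qed
    have "\<Inter>\<C> \<noteq> {}"
    proof -
      have "\<Inter>\<F> \<noteq> {}" if F: "finite \<F>" "\<F> \<subseteq> \<C>" for \<F>
      proof (cases "\<F> = {}")
        case False
        then obtain m where m: "m \<in> \<F>" "\<forall>b\<in>\<F>. b \<le> m \<longrightarrow> m = b"
          using finite_has_minimal[OF F(1)] by blast
        then have "m \<subseteq> \<Inter>\<F>"
          using comparable F(2) by blast
        then show ?thesis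
          using closed C m(1) F(2) by blast
      qed simp
      moreover have "\<forall>A\<in>\<C>. closedin P A"
        using closed C by blast
      ultimately show ?thesis
        using compact_space_fip[THEN iffD1, OF assms(1), rule_format, of \<C>] by simp
    qed
    moreover have "closedin P (\<Inter>\<C>)"
      using closed C by blast
    ultimately have "\<Inter>\<C> \<in> \<A>"
      using chain C by blast
    moreover have "\<Union>\<D> = - \<Inter>\<C>"
      by (auto simp: \<C>_def)
    ultimately show "\<Union>\<D> \<in> uminus ` \<A>"
      by blast
  qed
  then obtain M where "M \<in> \<A>" and "\<forall>A\<in>\<A>. - M \<subseteq> - A \<longrightarrow> - A = - M"
    by auto
  then show thesis
    using that by (metis Compl_subset_Compl_iff double_complement)
qed

text \<open>This is the Ellis-Numakura lemma. For \<open>v\<close> in a minimal closed subsemigroup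
  \<open>M\<close>, the set \<open>M v\<close> is again a closed subsemigroup, hence all of
  \<open>M\<close>; so \<open>{p. p v = v}\<close> is nonempty, and being a closed subsemigroup it
  is all of \<open>M\<close> too, which puts \<open>v\<close> in it.\<close>

lemma exists_idempotent:
  assumes P: "compact_space P" "Hausdorff_space P"
    and A: "closedin P A" "A \<noteq> {}"
    and mult: "\<And>p q. p \<in> A \<Longrightarrow> q \<in> A \<Longrightarrow> f p q \<in> A"
    and assoc: "\<And>p q r. p \<in> A \<Longrightarrow> q \<in> A \<Longrightarrow> r \<in> A \<Longrightarrow> f (f p q) r = f p (f q r)"
    and cont: "\<And>q. q \<in> A \<Longrightarrow> continuous_map P P (\<lambda>p. f p q)"
  obtains v where "v \<in> A" and "f v v = v"
proof -
  define \<A> where "\<A> = {B. closedin P B \<and> B \<noteq> {} \<and> B \<subseteq> A \<and> (\<forall>p\<in>B. \<forall>q\<in>B. f p q \<in> B)}"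
  have "A \<in> \<A>"
    using A mult by (auto simp: \<A>_def)
  have "\<exists>M. M \<in> \<A> \<and> (\<forall>B\<in>\<A>. B \<subseteq> M \<longrightarrow> B = M)"
  proof (rule compact_minimal_closed_set[OF P(1), of \<A>])
    show "\<A> \<noteq> {}" using \<open>A \<in> \<A>\<close> by auto
    show "closedin P B \<and> B \<noteq> {}" if "B \<in> \<A>" for B
      using that by (auto simp: \<A>_def)
    show "\<Inter>\<C> \<in> \<A>" if "\<C> \<subseteq> \<A>" "\<C> \<noteq> {}" "\<Inter>\<C> \<noteq> {}" "closedin P (\<Inter>\<C>)" for \<C>
    proof -
      have "\<Inter>\<C> \<subseteq> A" using that(1,2) unfolding \<A>_def by blast
      moreover have "f p q \<in> \<Inter>\<C>" if "p \<in> \<Inter>\<C>" "q \<in> \<Inter>\<C>" for p q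
        using that \<open>\<C> \<subseteq> \<A>\<close> by (auto simp: \<A>_def)
      ultimately show ?thesis
        using that(3,4) by (simp add: \<A>_def)
    qed
  qed blast
  then obtain M where M: "M \<in> \<A>" and min: "\<And>B. B \<in> \<A> \<Longrightarrow> B \<subseteq> M \<Longrightarrow> B = M"
    by blast
  have MA: "closedin P M" "M \<subseteq> A" and Mm: "\<And>p q. p \<in> M \<Longrightarrow> q \<in> M \<Longrightarrow> f p q \<in> M"
    using M by (auto simp: \<A>_def)
  obtain v where v: "v \<in> M"
    using M by (auto simp: \<A>_def)
  have MP: "M \<subseteq> topspace P"
    using MA closedin_subset by blast
  have "(\<lambda>p. f p v) ` M \<in> \<A>"
  proof -
    have "compactin P ((\<lambda>p. f p v) ` M)"
      using v MA P cont by (meson closedin_compact_space image_compactin subsetD)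
    then have "closedin P ((\<lambda>p. f p v) ` M)"
      using P compactin_imp_closedin by blast
    moreover have "f (f p v) (f q v) = f (f (f p v) q) v" if "p \<in> M" "q \<in> M" for p q
      using that v MA(2) Mm assoc by (metis subsetD)
    ultimately show ?thesis
      using v Mm MA(2) by (auto simp: \<A>_def)
  qed
  moreover have "(\<lambda>p. f p v) ` M \<subseteq> M"
    using Mm v by auto
  ultimately have "(\<lambda>p. f p v) ` M = M"
    using min by blast
  then obtain b where b: "b \<in> M" "f b v = v"
    using v by (metis (no_types, lifting) imageE)
  define B where "B = {p \<in> M. f p v = v}"
  have "closedin P {p \<in> M. f p v \<in> {v}}"
    using v MA MP P cont by (intro closedin_continuous_map_preimage_gen[of P P]) (auto simp: closedin_Hausdorff_singleton)
  then have "B \<in> \<A>"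
    using b v MA(2) Mm by (auto simp: \<A>_def B_def assoc subset_iff)
  then have "B = M"
    using min by (simp add: B_def)
  then show thesis
    using that v MA(2) by (auto simp: B_def)
qed

section \<open>Boxes in finite products and a countable functional base\<close>

lemma product_topology_box:
  assumes "finite J" "openin (product_topology X J) G" "w \<in> G"
  obtains U where "\<And>j. j \<in> J \<Longrightarrow> openin (X j) (U j) \<and> w j \<in> U j" and "PiE J U \<subseteq> G"
proof -
  obtain U where U: "finite {i \<in> J. U i \<noteq> topspace (X i)}" "\<forall>i\<in>J. openin (X i) (U i)"
    "w \<in> PiE J U" "PiE J U \<subseteq> G"
    using assms(2,3) unfolding openin_product_topology_alt by blast
  then show thesis
    using that[of U] by (auto simp: PiE_iff)
qed

text \<open>With finitely many coordinates closures are tested on boxes alone; this links closures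
  in cubes with the box-wise predicates \<open>cubical\<close> and
  \<open>face_limit\<close>.\<close>

lemma in_closure_of_product_topology:
  assumes "finite J"
  shows "w \<in> product_topology X J closure_of B \<longleftrightarrow>
    w \<in> (\<Pi>\<^sub>E j\<in>J. topspace (X j)) \<and>
    (\<forall>U. (\<forall>j\<in>J. openin (X j) (U j) \<and> w j \<in> U j) \<longrightarrow> (\<exists>b\<in>B. b \<in> extensional J \<and> (\<forall>j\<in>J. b j \<in> U j)))"
  (is "?L \<longleftrightarrow> ?w \<and> ?R")
proof
  assume L: ?L
  have ?w
    using L by (auto simp: in_closure_of)
  moreover have ?R
  proof (intro allI impI)
    fix U assume U: "\<forall>j\<in>J. openin (X j) (U j) \<and> w j \<in> U j"
    have "w \<in> PiE J U"
      using U \<open>?w\<close> by (auto simp: PiE_iff)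
    moreover have "openin (product_topology X J) (PiE J U)"
      using U assms by (simp add: openin_PiE)
    ultimately obtain b where "b \<in> B" "b \<in> PiE J U"
      using L unfolding in_closure_of by blast
    then show "\<exists>b\<in>B. b \<in> extensional J \<and> (\<forall>j\<in>J. b j \<in> U j)"
      by (auto simp: PiE_iff)
  qed
  ultimately show "?w \<and> ?R" ..
next
  assume R: "?w \<and> ?R"
  show ?L
    unfolding in_closure_of
  proof (intro conjI allI impI)
    show "w \<in> topspace (product_topology X J)"
      using R by simp
    fix G assume "w \<in> G \<and> openin (product_topology X J) G"
    then obtain U where U: "\<And>j. j \<in> J \<Longrightarrow> openin (X j) (U j) \<and> w j \<in> U j" "PiE J U \<subseteq> G"
      using product_topology_box[OF assms, of X G w] by blast
    then obtain b where "b \<in> B" "b \<in> extensional J" "\<forall>j\<in>J. b j \<in> U j"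
      using R[THEN conjunct2, rule_format, of U] by blast
    then show "\<exists>y. y \<in> B \<and> y \<in> G"
      using U(2) by (auto simp: PiE_iff subset_iff)
  qed
qed

text \<open>The functions are the distances to a countable dense sequence. Their rational sublevel
  sets form a countable base, which serves for Baire arguments, for coding closed sets by real
  sequences and for embedding spaces into sequences.\<close>

lemma compact_metrizable_functional_base:
  assumes "compact_space X" "metrizable_space X" "topspace X \<noteq> {}"
  obtains f :: "nat \<Rightarrow> 'a \<Rightarrow> real" where "\<And>n. continuous_map X euclideanreal (f n)"
    and "\<And>U x. openin X U \<Longrightarrow> x \<in> U \<Longrightarrow>
      \<exists>n. \<exists>c\<in>\<rat>. f n x < c \<and> (\<forall>y\<in>topspace X. f n y < c \<longrightarrow> y \<in> U)"
proof -
  obtain M d where "Metric_space M d" and X: "X = Metric_space.mtopology M d"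
    using assms(2) unfolding metrizable_space_def by metis
  interpret Metric_space M d by fact
  have M: "topspace X = M" by (simp add: X)
  have "\<exists>K. finite K \<and> K \<subseteq> M \<and> M \<subseteq> (\<Union>x\<in>K. mball x (1 / Suc n))" for n
    using assms(1) compact_space_eq_mcomplete_mtotally_bounded
    unfolding X mtotally_bounded_def by auto
  then obtain K where K: "\<And>n. finite (K n) \<and> K n \<subseteq> M \<and> M \<subseteq> (\<Union>x\<in>K n. mball x (1 / Suc n))"
    by metis
  define D where "D = (\<Union>n. K n)"
  have "countable D" "D \<subseteq> M"
    using K by (auto simp: D_def countable_finite)
  have dense: "\<exists>s\<in>D. d s x < e" if x: "x \<in> M" and "e > 0" for x e
  proof -
    obtain n where "1 / real (Suc n) < e"
      using \<open>e > 0\<close> nat_approx_posE by blast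
    moreover obtain s where "s \<in> K n" "x \<in> mball s (1 / Suc n)"
      using K x by blast
    ultimately show ?thesis
      by (force simp: D_def)
  qed
  then have "D \<noteq> {}"
    using assms(3) M zero_less_one by blast
  then obtain s :: "nat \<Rightarrow> 'a" where s: "range s = D"
    using range_from_nat_into[of D] \<open>countable D\<close> by blast
  have sM: "s n \<in> M" for n
    using s \<open>D \<subseteq> M\<close> by blast
  show thesis
  proof (rule that[of "\<lambda>n. d (s n)"])
    show "continuous_map X euclideanreal (d (s n))" for n
      using continuous_on_mdist[of "s n" Self] sM by (simp add: X mtopology_of_def)
    fix U x assume U: "openin X U" "x \<in> U"
    then obtain e where e: "e > 0" "mball x e \<subseteq> U" and x: "x \<in> M"
      by (metis X openin_mtopology subsetD)
    obtain n where n: "d (s n) x < e / 2"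
      using dense[OF x, of "e / 2"] e s by fastforce
    \<comment> \<open>The rational threshold lies below \<open>e / 2\<close>, so that two distances
      smaller than \<open>c\<close> add up to less than \<open>e\<close>.\<close>
    then obtain c where c: "c \<in> \<rat>" "d (s n) x < c" "c < e / 2"
      using Rats_dense_in_real by blast
    have "y \<in> U" if "y \<in> M" "d (s n) y < c" for y
    proof -
      have "d x y \<le> d (s n) x + d (s n) y"
        using triangle[of x "s n" y] x sM that by (simp add: commute)
      then have "d x y < e"
        using that c n by linarith
      then show ?thesis
        using e(2) x that(1) by (auto simp: subset_iff)
    qed
    then show "\<exists>na. \<exists>c\<in>\<rat>. d (s na) x < c \<and> (\<forall>y\<in>topspace X. d (s na) y < c \<longrightarrow> y \<in> U)"
      using c M by blast
  qed
qed

section \<open>Enveloping semigroups\<close>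

locale zsys =
  fixes X :: "'a topology" and S :: "'a \<Rightarrow> 'a"
  assumes system: "metric_system X S"
begin

abbreviation T :: "int \<Rightarrow> 'a \<Rightarrow> 'a" where "T \<equiv> int_iter X S"

abbreviation M :: "'a set" where "M \<equiv> topspace X"

lemma compact: "compact_space X"
  and metrizable: "metrizable_space X"
  and homeo: "homeomorphic_map X X S"
  using system by (auto simp: metric_system_def)

lemma Hausdorff: "Hausdorff_space X"
  using metrizable metrizable_imp_Hausdorff_space by blast

lemma S_bij: "bij_betw S M M"
  using homeo by (simp add: bij_betw_def homeomorphic_map_def quotient_imp_surjective_map
      homeomorphic_imp_surjective_map homeomorphic_imp_injective_map)

lemma inv_S: "inv_into M S (S x) = x" "S (inv_into M S x) = x"
    "inv_into M S x \<in> M" "S x \<in> M" if "x \<in> M"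
  using that bij_betw_inv_into_left[OF S_bij] bij_betw_inv_into_right[OF S_bij]
    bij_betw_apply[OF S_bij] bij_betw_apply[OF bij_betw_inv_into[OF S_bij]] by auto

lemma continuous_inv_S: "continuous_map X X (inv_into M S)"
proof -
  obtain g where g: "homeomorphic_maps X X S g"
    using homeo homeomorphic_map_maps by blast
  then have "inv_into M S x = g x" if "x \<in> M" for x
    using that inv_S by (metis homeomorphic_maps_def)
  moreover have "continuous_map X X g"
    using g by (simp add: homeomorphic_maps_def)
  ultimately show ?thesis
    using continuous_map_eq[of X X g "inv_into M S"] by simp
qed

lemma T_continuous: "continuous_map X X (T t)"
proof -
  have "continuous_map X X (f ^^ n)" if "continuous_map X X f" for f n
    using that by (induction n) (auto intro: continuous_map_compose simp: id_def)
  then show ?thesis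
    using continuous_inv_S homeo by (simp add: int_iter_def homeomorphic_imp_continuous_map)
qed

lemma T_in [simp]: "x \<in> M \<Longrightarrow> T t x \<in> M"
  using T_continuous continuous_map_image_subset_topspace by blast

lemma T_0 [simp]: "T 0 x = x"
  by (simp add: int_iter_def)

lemma T_1 [simp]: "T 1 x = S x"
  by (simp add: int_iter_def)

lemma T_succ: "T (t + 1) x = S (T t x)" if "x \<in> M"
proof (cases "t \<ge> 0")
  case True
  then have "nat (t + 1) = Suc (nat t)" by simp
  with True show ?thesis
    by (simp add: int_iter_def)
next
  case False
  define n where "n = nat (- (t + 1))"
  define y where "y = (inv_into M S ^^ n) x"
  have n: "nat (- t) = Suc n"
    using False by (auto simp: n_def)
  have y: "T (t + 1) x = y"
    using False by (cases "t + 1 = 0") (auto simp: int_iter_def y_def n_def)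
  moreover have "T t x = inv_into M S y"
    using False n by (simp add: int_iter_def y_def)
  ultimately show ?thesis
    using inv_S(2) T_in[OF that, of "t + 1"] by simp
qed

lemma inj_S: "inj_on S M"
  using S_bij by (simp add: bij_betw_def)

lemma T_add: "T (s + t) x = T s (T t x)" if x: "x \<in> M"
proof (induction s rule: int_induct[where k = 0])
  case (step1 i)
  then show ?case
    using T_succ[OF x, of "i + t"] T_succ[of "T t x" i] x by (simp add: ac_simps)
next
  case (step2 i)
  have "S (T (i - 1 + t) x) = S (T (i - 1) (T t x))"
    using step2 T_succ[OF x, of "i - 1 + t"] T_succ[of "T t x" "i - 1"] x by simp
  then show ?case
    using inj_onD[OF inj_S] x by simp
qed simp

lemma T_inverse [simp]: "T (- t) (T t x) = x" "T t (T (- t) x) = x" if "x \<in> M"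
  using T_add[of x "- t" t] T_add[of x t "- t"] that by simp_all

lemma open_T_preimage: "openin X U \<Longrightarrow> openin X {x \<in> M. T t x \<in> U}"
  by (rule openin_continuous_map_preimage[OF T_continuous])

text \<open>One self-map of \<open>M\<close> for every index, packed as a single function on pairs,
  so that pointwise convergence is the product topology and compactness is Tychonoff's theorem. The
  index set \<open>{()}\<close> will give the enveloping semigroup of the system, the index set
  \<open>cube_index k\<close> that of the face group acting on cubes.\<close>

definition fam_top :: "'i set \<Rightarrow> ('i \<times> 'a \<Rightarrow> 'a) topology" where
  "fam_top I = product_topology (\<lambda>_. X) (I \<times> M)"

definition shift_family :: "'i set \<Rightarrow> ('i \<Rightarrow> int) \<Rightarrow> 'i \<times> 'a \<Rightarrow> 'a" where
  "shift_family I g = (\<lambda>z\<in>I \<times> M. T (g (fst z)) (snd z))"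

definition enveloping :: "'i set \<Rightarrow> ('i \<Rightarrow> int) set \<Rightarrow> ('i \<times> 'a \<Rightarrow> 'a) set" where
  "enveloping I H = fam_top I closure_of (shift_family I ` H)"

definition fam_comp :: "'i set \<Rightarrow> ('i \<times> 'a \<Rightarrow> 'a) \<Rightarrow> ('i \<times> 'a \<Rightarrow> 'a) \<Rightarrow> 'i \<times> 'a \<Rightarrow> 'a" where
  "fam_comp I p q = (\<lambda>z\<in>I \<times> M. p (fst z, q z))"

lemma topspace_family: "topspace (fam_top I) = (I \<times> M \<rightarrow>\<^sub>E M)"
  by (simp add: fam_top_def)

lemma compact_family: "compact_space (fam_top I)"
  using compact by (simp add: fam_top_def compact_space_product_topology)

lemma Hausdorff_family: "Hausdorff_space (fam_top I)"
  using Hausdorff by (simp add: fam_top_def Hausdorff_space_product_topology)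

lemma shift_family_in: "shift_family I g \<in> topspace (fam_top I)"
  by (auto simp: topspace_family shift_family_def)

lemma closed_enveloping: "closedin (fam_top I) (enveloping I H)"
  by (simp add: enveloping_def)

lemma enveloping_subset: "enveloping I H \<subseteq> (I \<times> M \<rightarrow>\<^sub>E M)"
  using closedin_subset[OF closed_enveloping, of I H] by (simp add: topspace_family)

lemma enveloping_in: "p \<in> enveloping I H \<Longrightarrow> i \<in> I \<Longrightarrow> x \<in> M \<Longrightarrow> p (i, x) \<in> M"
  using enveloping_subset[of I H] by (auto simp: PiE_iff subset_iff)

lemma shift_family_enveloping: "g \<in> H \<Longrightarrow> shift_family I g \<in> enveloping I H"
  unfolding enveloping_def using shift_family_in[of I g]
    closure_of_subset_Int[of "fam_top I" "shift_family I ` H"] by blast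

lemma enveloping_minimal:
  assumes "closedin (fam_top I) C" "\<And>g. g \<in> H \<Longrightarrow> shift_family I g \<in> C"
  shows "enveloping I H \<subseteq> C"
  unfolding enveloping_def using assms by (intro closure_of_minimal) auto

lemma continuous_family_eval:
  "i \<in> I \<Longrightarrow> x \<in> M \<Longrightarrow> continuous_map (fam_top I) X (\<lambda>p. p (i, x))"
  unfolding fam_top_def by (rule continuous_map_product_projection) auto

lemma continuous_compose_right:
  assumes q: "q \<in> (I \<times> M \<rightarrow>\<^sub>E M)"
  shows "continuous_map (fam_top I) (fam_top I) (\<lambda>p. fam_comp I p q)"
  unfolding fam_top_def[of I] continuous_map_componentwise
proof (intro conjI ballI)
  show "(\<lambda>p. fam_comp I p q) ` topspace (product_topology (\<lambda>_. X) (I \<times> M))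
      \<subseteq> extensional (I \<times> M)"
    unfolding fam_comp_def by (rule image_subsetI) simp
  fix z assume z: "z \<in> I \<times> M"
  then have "continuous_map (fam_top I) X (\<lambda>p. p (fst z, q z))"
    using q by (intro continuous_family_eval) auto
  then show "continuous_map (product_topology (\<lambda>_. X) (I \<times> M)) X (\<lambda>p. fam_comp I p q z)"
    using z by (simp add: fam_comp_def fam_top_def)
qed

text \<open>Composition from the left is continuous for group elements, since \<open>T\<close> is; a
  general limit of them need not be continuous on \<open>X\<close>.\<close>

lemma continuous_compose_shift:
  "continuous_map (fam_top I) (fam_top I) (\<lambda>q. fam_comp I (shift_family I g) q)"
  unfolding fam_top_def[of I] continuous_map_componentwise
proof (intro conjI ballI)
  show "(\<lambda>q. fam_comp I (shift_family I g) q) ` topspace (product_topology (\<lambda>_. X) (I \<times> M))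
      \<subseteq> extensional (I \<times> M)"
    unfolding fam_comp_def by (rule image_subsetI) simp
  fix z assume z: "z \<in> I \<times> M"
  have "continuous_map (fam_top I) X (\<lambda>q. q z)"
    using continuous_family_eval[of "fst z" I "snd z"] z by auto
  then have "continuous_map (fam_top I) X (T (g (fst z)) \<circ> (\<lambda>q. q z))"
    using continuous_map_compose T_continuous by blast
  then have "continuous_map (fam_top I) X (\<lambda>q. T (g (fst z)) (q z))"
    by (simp add: o_def)
  moreover have "T (g (fst z)) (q z) = fam_comp I (shift_family I g) q z"
    if "q \<in> topspace (fam_top I)" for q
  proof -
    have "q z \<in> M"
      using that z by (auto simp: topspace_family)
    then show ?thesis
      using z by (auto simp: fam_comp_def shift_family_def mem_Times_iff)
  qed
  ultimately have "continuous_map (fam_top I) X (\<lambda>q. fam_comp I (shift_family I g) q z)"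
    using continuous_map_eq[of "fam_top I" X "\<lambda>q. T (g (fst z)) (q z)"
        "\<lambda>q. fam_comp I (shift_family I g) q z"] by simp
  then show "continuous_map (product_topology (\<lambda>_. X) (I \<times> M)) X
      (\<lambda>q. fam_comp I (shift_family I g) q z)"
    by (simp add: fam_top_def)
qed

lemma compose_shift_family:
  "fam_comp I (shift_family I g) (shift_family I h) = shift_family I (\<lambda>i. g i + h i)"
  by (auto simp: fam_comp_def shift_family_def T_add mem_Times_iff fun_eq_iff)

text \<open>Two closure arguments in this order: with a group element on the left, the right factor
  runs through the closure; with the right factor fixed, the left one does.\<close>

lemma compose_enveloping:
  assumes add: "\<And>g h. g \<in> H \<Longrightarrow> h \<in> H \<Longrightarrow> (\<lambda>i. g i + h i) \<in> H"
    and p: "p \<in> enveloping I H" and q: "q \<in> enveloping I H"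
  shows "fam_comp I p q \<in> enveloping I H"
proof -
  have left: "fam_comp I (shift_family I g) q \<in> enveloping I H"
    if g: "g \<in> H" and q: "q \<in> enveloping I H" for g q
  proof -
    have "enveloping I H \<subseteq> {q \<in> topspace (fam_top I).
        fam_comp I (shift_family I g) q \<in> enveloping I H}"
    proof (rule enveloping_minimal)
      show "closedin (fam_top I) {q \<in> topspace (fam_top I).
          fam_comp I (shift_family I g) q \<in> enveloping I H}"
        by (rule closedin_continuous_map_preimage[OF continuous_compose_shift closed_enveloping])
      fix h assume "h \<in> H"
      then show "shift_family I h \<in> {q \<in> topspace (fam_top I).
          fam_comp I (shift_family I g) q \<in> enveloping I H}"
        using shift_family_enveloping[OF add[OF g]] shift_family_in by (simp add: compose_shift_family)
    qed
    then show ?thesis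
      using q by blast
  qed
  have "enveloping I H \<subseteq> {p \<in> topspace (fam_top I). fam_comp I p q \<in> enveloping I H}"
  proof (rule enveloping_minimal)
    show "closedin (fam_top I) {p \<in> topspace (fam_top I).
        fam_comp I p q \<in> enveloping I H}"
      using q enveloping_subset
      by (intro closedin_continuous_map_preimage[OF continuous_compose_right closed_enveloping]) blast
  qed (use left q shift_family_in in auto)
  then show ?thesis
    using p by blast
qed

lemma fam_comp_apply [simp]:
  "i \<in> I \<Longrightarrow> x \<in> M \<Longrightarrow> fam_comp I p q (i, x) = p (i, q (i, x))"
  by (simp add: fam_comp_def)

lemma fam_comp_assoc:
  assumes "r \<in> (I \<times> M \<rightarrow>\<^sub>E M)"
  shows "fam_comp I (fam_comp I p q) r = fam_comp I p (fam_comp I q r)"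
proof
  fix z
  show "fam_comp I (fam_comp I p q) r z = fam_comp I p (fam_comp I q r) z"
  proof (cases "z \<in> I \<times> M")
    case True
    then have "r z \<in> M"
      using assms by auto
    then show ?thesis
      using True by (auto simp: fam_comp_def)
  qed (simp add: fam_comp_def)
qed

text \<open>Compactness turns approximation into attainment: evaluation at finitely many points has
  a compact, hence closed, image, so a configuration approximated by group elements is the exact
  value of one semigroup element.\<close>

lemma enveloping_eval:
  assumes J: "finite J" "w ` J \<subseteq> I \<times> M" and w': "\<And>j. j \<in> J \<Longrightarrow> w' j \<in> M"
    and approx: "\<And>U. (\<And>j. j \<in> J \<Longrightarrow> openin X (U j) \<and> w' j \<in> U j) \<Longrightarrow>
      \<exists>g\<in>H. \<forall>j\<in>J. T (g (fst (w j))) (snd (w j)) \<in> U j"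
  obtains p where "p \<in> enveloping I H" and "\<And>j. j \<in> J \<Longrightarrow> p (w j) = w' j"
proof -
  let ?ev = "\<lambda>p. \<lambda>j\<in>J. p (w j)"
  have "continuous_map (fam_top I) (product_topology (\<lambda>_. X) J) ?ev"
    unfolding continuous_map_componentwise
  proof (intro conjI ballI)
    fix j assume j: "j \<in> J"
    then have "continuous_map (fam_top I) X (\<lambda>p. p (fst (w j), snd (w j)))"
      using J by (intro continuous_family_eval) (auto simp: image_subset_iff mem_Times_iff)
    then show "continuous_map (fam_top I) X (\<lambda>p. ?ev p j)"
      using j by simp
  qed auto
  then have "compactin (product_topology (\<lambda>_. X) J) (?ev ` enveloping I H)"
    using closedin_compact_space[OF compact_family closed_enveloping] image_compactin by blast
  then have closed: "closedin (product_topology (\<lambda>_. X) J) (?ev ` enveloping I H)"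
    using Hausdorff by (simp add: compactin_imp_closedin Hausdorff_space_product_topology)
  have "restrict w' J \<in> product_topology (\<lambda>_. X) J closure_of (?ev ` enveloping I H)"
    unfolding in_closure_of_product_topology[OF J(1)]
  proof (intro conjI allI impI)
    show "restrict w' J \<in> J \<rightarrow>\<^sub>E M"
      using w' by auto
    fix U assume U: "\<forall>j\<in>J. openin X (U j) \<and> restrict w' J j \<in> U j"
    then obtain g where g: "g \<in> H" "\<forall>j\<in>J. T (g (fst (w j))) (snd (w j)) \<in> U j"
      using approx[of U] by auto
    have "\<forall>j\<in>J. ?ev (shift_family I g) j \<in> U j"
      using g(2) J(2) by (auto simp: shift_family_def)
    then show "\<exists>b\<in>?ev ` enveloping I H. b \<in> extensional J \<and> (\<forall>j\<in>J. b j \<in> U j)"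
      using shift_family_enveloping[OF g(1), of I] by fastforce
  qed
  then have "restrict w' J \<in> ?ev ` enveloping I H"
    using closed closure_of_closedin by blast
  then obtain p where p: "p \<in> enveloping I H" "restrict w' J = ?ev p"
    by blast
  then have "p (w j) = w' j" if "j \<in> J" for j
    using that by (metis restrict_apply')
  then show thesis
    using that p by blast
qed

end

section \<open>Cubes and residual sets\<close>

lemma finite_cube_index [simp]: "finite (cube_index k)"
  by (simp add: cube_index_def)

lemma cube_index_finite: "e \<in> cube_index k \<Longrightarrow> finite e"
  by (auto simp: cube_index_def intro: finite_subset)

lemma empty_in_cube_index [simp]: "{} \<in> cube_index k"
  by (simp add: cube_index_def)

lemma cube_index_mono: "j \<le> k \<Longrightarrow> e \<in> cube_index j \<Longrightarrow> e \<in> cube_index k"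
  by (fastforce simp: cube_index_def)

lemma cube_index_Suc_cases:
  assumes "e \<in> cube_index (Suc k)"
  obtains "e \<in> cube_index k" "Suc k \<notin> e"
  | e' where "e = insert (Suc k) e'" "e' \<in> cube_index k" "Suc k \<notin> e'"
proof (cases "Suc k \<in> e")
  case True
  have "e - {Suc k} \<in> cube_index k"
    using assms by (auto simp: cube_index_def subset_iff le_Suc_eq)
  then show thesis
    using True that(2)[of "e - {Suc k}"] by auto
next
  case False
  then have "e \<in> cube_index k"
    using assms by (auto simp: cube_index_def subset_iff le_Suc_eq)
  then show thesis
    using False that(1) by blast
qed

lemma Suc_notin_cube_index: "e \<in> cube_index k \<Longrightarrow> Suc k \<notin> e"
  by (auto simp: cube_index_def)

lemma insert_Suc_cube_index: "e \<in> cube_index k \<Longrightarrow> insert (Suc k) e \<in> cube_index (Suc k)"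
  by (auto simp: cube_index_def subset_iff)

text \<open>The entry at \<open>Suc k\<close> acts on the upper facet in direction
  \<open>Suc k\<close> alone and can be chosen after all others.\<close>

lemma sum_upd_cube_index:
  fixes n :: "nat \<Rightarrow> int"
  assumes "e \<in> cube_index k"
  shows "sum (n(Suc k := t)) e = sum n e"
    and "sum (n(Suc k := t)) (insert (Suc k) e) = t + sum n e"
proof -
  show eq: "sum (n(Suc k := t)) e = sum n e"
    using Suc_notin_cube_index[OF assms] by (intro sum.cong) auto
  show "sum (n(Suc k := t)) (insert (Suc k) e) = t + sum n e"
    using Suc_notin_cube_index[OF assms] cube_index_finite[OF assms] eq by simp
qed

lemma sum_single_cube_index:
  assumes "e \<in> cube_index k"
  shows "sum (\<lambda>j. if j = i then t else 0) e = (if i \<in> e then t else (0::int))"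
  using cube_index_finite[OF assms] by (simp add: sum.delta)

text \<open>Multiplying facet elements adds one integer per direction, so an element of the face
  group is a sequence \<open>n\<close> acting at the vertex \<open>e\<close> by the sum of
  \<open>n\<close> over \<open>e\<close>. This replaces the generated group by explicit
  sums.\<close>

lemma face_group_eq: "face_group k = range (\<lambda>n. \<lambda>e\<in>cube_index k. sum n e)"
proof
  let ?G = "product_group (cube_index k) (\<lambda>_. integer_group)"
  let ?H = "{facet_elem k t \<alpha> | t \<alpha>. \<alpha> \<in> upper_facets k}"
  have single: "facet_elem k t {e \<in> cube_index k. i \<in> e}
      = (\<lambda>e\<in>cube_index k. sum (\<lambda>j. if j = i then t else 0) e)" for t i
    unfolding facet_elem_def by (rule restrict_ext) (simp add: sum_single_cube_index)
  have H: "h \<in> ?H \<longleftrightarrow> (\<exists>i\<in>{1..k}. \<exists>t. h = (\<lambda>e\<in>cube_index k. sum (\<lambda>j. if j = i then t else 0) e))" for h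
    unfolding upper_facets_def single[symmetric] by blast
  have inv_eq: "inv\<^bsub>?G\<^esub> (\<lambda>e\<in>cube_index k. g e) = (\<lambda>e\<in>cube_index k. - g e)" for g
  proof -
    have "inv\<^bsub>?G\<^esub> (\<lambda>e\<in>cube_index k. g e) = (\<lambda>e\<in>cube_index k. inv\<^bsub>integer_group\<^esub> ((\<lambda>e\<in>cube_index k. g e) e))"
      by (rule inv_product_group) auto
    then show ?thesis
      by (simp cong: restrict_cong)
  qed
  show "face_group k \<subseteq> range (\<lambda>n. \<lambda>e\<in>cube_index k. sum n e)"
  proof
    fix f assume "f \<in> face_group k"
    then have "f \<in> generate ?G ?H" by (simp add: face_group_def)
    then show "f \<in> range (\<lambda>n. \<lambda>e\<in>cube_index k. sum n e)"
    proof (induction rule: generate.induct)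
      case one
      have "\<one>\<^bsub>?G\<^esub> = (\<lambda>e\<in>cube_index k. sum (\<lambda>_. 0::int) e)"
        by (auto simp: integer_group_def)
      then show ?case by blast
    next
      case (incl h)
      then show ?case using H by blast
    next
      case (inv h)
      then obtain i t where "h = (\<lambda>e\<in>cube_index k. sum (\<lambda>j. if j = i then t else 0) e)"
        using H by blast
      then have "inv\<^bsub>?G\<^esub> h = (\<lambda>e\<in>cube_index k. sum (\<lambda>j. - (if j = i then t else 0)) e)"
        by (simp only: inv_eq sum_negf)
      then show ?case by blast
    next
      case (eng h1 h2)
      then obtain n1 n2 where h: "h1 = (\<lambda>e\<in>cube_index k. sum n1 e)" "h2 = (\<lambda>e\<in>cube_index k. sum n2 e)"
        by blast
      have "h1 \<otimes>\<^bsub>?G\<^esub> h2 = (\<lambda>e\<in>cube_index k. sum (\<lambda>j. n1 j + n2 j) e)"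
        unfolding h mult_product_group by (rule restrict_ext) (simp add: integer_group_def sum.distrib)
      then show ?case by blast
    qed
  qed
  show "range (\<lambda>n. \<lambda>e\<in>cube_index k. sum n e) \<subseteq> face_group k"
  proof
    fix f assume "f \<in> range (\<lambda>n. \<lambda>e\<in>cube_index k. sum n e :: int)"
    then obtain n :: "nat \<Rightarrow> int" where f: "f = (\<lambda>e\<in>cube_index k. sum n e)"
      by blast
    \<comment> \<open>The facet elements in the directions \<open>1\<close> to \<open>m\<close> are
      multiplied in one at a time.\<close>
    have "(\<lambda>e\<in>cube_index k. sum n (e \<inter> {1..m})) \<in> generate ?G ?H" if "m \<le> k" for m
      using that
    proof (induction m)
      case 0
      have "(\<lambda>e\<in>cube_index k. sum n (e \<inter> {1..0})) = \<one>\<^bsub>?G\<^esub>"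
        by (auto simp: integer_group_def)
      then show ?case
        using generate.one[of ?G ?H] by (simp add: restrict_def)
    next
      case (Suc m)
      let ?g = "\<lambda>e\<in>cube_index k. sum n (e \<inter> {1..m})"
      let ?h = "\<lambda>e\<in>cube_index k. sum (\<lambda>j. if j = Suc m then n (Suc m) else 0) e"
      have "?h \<in> ?H"
        unfolding H using Suc.prems by (intro bexI[of _ "Suc m"]) auto
      then have "?g \<otimes>\<^bsub>?G\<^esub> ?h \<in> generate ?G ?H"
        using generate.eng[OF Suc.IH generate.incl, of ?h] Suc.prems by (simp only: Suc_leD)
      moreover have "?g \<otimes>\<^bsub>?G\<^esub> ?h = (\<lambda>e\<in>cube_index k. sum n (e \<inter> {1..Suc m}))"
        unfolding mult_product_group
      proof (rule restrict_ext)
        fix e assume e: "e \<in> cube_index k"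
        have "sum n (e \<inter> {1..Suc m}) = sum n (e \<inter> {1..m}) + (if Suc m \<in> e then n (Suc m) else 0)"
          by (simp add: atLeastAtMostSuc_conv Int_insert_right)
        then show "?g e \<otimes>\<^bsub>integer_group\<^esub> ?h e = sum n (e \<inter> {1..Suc m})"
          using e sum_single_cube_index[OF e, of "Suc m" "n (Suc m)"] by (simp add: integer_group_def)
      qed
      ultimately show ?case by (simp only:)
    qed
    from this[of k] have "(\<lambda>e\<in>cube_index k. sum n (e \<inter> {1..k})) \<in> face_group k"
      by (simp add: face_group_def)
    moreover have "(\<lambda>e\<in>cube_index k. sum n (e \<inter> {1..k})) = f"
      unfolding f by (rule restrict_ext) (auto simp: cube_index_def Int_absorb2)
    ultimately show "f \<in> face_group k" by simp
  qed
qed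

text \<open>Stated by a countable family of dense open sets, so that intersections are obtained by
  uniting two families and Baire's theorem enters only when a point or a dense subset is
  extracted.\<close>

definition residual_in :: "'a topology \<Rightarrow> 'a set \<Rightarrow> bool" where
  "residual_in X A \<longleftrightarrow> (\<exists>\<G>. countable \<G> \<and> (\<forall>G\<in>\<G>. openin X G \<and> X closure_of G = topspace X) \<and>
     topspace X \<inter> \<Inter>\<G> \<subseteq> A)"

lemma residual_in_Int:
  assumes "residual_in X A" "residual_in X B"
  shows "residual_in X (A \<inter> B)"
proof -
  obtain \<G> \<H> where "countable \<G>" "\<forall>G\<in>\<G>. openin X G \<and> X closure_of G = topspace X" "topspace X \<inter> \<Inter>\<G> \<subseteq> A"
    and "countable \<H>" "\<forall>G\<in>\<H>. openin X G \<and> X closure_of G = topspace X" "topspace X \<inter> \<Inter>\<H> \<subseteq> B"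
    using assms unfolding residual_in_def by blast
  then show ?thesis
    unfolding residual_in_def by (intro exI[of _ "\<G> \<union> \<H>"]) auto
qed

lemma dense_gdelta_Inter:
  assumes X: "compact_space X" "Hausdorff_space X"
    and \<G>: "countable \<G>" "\<And>G. G \<in> \<G> \<Longrightarrow> openin X G \<and> X closure_of G = topspace X"
  shows "dense_gdelta X (topspace X \<inter> \<Inter>\<G>)"
proof -
  have "X closure_of \<Inter>\<G> = topspace X"
    using X \<G> by (intro Baire_category)
      (auto intro: compact_imp_locally_compact_space compact_Hausdorff_imp_regular_space)
  then have "X closure_of (topspace X \<inter> \<Inter>\<G>) = topspace X"
    using closure_of_restrict[of X "\<Inter>\<G>"] by simp
  moreover have "gdelta_in X (topspace X \<inter> \<Inter>\<G>)"
  proof -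
    \<comment> \<open>Inserting the whole space keeps the intersection inside
      \<open>topspace X\<close> even for an empty family.\<close>
    have "gdelta_in X (\<Inter>(insert (topspace X) \<G>))"
      using \<G> by (intro gdelta_in_Inter) (auto intro: open_imp_gdelta_in)
    then show ?thesis by simp
  qed
  ultimately show ?thesis
    by (simp add: dense_gdelta_def)
qed

lemma residual_in_dense_gdelta:
  assumes "compact_space X" "Hausdorff_space X" "residual_in X A"
  obtains G where "dense_gdelta X G" "G \<subseteq> A"
  using assms dense_gdelta_Inter unfolding residual_in_def by metis

lemma residual_in_meets_open:
  assumes "compact_space X" "Hausdorff_space X" "residual_in X A" "openin X U" "U \<noteq> {}"
  obtains x where "x \<in> A" "x \<in> U"
proof -
  obtain G where "dense_gdelta X G" and G: "G \<subseteq> A"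
    using residual_in_dense_gdelta assms by blast
  then have "G \<inter> U \<noteq> {}"
    using assms(4,5) openin_subset[OF assms(4)] dense_intersects_open[of X G] by (auto simp: dense_gdelta_def)
  then show thesis
    using that G by blast
qed

section \<open>Cubical points\<close>

context zsys
begin

text \<open>The dynamical parallelepipeds, that is, the closure of the points \<open>f (x, \<dots>, x)\<close> with \<open>f\<close> in the face
  group and \<open>x\<close> arbitrary; \<open>face_limit k w p\<close> says that \<open>p\<close> is in the orbit closure of \<open>w\<close>. Values outside
  \<^term>\<open>cube_index k\<close> are irrelevant. Every element of the face group is \<open>sum n\<close> for some
  integer sequence \<open>n\<close>.\<close>

definition cubical :: "nat \<Rightarrow> (nat set \<Rightarrow> 'a) \<Rightarrow> bool" where
  "cubical k p \<longleftrightarrow> (\<forall>e\<in>cube_index k. p e \<in> M) \<and>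
     (\<forall>U. (\<forall>e\<in>cube_index k. openin X (U e) \<and> p e \<in> U e) \<longrightarrow>
        (\<exists>z\<in>M. \<exists>n. \<forall>e\<in>cube_index k. T (sum n e) z \<in> U e))"

definition face_limit :: "nat \<Rightarrow> (nat set \<Rightarrow> 'a) \<Rightarrow> (nat set \<Rightarrow> 'a) \<Rightarrow> bool" where
  "face_limit k w p \<longleftrightarrow> (\<forall>e\<in>cube_index k. p e \<in> M) \<and>
     (\<forall>U. (\<forall>e\<in>cube_index k. openin X (U e) \<and> p e \<in> U e) \<longrightarrow>
        (\<exists>n. \<forall>e\<in>cube_index k. T (sum n e) (w e) \<in> U e))"

lemma cubical_in: "cubical k p \<Longrightarrow> e \<in> cube_index k \<Longrightarrow> p e \<in> M"
  by (simp add: cubical_def)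

lemma face_limit_in: "face_limit k w p \<Longrightarrow> e \<in> cube_index k \<Longrightarrow> p e \<in> M"
  by (simp add: face_limit_def)

lemma cubical_approx:
  assumes "cubical k p" "\<And>e. e \<in> cube_index k \<Longrightarrow> openin X (U e) \<and> p e \<in> U e"
  obtains z n where "z \<in> M" "\<And>e. e \<in> cube_index k \<Longrightarrow> T (sum n e) z \<in> U e"
  using assms(1)[unfolded cubical_def, THEN conjunct2, rule_format, of U] assms(2) by blast

lemma face_limit_approx:
  assumes "face_limit k w p" "\<And>e. e \<in> cube_index k \<Longrightarrow> openin X (U e) \<and> p e \<in> U e"
  obtains n where "\<And>e. e \<in> cube_index k \<Longrightarrow> T (sum n e) (w e) \<in> U e"
  using assms(1)[unfolded face_limit_def, THEN conjunct2, rule_format, of U] assms(2) by blast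

lemma cubicalI:
  assumes "\<And>e. e \<in> cube_index k \<Longrightarrow> p e \<in> M"
    and "\<And>U. (\<And>e. e \<in> cube_index k \<Longrightarrow> openin X (U e) \<and> p e \<in> U e) \<Longrightarrow>
      \<exists>z\<in>M. \<exists>n. \<forall>e\<in>cube_index k. T (sum n e) z \<in> U e"
  shows "cubical k p"
  using assms unfolding cubical_def by simp

lemma face_limitI:
  assumes "\<And>e. e \<in> cube_index k \<Longrightarrow> p e \<in> M"
    and "\<And>U. (\<And>e. e \<in> cube_index k \<Longrightarrow> openin X (U e) \<and> p e \<in> U e) \<Longrightarrow>
      \<exists>n. \<forall>e\<in>cube_index k. T (sum n e) (w e) \<in> U e"
  shows "face_limit k w p"
  using assms unfolding face_limit_def by simp

lemma cubical_eq:
  assumes "cubical k p" "\<And>e. e \<in> cube_index k \<Longrightarrow> p e = q e"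
  shows "cubical k q"
  using assms unfolding cubical_def by simp

lemma cubical_closed:
  assumes "\<And>e. e \<in> cube_index k \<Longrightarrow> p e \<in> M"
    and "\<And>U. (\<And>e. e \<in> cube_index k \<Longrightarrow> openin X (U e) \<and> p e \<in> U e) \<Longrightarrow>
      \<exists>q. cubical k q \<and> (\<forall>e\<in>cube_index k. q e \<in> U e)"
  shows "cubical k p"
proof (rule cubicalI)
  fix U assume U: "\<And>e. e \<in> cube_index k \<Longrightarrow> openin X (U e) \<and> p e \<in> U e"
  obtain q where q: "cubical k q" "\<forall>e\<in>cube_index k. q e \<in> U e"
    using assms(2)[of U] U by blast
  show "\<exists>z\<in>M. \<exists>n. \<forall>e\<in>cube_index k. T (sum n e) z \<in> U e"
    using cubical_approx[OF q(1), of U] q(2) U by metis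
qed (use assms in auto)

lemma cubical_act:
  assumes "cubical k p"
  shows "cubical k (\<lambda>e. T (t + sum n e) (p e))"
proof (rule cubicalI)
  show "T (t + sum n e) (p e) \<in> M" if "e \<in> cube_index k" for e
    using assms that by (simp add: cubical_in)
  fix U assume U: "\<And>e. e \<in> cube_index k \<Longrightarrow> openin X (U e) \<and> T (t + sum n e) (p e) \<in> U e"
  obtain z m where z: "z \<in> M"
    and m: "\<And>e. e \<in> cube_index k \<Longrightarrow> T (sum m e) z \<in> {x \<in> M. T (t + sum n e) x \<in> U e}"
    using cubical_approx[OF assms, of "\<lambda>e. {x \<in> M. T (t + sum n e) x \<in> U e}"]
      U open_T_preimage cubical_in[OF assms] by auto
  have "T (sum (\<lambda>j. n j + m j) e) (T t z) \<in> U e" if "e \<in> cube_index k" for e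
  proof -
    have "T (sum (\<lambda>j. n j + m j) e) (T t z) = T (t + sum n e) (T (sum m e) z)"
      using z by (simp add: T_add[symmetric] sum.distrib ac_simps)
    then show ?thesis
      using m[OF that] by simp
  qed
  then show "\<exists>z\<in>M. \<exists>n. \<forall>e\<in>cube_index k. T (sum n e) z \<in> U e"
    using z T_in by blast
qed

lemma cubical_facet:
  assumes "cubical k p"
  shows "cubical k (\<lambda>e. if i \<in> e then T t (p e) else p e)"
  by (rule cubical_eq[OF cubical_act[OF assms, of 0 "\<lambda>j. if j = i then t else 0"]])
    (simp add: sum_single_cube_index)

lemma cubical_face_limit:
  assumes "cubical k w" "face_limit k w p"
  shows "cubical k p"
proof (rule cubical_closed)
  fix U assume U: "\<And>e. e \<in> cube_index k \<Longrightarrow> openin X (U e) \<and> p e \<in> U e"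
  then obtain n where "\<And>e. e \<in> cube_index k \<Longrightarrow> T (sum n e) (w e) \<in> U e"
    using face_limit_approx[OF assms(2)] by metis
  then show "\<exists>q. cubical k q \<and> (\<forall>e\<in>cube_index k. q e \<in> U e)"
    using cubical_act[OF assms(1), of 0 n] by (intro exI conjI) auto
qed (use assms face_limit_in in auto)

lemma face_limit_trans:
  assumes "face_limit k w p" "face_limit k p q" and w: "\<And>e. e \<in> cube_index k \<Longrightarrow> w e \<in> M"
  shows "face_limit k w q"
proof (rule face_limitI)
  fix U assume U: "\<And>e. e \<in> cube_index k \<Longrightarrow> openin X (U e) \<and> q e \<in> U e"
  then obtain n where n: "\<And>e. e \<in> cube_index k \<Longrightarrow> T (sum n e) (p e) \<in> U e"
    using face_limit_approx[OF assms(2)] by metis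
  obtain m where m: "\<And>e. e \<in> cube_index k \<Longrightarrow> T (sum m e) (w e) \<in> {x \<in> M. T (sum n e) x \<in> U e}"
    using face_limit_approx[OF assms(1), of "\<lambda>e. {x \<in> M. T (sum n e) x \<in> U e}"]
      U n open_T_preimage face_limit_in[OF assms(1)] by auto
  have "T (sum (\<lambda>j. n j + m j) e) (w e) \<in> U e" if "e \<in> cube_index k" for e
    using m[OF that] w[OF that] by (simp add: T_add sum.distrib)
  then show "\<exists>n. \<forall>e\<in>cube_index k. T (sum n e) (w e) \<in> U e"
    by blast
qed (use assms face_limit_in in auto)

lemma cubical_diag: "x \<in> M \<Longrightarrow> cubical k (\<lambda>_. x)"
  by (rule cubicalI) (auto intro!: bexI[of _ x] exI[of _ "\<lambda>_. 0"])

lemma cubical_mono: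
  assumes "cubical k p" "j \<le> k"
  shows "cubical j p"
proof (rule cubicalI)
  fix U assume U: "\<And>e. e \<in> cube_index j \<Longrightarrow> openin X (U e) \<and> p e \<in> U e"
  define V where "V = (\<lambda>e. if e \<in> cube_index j then U e else M)"
  have "openin X (V e) \<and> p e \<in> V e" if "e \<in> cube_index k" for e
    using U cubical_in[OF assms(1) that] by (simp add: V_def)
  then obtain z n where z: "z \<in> M" and n: "\<And>e. e \<in> cube_index k \<Longrightarrow> T (sum n e) z \<in> V e"
    using cubical_approx[OF assms(1), of V] by metis
  have "T (sum n e) z \<in> U e" if "e \<in> cube_index j" for e
    using n[OF cube_index_mono[OF assms(2) that]] that by (simp add: V_def)
  then show "\<exists>z\<in>M. \<exists>n. \<forall>e\<in>cube_index j. T (sum n e) z \<in> U e"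
    using z by blast
qed (use assms cubical_in cube_index_mono in blast)

text \<open>The new direction gets the shift \<open>0\<close>, so both facets follow the same
  approximation.\<close>

lemma cubical_double:
  assumes "cubical k p"
  shows "cubical (Suc k) (\<lambda>e. p (e - {Suc k}))"
proof (rule cubicalI)
  show "p (e - {Suc k}) \<in> M" if "e \<in> cube_index (Suc k)" for e
    using that by (cases rule: cube_index_Suc_cases) (auto intro: cubical_in[OF assms])
  fix U assume U: "\<And>e. e \<in> cube_index (Suc k) \<Longrightarrow> openin X (U e) \<and> p (e - {Suc k}) \<in> U e"
  have "openin X (U e \<inter> U (insert (Suc k) e)) \<and> p e \<in> U e \<inter> U (insert (Suc k) e)"
    if "e \<in> cube_index k" for e
    using U[of e] U[of "insert (Suc k) e"] that Suc_notin_cube_index[OF that]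
      insert_Suc_cube_index[OF that] cube_index_mono[of k "Suc k" e] by auto
  then obtain z n where z: "z \<in> M"
    and n: "\<And>e. e \<in> cube_index k \<Longrightarrow> T (sum n e) z \<in> U e \<inter> U (insert (Suc k) e)"
    using cubical_approx[OF assms, of "\<lambda>e. U e \<inter> U (insert (Suc k) e)"] by metis
  have "T (sum (n(Suc k := 0)) e) z \<in> U e" if "e \<in> cube_index (Suc k)" for e
    using that
  proof (cases rule: cube_index_Suc_cases)
    case 1
    then show ?thesis using n by (simp add: sum_upd_cube_index del: fun_upd_apply)
  next
    case (2 e')
    then show ?thesis using n by (simp add: sum_upd_cube_index del: fun_upd_apply)
  qed
  then show "\<exists>z\<in>M. \<exists>n. \<forall>e\<in>cube_index (Suc k). T (sum n e) z \<in> U e"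
    using z by blast
qed

text \<open>Reversing a direction means starting from the other end of its edge: the base point
  becomes \<open>T (sum n \<sigma>) z\<close> and the entries of \<open>n\<close> on
  \<open>\<sigma>\<close> change sign.\<close>

lemma cubical_reflect:
  assumes "cubical k p" and \<sigma>: "\<sigma> \<in> cube_index k"
  shows "cubical k (\<lambda>e. p (sym_diff e \<sigma>))"
proof (rule cubicalI)
  have in_index: "sym_diff e \<sigma> \<in> cube_index k" if "e \<in> cube_index k" for e
    using that \<sigma> by (auto simp: cube_index_def)
  then show "p (sym_diff e \<sigma>) \<in> M" if "e \<in> cube_index k" for e
    using that assms cubical_in by blast
  have invol: "sym_diff (sym_diff e \<sigma>) \<sigma> = e" for e
    by auto
  fix U assume U: "\<And>e. e \<in> cube_index k \<Longrightarrow> openin X (U e) \<and> p (sym_diff e \<sigma>) \<in> U e"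
  have "openin X (U (sym_diff e \<sigma>)) \<and> p e \<in> U (sym_diff e \<sigma>)" if "e \<in> cube_index k" for e
    using U[OF in_index[OF that]] unfolding invol .
  then obtain z n where z: "z \<in> M"
    and n: "\<And>e. e \<in> cube_index k \<Longrightarrow> T (sum n e) z \<in> U (sym_diff e \<sigma>)"
    using cubical_approx[OF assms(1), of "\<lambda>e. U (sym_diff e \<sigma>)"] by metis
  define n' where "n' = (\<lambda>j. if j \<in> \<sigma> then - n j else n j)"
  have "T (sum n' e) (T (sum n \<sigma>) z) \<in> U e" if e: "e \<in> cube_index k" for e
  proof -
    have fin: "finite e" "finite \<sigma>"
      using e \<sigma> cube_index_finite by auto
    have "sum n' e = sum n' (e - \<sigma>) + sum n' (e \<inter> \<sigma>)"
      using fin by (metis Int_Diff_Un Int_Diff_disjoint add.commute finite_Diff finite_Int sum.union_disjoint)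
    also have "\<dots> = sum n (e - \<sigma>) - sum n (e \<inter> \<sigma>)"
      by (simp add: n'_def sum_negf)
    finally have "sum n' e + sum n \<sigma> = sum n (e - \<sigma>) + sum n (\<sigma> - e)"
      using sum.Int_Diff[OF fin(2), of n e] by (simp add: Int_commute)
    also have "\<dots> = sum n (sym_diff e \<sigma>)"
      using fin by (intro sum.union_disjoint[symmetric]) auto
    finally have "T (sum n' e) (T (sum n \<sigma>) z) = T (sum n (sym_diff e \<sigma>)) z"
      using z by (simp add: T_add[symmetric])
    then show ?thesis
      using n[OF in_index[OF e]] by (simp only: invol)
  qed
  then show "\<exists>z\<in>M. \<exists>n. \<forall>e\<in>cube_index k. T (sum n e) z \<in> U e"
    using z T_in by blast
qed

lemma face_limit_imp_cubical:
  "x \<in> M \<Longrightarrow> face_limit k (\<lambda>_. x) p \<Longrightarrow> cubical k p"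
  using cubical_diag cubical_face_limit by blast

lemma in_cube_orbit_closure_iff:
  assumes "x \<in> M"
  shows "p \<in> cube_orbit_closure k X S x \<longleftrightarrow>
    p \<in> (cube_index k \<rightarrow>\<^sub>E M) \<and> face_limit k (\<lambda>_. x) p"
proof -
  have orbit: "(\<lambda>f. cube_act k X S f (diag k x)) ` face_group k
      = range (\<lambda>n. \<lambda>e\<in>cube_index k. T (sum n e) x)"
    unfolding face_group_eq image_image cube_act_def diag_def
    by (intro image_cong restrict_ext refl) simp
  show ?thesis
    unfolding cube_orbit_closure_def cube_def orbit in_closure_of_product_topology[OF finite_cube_index]
    by (auto simp: face_limit_def)
qed

definition generic :: "nat \<Rightarrow> 'a set" where
  "generic k = {x \<in> M. \<forall>p. cubical k p \<and> p {} = x \<longrightarrow> face_limit k (\<lambda>_. x) p}"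

text \<open>The orbit closures depend lower semicontinuously on the base point, so that the base point is
  a point of continuity outside a meagre set.\<close>

lemma residual_generic: "residual_in X (generic k)"
proof (cases "M = {}")
  case True
  then show ?thesis
    unfolding residual_in_def by (intro exI[of _ "{}"]) auto
next
  case False
  obtain f :: "nat \<Rightarrow> 'a \<Rightarrow> real" where f: "\<And>n. continuous_map X euclideanreal (f n)"
    and base: "\<And>U x. openin X U \<Longrightarrow> x \<in> U \<Longrightarrow>
      \<exists>n. \<exists>c\<in>\<rat>. f n x < c \<and> (\<forall>y\<in>M. f n y < c \<longrightarrow> y \<in> U)"
    using compact_metrizable_functional_base[OF compact metrizable False] by metis
  define B where "B = (\<lambda>(n, c). {y \<in> M. f n y < c})"
  have B_open: "openin X (B b)" for b
  proof -
    have "openin X {y \<in> M. f (fst b) y \<in> {..<snd b}}"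
      using f by (intro openin_continuous_map_preimage) auto
    then show ?thesis
      by (simp add: B_def case_prod_beta)
  qed
  define W where "W = (\<lambda>\<beta>. {x \<in> M. \<exists>n. \<forall>e\<in>cube_index k. T (sum n e) x \<in> B (\<beta> e)})"
  \<comment> \<open>\<open>W \<beta>\<close> is the open set of base points whose orbit meets the
    basic box \<open>\<beta>\<close>; adding its exterior makes it dense, so a point in every
    \<open>G \<beta>\<close> lies on the boundary of no \<open>W \<beta>\<close>.\<close>
  define G where "G = (\<lambda>\<beta>. W \<beta> \<union> (M - X closure_of W \<beta>))"
  have W_open: "openin X (W \<beta>)" for \<beta>
  proof -
    have "W \<beta> = (\<Union>n. (\<Inter>e\<in>cube_index k. {x \<in> M. T (sum n e) x \<in> B (\<beta> e)}))"
      unfolding W_def using empty_in_cube_index[of k] by blast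
    also have "openin X \<dots>"
    proof -
      have "cube_index k \<noteq> {}"
        using empty_in_cube_index[of k] by blast
      then show ?thesis
        by (intro openin_Union ballI) (auto intro!: openin_INT2 open_T_preimage B_open)
    qed
    finally show ?thesis .
  qed
  have "openin X (G \<beta>) \<and> X closure_of (G \<beta>) = M" for \<beta>
  proof
    show "openin X (G \<beta>)"
      unfolding G_def using W_open by (intro openin_Un openin_diff) auto
    have "M - X closure_of W \<beta> \<subseteq> X closure_of (M - X closure_of W \<beta>)"
      by (intro closure_of_subset) auto
    then have "M \<subseteq> X closure_of (G \<beta>)"
      by (auto simp: G_def)
    then show "X closure_of (G \<beta>) = M"
      by (simp add: closure_of_subset_topspace subset_antisym)
  qed
  moreover have "countable (G ` (cube_index k \<rightarrow>\<^sub>E UNIV \<times> \<rat>))"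
    by (intro countable_image countable_PiE) (auto simp: countable_rat)
  moreover have "M \<inter> \<Inter>(G ` (cube_index k \<rightarrow>\<^sub>E UNIV \<times> \<rat>)) \<subseteq> generic k"
  proof
    fix x assume x: "x \<in> M \<inter> \<Inter>(G ` (cube_index k \<rightarrow>\<^sub>E UNIV \<times> \<rat>))"
    have "face_limit k (\<lambda>_. x) p" if p: "cubical k p" "p {} = x" for p
    proof (rule face_limitI)
      fix U assume U: "\<And>e. e \<in> cube_index k \<Longrightarrow> openin X (U e) \<and> p e \<in> U e"
      have "\<forall>e\<in>cube_index k. \<exists>b. b \<in> UNIV \<times> \<rat> \<and> p e \<in> B b \<and> B b \<subseteq> U e"
      proof
        fix e assume e: "e \<in> cube_index k"
        then obtain n c where "c \<in> \<rat>" "f n (p e) < c" "\<forall>y\<in>M. f n y < c \<longrightarrow> y \<in> U e"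
          using base[of "U e" "p e"] U by blast
        then show "\<exists>b. b \<in> UNIV \<times> \<rat> \<and> p e \<in> B b \<and> B b \<subseteq> U e"
          using cubical_in[OF p(1) e] by (intro exI[of _ "(n, c)"]) (auto simp: B_def)
      qed
      then obtain \<beta> where \<beta>: "\<And>e. e \<in> cube_index k \<Longrightarrow> \<beta> e \<in> UNIV \<times> \<rat> \<and> p e \<in> B (\<beta> e) \<and> B (\<beta> e) \<subseteq> U e"
        by metis
      let ?\<beta> = "restrict \<beta> (cube_index k)"
      have "?\<beta> \<in> cube_index k \<rightarrow>\<^sub>E UNIV \<times> \<rat>"
        using \<beta> by (simp add: PiE_iff)
      then have "x \<in> G ?\<beta>"
        using x by blast
      have "x \<in> W ?\<beta>"
      proof (rule ccontr)
        assume "x \<notin> W ?\<beta>"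
        \<comment> \<open>The exterior neighbourhood of \<open>x\<close> is imposed at the
          coordinate \<open>{}\<close>; since \<open>p {} = x\<close>, the approximating base point
          \<open>z\<close> would lie in it and in \<open>W\<close> at once.\<close>
        define O' where "O' = M - X closure_of W ?\<beta>"
        have O': "openin X O'" "x \<in> O'"
          using \<open>x \<in> G ?\<beta>\<close> \<open>x \<notin> W ?\<beta>\<close> by (auto simp: O'_def G_def intro: openin_diff)
        define V where "V = (\<lambda>e. if e = {} then B (\<beta> e) \<inter> O' else B (\<beta> e))"
        have "openin X (V e) \<and> p e \<in> V e" if "e \<in> cube_index k" for e
          using \<beta>[OF that] O' B_open p(2) by (auto simp: V_def)
        then obtain z n where z: "z \<in> M" "\<And>e. e \<in> cube_index k \<Longrightarrow> T (sum n e) z \<in> V e"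
          using cubical_approx[OF p(1), of V] by metis
        have "T (sum n e) z \<in> B (?\<beta> e)" if "e \<in> cube_index k" for e
          using z(2)[OF that] that by (simp add: V_def split: if_splits)
        moreover have "z \<in> O'"
          using z(2)[of "{}"] by (simp add: V_def)
        ultimately have "z \<in> O'" "z \<in> W ?\<beta>"
          using z(1) unfolding W_def by blast+
        then show False
          using closure_of_subset[of "W ?\<beta>" X] openin_subset[OF W_open] by (auto simp: O'_def)
      qed
      then show "\<exists>n. \<forall>e\<in>cube_index k. T (sum n e) x \<in> U e"
        using \<beta> by (fastforce simp: W_def)
    qed (use p cubical_in in auto)
    then show "x \<in> generic k"
      using x by (simp add: generic_def)
  qed
  ultimately show ?thesis
    unfolding residual_in_def by blast
qed

section \<open>The regionally proximal relation\<close>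

text \<open>Two \<open>k\<close>-cubes glued along direction \<open>Suc k\<close>: they agree except
  at their base vertices, which carry \<open>x\<close> and \<open>y\<close>.\<close>

definition corner :: "nat \<Rightarrow> 'a \<Rightarrow> 'a \<Rightarrow> (nat set \<Rightarrow> 'a) \<Rightarrow> nat set \<Rightarrow> 'a" where
  "corner k x y a = (\<lambda>e. if e = {} then x else if e = {Suc k} then y else a (e - {Suc k}))"

lemma corner_lower: "e \<in> cube_index k \<Longrightarrow> corner k x y a e = (if e = {} then x else a e)"
  using Suc_notin_cube_index[of e k] by (auto simp: corner_def)

lemma corner_upper:
  "e \<in> cube_index k \<Longrightarrow> corner k x y a (insert (Suc k) e) = (if e = {} then y else a e)"
  using Suc_notin_cube_index[of e k] by (auto simp: corner_def)

text \<open>A single cube of one dimension more replaces the two nets in the definition of the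
  regionally proximal relation; for minimal systems both relations turn out to agree.\<close>

definition RP :: "nat \<Rightarrow> 'a \<Rightarrow> 'a \<Rightarrow> bool" where
  "RP k x y \<longleftrightarrow> (\<exists>a. cubical (Suc k) (corner k x y a))"

lemma RP_in: "RP k x y \<Longrightarrow> x \<in> M" "RP k x y \<Longrightarrow> y \<in> M"
  using cubical_in[of "Suc k" _ "{}"] cubical_in[of "Suc k" _ "{Suc k}"]
    insert_Suc_cube_index[of "{}" k] by (fastforce simp: RP_def corner_def)+

end

context zsys
begin

text \<open>The converse of \<open>enveloping_eval\<close>: exact values at finitely many points are
  approximated by one group element.\<close>

lemma enveloping_approx_family:
  assumes q: "q \<in> enveloping I H" and J: "finite J" "w ` J \<subseteq> I \<times> M"
    and U: "\<And>j. j \<in> J \<Longrightarrow> openin X (U j) \<and> q (w j) \<in> U j"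
  obtains g where "g \<in> H" and "\<And>j. j \<in> J \<Longrightarrow> T (g (fst (w j))) (snd (w j)) \<in> U j"
proof -
  let ?O = "\<lambda>j. {p \<in> topspace (fam_top I). p (w j) \<in> U j}"
  have "openin (fam_top I) (?O j)" if "j \<in> J" for j
  proof -
    have "continuous_map (fam_top I) X (\<lambda>p. p (fst (w j), snd (w j)))"
      using J that by (intro continuous_family_eval) (auto simp: image_subset_iff mem_Times_iff)
    then show ?thesis
      using U that openin_continuous_map_preimage by fastforce
  qed
  define G where "G = topspace (fam_top I) \<inter> \<Inter>(?O ` J)"
  have "openin (fam_top I) G"
    using J \<open>\<And>j. j \<in> J \<Longrightarrow> openin _ (?O j)\<close> by (cases "J = {}") (auto simp: G_def intro!: openin_Int openin_Inter)
  moreover have "q \<in> G"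
    using q U enveloping_subset[of I H] by (auto simp: topspace_family G_def)
  ultimately have "\<exists>y. y \<in> shift_family I ` H \<and> y \<in> G"
    using q[unfolded enveloping_def in_closure_of, THEN conjunct2, rule_format, of G] by simp
  then obtain g where g: "g \<in> H" "shift_family I g \<in> G"
    by blast
  then have "T (g (fst (w j))) (snd (w j)) \<in> U j" if "j \<in> J" for j
    using J that g(2) by (auto simp: G_def shift_family_def image_subset_iff)
  then show thesis
    using that g(1) by blast
qed

section \<open>The enveloping semigroup acting on cubical points\<close>

abbreviation E :: "(unit \<times> 'a \<Rightarrow> 'a) set" where "E \<equiv> enveloping {()} UNIV"

abbreviation E_mult :: "(unit \<times> 'a \<Rightarrow> 'a) \<Rightarrow> (unit \<times> 'a \<Rightarrow> 'a) \<Rightarrow> unit \<times> 'a \<Rightarrow> 'a" where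
  "E_mult \<equiv> fam_comp {()}"

lemma E_mult_in: "p \<in> E \<Longrightarrow> q \<in> E \<Longrightarrow> E_mult p q \<in> E"
  by (rule compose_enveloping) auto

lemma E_in [simp]: "p \<in> E \<Longrightarrow> x \<in> M \<Longrightarrow> p ((), x) \<in> M"
  by (rule enveloping_in) auto

lemma E_mult_assoc: "r \<in> E \<Longrightarrow> E_mult (E_mult p q) r = E_mult p (E_mult q r)"
  using enveloping_subset by (intro fam_comp_assoc) blast

lemma principal_left_ideal_closed:
  assumes "q \<in> enveloping I H"
  shows "closedin (fam_top I) ((\<lambda>p. fam_comp I p q) ` enveloping I H)"
proof -
  have "continuous_map (fam_top I) (fam_top I) (\<lambda>p. fam_comp I p q)"
    using assms enveloping_subset by (intro continuous_compose_right) blast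
  then have "compactin (fam_top I) ((\<lambda>p. fam_comp I p q) ` enveloping I H)"
    using closedin_compact_space[OF compact_family closed_enveloping] image_compactin by blast
  then show ?thesis
    using compactin_imp_closedin[OF Hausdorff_family] by blast
qed

text \<open>The last clause is minimality in the form in which it is used: every element of the
  ideal generates all of it.\<close>

definition minimal_left_ideal :: "(unit \<times> 'a \<Rightarrow> 'a) set \<Rightarrow> bool" where
  "minimal_left_ideal J \<longleftrightarrow> closedin (fam_top {()}) J \<and> J \<noteq> {} \<and> J \<subseteq> E \<and>
     (\<forall>p\<in>E. \<forall>q\<in>J. E_mult p q \<in> J) \<and> (\<forall>q\<in>J. \<forall>r\<in>J. \<exists>p\<in>E. E_mult p q = r)"

lemma ex_minimal_left_ideal: "\<exists>J. minimal_left_ideal J"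
proof -
  define \<L> where "\<L> = {L. closedin (fam_top {()}) L \<and> L \<noteq> {} \<and> L \<subseteq> E \<and>
    (\<forall>p\<in>E. \<forall>q\<in>L. E_mult p q \<in> L)}"
  have "E \<noteq> {}"
    using shift_family_enveloping[of _ UNIV "{()}"] by blast
  then have "E \<in> \<L>"
    using closed_enveloping E_mult_in by (auto simp: \<L>_def)
  have "\<exists>M. M \<in> \<L> \<and> (\<forall>L\<in>\<L>. L \<subseteq> M \<longrightarrow> L = M)"
  proof (rule compact_minimal_closed_set[OF compact_family, of \<L>])
    show "\<L> \<noteq> {}" using \<open>E \<in> \<L>\<close> by auto
    show "closedin (fam_top {()}) L \<and> L \<noteq> {}" if "L \<in> \<L>" for L
      using that by (auto simp: \<L>_def)
    show "\<Inter>\<C> \<in> \<L>" if C: "\<C> \<subseteq> \<L>" "\<C> \<noteq> {}" "\<Inter>\<C> \<noteq> {}" "closedin (fam_top {()}) (\<Inter>\<C>)" for \<C>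
    proof -
      have "\<Inter>\<C> \<subseteq> E" using C(1,2) unfolding \<L>_def by blast
      moreover have "E_mult p q \<in> \<Inter>\<C>" if "p \<in> E" "q \<in> \<Inter>\<C>" for p q
        using that C(1) by (auto simp: \<L>_def)
      ultimately show ?thesis
        using C(3,4) by (simp add: \<L>_def)
    qed
  qed blast
  then obtain J where J: "J \<in> \<L>" and min: "\<And>L. L \<in> \<L> \<Longrightarrow> L \<subseteq> J \<Longrightarrow> L = J"
    by blast
  have JE: "J \<subseteq> E" and left: "\<And>p q. p \<in> E \<Longrightarrow> q \<in> J \<Longrightarrow> E_mult p q \<in> J"
    using J by (auto simp: \<L>_def)
  have "\<exists>p\<in>E. E_mult p q = r" if q: "q \<in> J" and r: "r \<in> J" for q r
  proof -
    have "q \<in> E" using q JE by blast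
    have "E_mult p (E_mult p' q) \<in> (\<lambda>p. E_mult p q) ` E" if "p \<in> E" "p' \<in> E" for p p'
      using that \<open>q \<in> E\<close> E_mult_in E_mult_assoc[symmetric] by simp
    then have "(\<lambda>p. E_mult p q) ` E \<in> \<L>"
      using principal_left_ideal_closed[OF \<open>q \<in> E\<close>] \<open>E \<noteq> {}\<close> \<open>q \<in> E\<close> E_mult_in by (auto simp: \<L>_def)
    then have "(\<lambda>p. E_mult p q) ` E = J"
      using min left q by blast
    then show ?thesis
      using r by blast
  qed
  then have "minimal_left_ideal J"
    using J by (simp add: \<L>_def minimal_left_ideal_def)
  then show ?thesis ..
qed

text \<open>One group element approximates \<open>v\<close> at all the finitely many moved vertices
  simultaneously, so invariance under the integers passes to limits in \<open>E\<close> because the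
  cubical points are closed.\<close>

lemma cubical_enveloping:
  assumes p: "cubical k p" and v: "v \<in> E"
    and inv: "\<And>t. cubical k (\<lambda>e. if P e then T t (p e) else p e)"
  shows "cubical k (\<lambda>e. if P e then v ((), p e) else p e)"
proof (rule cubical_closed)
  show "(if P e then v ((), p e) else p e) \<in> M" if "e \<in> cube_index k" for e
    using v cubical_in[OF p that] by simp
  fix U assume U: "\<And>e. e \<in> cube_index k \<Longrightarrow>
      openin X (U e) \<and> (if P e then v ((), p e) else p e) \<in> U e"
  obtain g where g: "\<And>e. e \<in> {e \<in> cube_index k. P e} \<Longrightarrow> T (g ()) (p e) \<in> U e"
  proof (rule enveloping_approx_family[OF v, of "{e \<in> cube_index k. P e}" "\<lambda>e. ((), p e)" U])
    show "openin X (U e) \<and> v ((), p e) \<in> U e" if "e \<in> {e \<in> cube_index k. P e}" for e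
      using U[of e] that by simp
  qed (use cubical_in[OF p] that in auto)
  have "(if P e then T (g ()) (p e) else p e) \<in> U e" if "e \<in> cube_index k" for e
    using g[of e] U[OF that] that by (simp split: if_splits)
  then show "\<exists>q. cubical k q \<and> (\<forall>e\<in>cube_index k. q e \<in> U e)"
    using inv[of "g ()"] by blast
qed

lemma cubical_facet_enveloping:
  "cubical k p \<Longrightarrow> v \<in> E \<Longrightarrow> cubical k (\<lambda>e. if i \<in> e then v ((), p e) else p e)"
  by (rule cubical_enveloping) (auto intro: cubical_facet)

lemma RP_enveloping:
  assumes "RP k x y" "v \<in> E"
  shows "RP k (v ((), x)) (v ((), y))"
proof -
  obtain a where a: "cubical (Suc k) (corner k x y a)"
    using assms(1) by (auto simp: RP_def)
  have "cubical (Suc k) (\<lambda>e. if True then T t (corner k x y a e) else corner k x y a e)" for t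
    using cubical_act[OF a, of t "\<lambda>_. 0"] by simp
  from cubical_enveloping[OF a assms(2), of "\<lambda>_. True", OF this]
  have "cubical (Suc k) (\<lambda>e. v ((), corner k x y a e))"
    by simp
  moreover have "(\<lambda>e. v ((), corner k x y a e)) = corner k (v ((), x)) (v ((), y)) (\<lambda>e. v ((), a e))"
    by (auto simp: corner_def)
  ultimately show ?thesis
    by (auto simp: RP_def)
qed

lemma RP_T: "RP k x y \<Longrightarrow> RP k (T t x) (T t y)"
  using RP_enveloping[OF _ shift_family_enveloping[of "\<lambda>_. t"], of k x y] RP_in
  by (simp add: shift_family_def)

lemma RP_refl: "x \<in> M \<Longrightarrow> RP k x x"
  unfolding RP_def
  by (intro exI[of _ "\<lambda>_. x"] cubical_eq[OF cubical_diag]) (auto simp: corner_def)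

text \<open>Reflection in direction \<open>Suc k\<close> exchanges the two glued facets.\<close>

lemma RP_sym:
  assumes "RP k x y"
  shows "RP k y x"
proof -
  obtain a where a: "cubical (Suc k) (corner k x y a)"
    using assms by (auto simp: RP_def)
  have "cubical (Suc k) (\<lambda>e. corner k x y a (sym_diff e {Suc k}))"
    using insert_Suc_cube_index[of "{}" k] by (intro cubical_reflect[OF a]) simp
  moreover have "corner k x y a (sym_diff e {Suc k}) = corner k y x a e" if "e \<in> cube_index (Suc k)" for e
    using that
  proof (cases rule: cube_index_Suc_cases)
    case 1
    then have "sym_diff e {Suc k} = insert (Suc k) e" by auto
    then show ?thesis
      using 1 by (simp add: corner_lower corner_upper)
  next
    case (2 e')
    then have "sym_diff e {Suc k} = e'" by auto
    then show ?thesis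
      using 2 by (simp add: corner_lower corner_upper)
  qed
  ultimately have "cubical (Suc k) (corner k y x a)"
    by (rule cubical_eq)
  then show ?thesis
    by (auto simp: RP_def)
qed

text \<open>An idempotent applied to the upper facet moves \<open>z\<close> to \<open>v z\<close> but spoils the equality of the
  two facets; applying it once more to the remaining coordinates of both facets restores it.\<close>

lemma RP_idempotent:
  assumes "RP k x z" and v: "v \<in> E" and idem: "E_mult v v = v"
  shows "RP k x (v ((), z))"
proof -
  obtain a where a: "cubical (Suc k) (corner k x z a)"
    using assms(1) by (auto simp: RP_def)
  have vv: "v ((), v ((), y)) = v ((), y)" if "y \<in> M" for y
    using idem fam_comp_apply[of "()" "{()}" y v v] that by simp
  define p where "p = (\<lambda>e. if Suc k \<in> e then v ((), corner k x z a e) else corner k x z a e)"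
  have p: "cubical (Suc k) p"
    unfolding p_def by (rule cubical_facet_enveloping[OF a v])
  \<comment> \<open>The directions \<open>1\<close> to \<open>k\<close> are treated one by one;
    idempotence leaves vertices that were already moved unchanged. Among all vertices only
    \<open>{}\<close> and \<open>{Suc k}\<close> meet none of these directions.\<close>
  have "cubical (Suc k) (\<lambda>e. if e \<inter> {1..m} = {} then p e else v ((), p e))" for m
  proof (induction m)
    case 0
    then show ?case using p by simp
  next
    case (Suc m)
    let ?q = "\<lambda>e. if e \<inter> {1..m} = {} then p e else v ((), p e)"
    have eq: "(if Suc m \<in> e then v ((), ?q e) else ?q e)
        = (if e \<inter> {1..Suc m} = {} then p e else v ((), p e))" if "e \<in> cube_index (Suc k)" for e
      using vv[OF cubical_in[OF p that]] by (auto simp: atLeastAtMostSuc_conv)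
    show ?case
      by (rule cubical_eq[OF cubical_facet_enveloping[OF Suc v, of "Suc m"]]) (rule eq)
  qed
  from this[of k] have q: "cubical (Suc k) (\<lambda>e. if e \<inter> {1..k} = {} then p e else v ((), p e))" .
  have eq: "(if e \<inter> {1..k} = {} then p e else v ((), p e)) = corner k x (v ((), z)) (\<lambda>e. v ((), a e)) e"
    if "e \<in> cube_index (Suc k)" for e
    using that
  proof (cases rule: cube_index_Suc_cases)
    case 1
    then have "e \<inter> {1..k} = e" by (auto simp: cube_index_def)
    then show ?thesis
      using 1 by (auto simp: p_def corner_lower)
  next
    case (2 e')
    then have "e \<inter> {1..k} = e'" by (auto simp: cube_index_def)
    moreover have "e' \<noteq> {} \<Longrightarrow> a e' \<in> M"
      using cubical_in[OF a that] 2 corner_upper[of e' k x z a] by simp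
    ultimately show ?thesis
      using 2 by (auto simp: p_def corner_upper vv)
  qed
  have "cubical (Suc k) (corner k x (v ((), z)) (\<lambda>e. v ((), a e)))"
    by (rule cubical_eq[OF q]) (rule eq)
  then show ?thesis
    by (auto simp: RP_def)
qed

end

section \<open>Minimal systems and idempotents of minimal left ideals\<close>

locale minimal_zsys = zsys +
  assumes minimal: "minimal_system X S"
begin

lemma orbit_meets_open:
  assumes "x \<in> M" "openin X U" "U \<noteq> {}"
  obtains t where "T t x \<in> U"
proof -
  obtain y where y: "y \<in> U" "y \<in> M"
    using assms(2,3) openin_subset by fastforce
  then have "y \<in> X closure_of range (\<lambda>t. T t x)"
    using minimal assms(1) by (simp add: minimal_system_def)
  then show thesis
    using that y(1) assms(2) unfolding in_closure_of by blast
qed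

lemma E_transitive:
  assumes "x \<in> M" "y \<in> M"
  obtains p where "p \<in> E" "p ((), x) = y"
proof -
  obtain p where "p \<in> E" "\<And>j. j \<in> {()} \<Longrightarrow> p ((), x) = y"
  proof (rule enveloping_eval[of "{()}" "\<lambda>_. ((), x)" "{()}" "\<lambda>_. y" UNIV])
    fix U assume U: "\<And>j::unit. j \<in> {()} \<Longrightarrow> openin X (U j) \<and> y \<in> U j"
    then obtain t where "T t x \<in> U ()"
      using orbit_meets_open[OF assms(1), of "U ()"] by blast
    then show "\<exists>g\<in>UNIV. \<forall>j\<in>{()}. T (g (fst ((), x))) (snd ((), x)) \<in> U j"
      by (intro bexI[of _ "\<lambda>_. t"]) auto
  qed (use assms that in auto)
  then show thesis
    using that by blast
qed

lemma minimal_left_idealD: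
  assumes "minimal_left_ideal J"
  shows "closedin (fam_top {()}) J" "J \<noteq> {}" "J \<subseteq> E"
    "p \<in> E \<Longrightarrow> q \<in> J \<Longrightarrow> E_mult p q \<in> J" "q \<in> J \<Longrightarrow> r \<in> J \<Longrightarrow> \<exists>p\<in>E. E_mult p q = r"
  using assms unfolding minimal_left_ideal_def by simp_all

text \<open>Every element of the ideal is a multiple \<open>p v\<close>, so an idempotent
  \<open>v\<close> of the ideal is a right identity on it.\<close>

lemma minimal_left_ideal_idempotent_right:
  assumes J: "minimal_left_ideal J" and "u \<in> J" "v \<in> J" "E_mult v v = v"
  shows "E_mult u v = u"
proof -
  obtain p where "p \<in> E" "E_mult p v = u"
    using minimal_left_idealD(5)[OF J] assms by blast
  then show ?thesis
    using E_mult_assoc[of v p v] assms minimal_left_idealD(3)[OF J] by auto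
qed

text \<open>The elements of the ideal that fix \<open>x\<close> form a closed subsemigroup; it is
  nonempty because any element of the ideal can be followed by one that brings its value back to
  \<open>x\<close>.\<close>

lemma minimal_left_ideal_idempotent_fixing:
  assumes J: "minimal_left_ideal J" and x: "x \<in> M"
  obtains v where "v \<in> J" "E_mult v v = v" "v ((), x) = x"
proof -
  define A where "A = {p \<in> J. p ((), x) \<in> {x}}"
  have sub: "A \<subseteq> E" using minimal_left_idealD(3)[OF J] by (auto simp: A_def)
  have "\<exists>v. v \<in> A \<and> E_mult v v = v"
  proof (rule exists_idempotent[OF compact_family Hausdorff_family, of "{()}" A E_mult])
    show "closedin (fam_top {()}) A"
      unfolding A_def using minimal_left_idealD(1)[OF J] x Hausdorff
      by (intro closedin_continuous_map_preimage_gen[OF continuous_family_eval])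
        (auto simp: closedin_Hausdorff_singleton)
    obtain q where q: "q \<in> J" using minimal_left_idealD(2)[OF J] by blast
    then have "q \<in> E" using minimal_left_idealD(3)[OF J] by blast
    then obtain p where p: "p \<in> E" "p ((), q ((), x)) = x"
      using E_transitive[of "q ((), x)" x] x by auto
    then have "E_mult p q \<in> A"
      using minimal_left_idealD(4)[OF J] q x by (simp add: A_def)
    then show "A \<noteq> {}" by blast
    show "E_mult p q \<in> A" if "p \<in> A" "q \<in> A" for p q
      using that x minimal_left_idealD(4)[OF J] sub by (auto simp: A_def)
    show "E_mult (E_mult p q) r = E_mult p (E_mult q r)" if "r \<in> A" for p q r
      using that sub E_mult_assoc by blast
    show "continuous_map (fam_top {()}) (fam_top {()}) (\<lambda>p. E_mult p q)" if "q \<in> A" for q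
      using that sub enveloping_subset by (intro continuous_compose_right) blast
  qed blast
  then show thesis
    using that by (auto simp: A_def)
qed

end

section \<open>Minimality of diagonal points under the face group\<close>

context zsys
begin

abbreviation E_face :: "nat \<Rightarrow> (nat set \<times> 'a \<Rightarrow> 'a) set" where
  "E_face k \<equiv> enveloping (cube_index k) (range sum)"

lemma E_face_mult_in:
  assumes "p \<in> E_face k" "q \<in> E_face k"
  shows "fam_comp (cube_index k) p q \<in> E_face k"
proof (rule compose_enveloping[OF _ assms])
  fix g h :: "nat set \<Rightarrow> int" assume "g \<in> range sum" "h \<in> range sum"
  then obtain m n where "g = sum m" "h = sum n" by blast
  then have "(\<lambda>i. g i + h i) = sum (\<lambda>j. m j + n j)"
    by (simp add: sum.distrib fun_eq_iff)
  then show "(\<lambda>i. g i + h i) \<in> range sum" by blast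
qed

lemma E_face_in: "p \<in> E_face k \<Longrightarrow> e \<in> cube_index k \<Longrightarrow> x \<in> M \<Longrightarrow> p (e, x) \<in> M"
  by (rule enveloping_in)

lemma E_face_empty:
  assumes "p \<in> E_face k" "x \<in> M"
  shows "p ({}, x) = x"
proof -
  have "E_face k \<subseteq> {p \<in> topspace (fam_top (cube_index k)). p ({}, x) \<in> {x}}"
  proof (rule enveloping_minimal)
    show "closedin (fam_top (cube_index k)) {p \<in> topspace (fam_top (cube_index k)). p ({}, x) \<in> {x}}"
      using assms(2) Hausdorff
      by (intro closedin_continuous_map_preimage[OF continuous_family_eval])
        (auto simp: closedin_Hausdorff_singleton)
  qed (use assms(2) in \<open>auto simp: shift_family_in[unfolded topspace_family] topspace_family shift_family_def\<close>)
  then show ?thesis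
    using assms(1) by blast
qed

text \<open>Reading off one vertex is continuous, so limits of face group elements act at each
  vertex through \<open>E\<close>; there they can be compared with a minimal left ideal of
  \<open>E\<close>.\<close>

lemma E_face_coordinate:
  assumes "p \<in> E_face k" "e \<in> cube_index k"
  shows "(\<lambda>z\<in>{()} \<times> M. p (e, snd z)) \<in> E"
proof -
  let ?c = "\<lambda>p. \<lambda>z\<in>{()} \<times> M. p (e, snd z)"
  have cont: "continuous_map (fam_top (cube_index k)) (fam_top {()}) ?c"
    unfolding fam_top_def[of "{()}"] continuous_map_componentwise
  proof (intro conjI ballI)
    fix z :: "unit \<times> 'a" assume z: "z \<in> {()} \<times> M"
    then have "continuous_map (fam_top (cube_index k)) X (\<lambda>p. p (e, snd z))"
      using assms(2) by (intro continuous_family_eval) auto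
    then show "continuous_map (fam_top (cube_index k)) X (\<lambda>p. ?c p z)"
      using z by simp
  qed (rule image_subsetI, simp)
  have "E_face k \<subseteq> {p \<in> topspace (fam_top (cube_index k)). ?c p \<in> E}"
  proof (rule enveloping_minimal)
    show "closedin (fam_top (cube_index k)) {p \<in> topspace (fam_top (cube_index k)). ?c p \<in> E}"
      by (rule closedin_continuous_map_preimage[OF cont closed_enveloping])
    fix g
    have "?c (shift_family (cube_index k) g) = shift_family {()} (\<lambda>_. g e)"
      unfolding shift_family_def using assms(2) by (intro restrict_ext) auto
    then show "shift_family (cube_index k) g \<in> {p \<in> topspace (fam_top (cube_index k)). ?c p \<in> E}"
      using shift_family_in shift_family_enveloping[of "\<lambda>_. g e" UNIV "{()}"] by simp
  qed
  then show ?thesis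
    using assms(1) by blast
qed

text \<open>Spreading a map over one facet is continuous, which carries limits of integers to limits
  of facet elements.\<close>

lemma facet_in_E_face:
  assumes "u \<in> E"
  shows "(\<lambda>z\<in>cube_index k \<times> M. if i \<in> fst z then u ((), snd z) else snd z) \<in> E_face k"
proof -
  let ?c = "\<lambda>u. \<lambda>z\<in>cube_index k \<times> M. if i \<in> fst z then u ((), snd z) else snd z"
  have cont: "continuous_map (fam_top {()}) (fam_top (cube_index k)) ?c"
    unfolding fam_top_def[of "cube_index k"] continuous_map_componentwise
  proof (intro conjI ballI)
    fix z assume z: "z \<in> cube_index k \<times> M"
    then have "continuous_map (fam_top {()}) X (\<lambda>u. if i \<in> fst z then u ((), snd z) else snd z)"
      by (cases "i \<in> fst z") (auto intro!: continuous_family_eval)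
    then show "continuous_map (fam_top {()}) X (\<lambda>u. ?c u z)"
      using z by simp
  qed (rule image_subsetI, simp)
  have "E \<subseteq> {u \<in> topspace (fam_top {()}). ?c u \<in> E_face k}"
  proof (rule enveloping_minimal)
    show "closedin (fam_top {()}) {u \<in> topspace (fam_top {()}). ?c u \<in> E_face k}"
      by (rule closedin_continuous_map_preimage[OF cont closed_enveloping])
    fix g :: "unit \<Rightarrow> int"
    have "?c (shift_family {()} g) = shift_family (cube_index k) (sum (\<lambda>j. if j = i then g () else 0))"
      unfolding shift_family_def
      by (intro restrict_ext) (auto simp: sum_single_cube_index)
    then show "shift_family {()} g \<in> {u \<in> topspace (fam_top {()}). ?c u \<in> E_face k}"
      using shift_family_in shift_family_enveloping[of "sum (\<lambda>j. if j = i then g () else 0)" "range sum" "cube_index k"]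
      by simp
  qed
  then show ?thesis
    using assms by blast
qed

text \<open>This is the product of the idempotent \<open>u\<close> over all upper facets.\<close>

lemma punctured_idempotent_in_E_face:
  assumes u: "u \<in> E" and idem: "E_mult u u = u"
  shows "(\<lambda>z\<in>cube_index k \<times> M. if fst z = {} then snd z else u ((), snd z)) \<in> E_face k"
proof -
  let ?I = "cube_index k \<times> M"
  let ?U = "\<lambda>m. \<lambda>z\<in>?I. if fst z \<inter> {1..m} = {} then snd z else u ((), snd z)"
  have uu: "u ((), u ((), y)) = u ((), y)" if "y \<in> M" for y
    using idem fam_comp_apply[of "()" "{()}" y u u] that by simp
  have "?U m \<in> E_face k" for m
  proof (induction m)
    case 0
    have "?U 0 = shift_family (cube_index k) (sum (\<lambda>_. 0))"
      unfolding shift_family_def by (intro restrict_ext) auto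
    then show ?case
      using shift_family_enveloping[of "sum (\<lambda>_. 0)" "range sum" "cube_index k"] by simp
  next
    case (Suc m)
    let ?A = "\<lambda>z\<in>?I. if Suc m \<in> fst z then u ((), snd z) else snd z"
    have "fam_comp (cube_index k) ?A (?U m) \<in> E_face k"
      by (rule E_face_mult_in[OF facet_in_E_face[OF u] Suc])
    moreover have "fam_comp (cube_index k) ?A (?U m) = ?U (Suc m)"
      unfolding fam_comp_def
      by (intro restrict_ext) (auto simp: atLeastAtMostSuc_conv uu u)
    ultimately show ?case by (simp only:)
  qed
  moreover have "?U k = (\<lambda>z\<in>?I. if fst z = {} then snd z else u ((), snd z))"
    by (intro restrict_ext) (auto simp: cube_index_def Int_absorb2)
  ultimately show ?thesis by (metis (no_types, lifting))
qed

end

context minimal_zsys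
begin

text \<open>The diagonal point is fixed by the punctured idempotent \<open>U\<close>, which is minimal in the
  enveloping semigroup of the face group: \<open>U V = U\<close> for every idempotent \<open>V\<close> in the left ideal
  generated by \<open>p U\<close>, whatever \<open>p\<close>.\<close>

theorem face_limit_return:
  assumes x: "x \<in> M" and w: "face_limit k (\<lambda>_. x) w"
  shows "face_limit k w (\<lambda>_. x)"
proof -
  let ?C = "cube_index k"
  let ?m = "fam_comp ?C"
  obtain J where J: "minimal_left_ideal J"
    using ex_minimal_left_ideal by blast
  obtain u where u: "u \<in> J" "E_mult u u = u" "u ((), x) = x"
    using minimal_left_ideal_idempotent_fixing[OF J x] .
  have uE: "u \<in> E" using u(1) minimal_left_idealD(3)[OF J] by blast
  define U where "U = (\<lambda>z\<in>?C \<times> M. if fst z = {} then snd z else u ((), snd z))"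
  have U: "U \<in> E_face k"
    unfolding U_def by (rule punctured_idempotent_in_E_face[OF uE u(2)])
  have sub: "q \<in> (?C \<times> M \<rightarrow>\<^sub>E M)" if "q \<in> E_face k" for q
    using that enveloping_subset by blast
  obtain p where p: "p \<in> E_face k" "\<And>e. e \<in> ?C \<Longrightarrow> p (e, x) = w e"
  proof (rule enveloping_eval[of ?C "\<lambda>e. (e, x)" ?C w "range sum"])
    fix V assume V: "\<And>e. e \<in> ?C \<Longrightarrow> openin X (V e) \<and> w e \<in> V e"
    then obtain n where "\<And>e. e \<in> ?C \<Longrightarrow> T (sum n e) x \<in> V e"
      using face_limit_approx[OF w] by metis
    then show "\<exists>g\<in>range sum. \<forall>e\<in>?C. T (g (fst (e, x))) (snd (e, x)) \<in> V e"
      by auto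
  qed (use x w face_limit_in that in auto)
  define A where "A = (\<lambda>r. ?m r (?m p U)) ` E_face k"
  have pU: "?m p U \<in> E_face k"
    by (rule E_face_mult_in[OF p(1) U])
  have A_sub: "A \<subseteq> E_face k"
    using E_face_mult_in pU by (auto simp: A_def)
  have "\<exists>V. V \<in> A \<and> ?m V V = V"
  proof (rule exists_idempotent[OF compact_family Hausdorff_family, of ?C A ?m])
    show "closedin (fam_top ?C) A"
      unfolding A_def by (rule principal_left_ideal_closed[OF pU])
    show "A \<noteq> {}" using U by (auto simp: A_def)
    show "?m q r \<in> A" if q: "q \<in> A" and r: "r \<in> A" for q r
    proof -
      obtain r' where r': "r' \<in> E_face k" "r = ?m r' (?m p U)"
        using r by (auto simp: A_def)
      then have "?m q r = ?m (?m q r') (?m p U)"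
        using fam_comp_assoc[OF sub[OF pU]] by simp
      then show ?thesis
        using E_face_mult_in q A_sub r'(1) by (auto simp: A_def)
    qed
    show "?m (?m q r) s = ?m q (?m r s)" if "s \<in> A" for q r s
      by (rule fam_comp_assoc[OF sub[OF subsetD[OF A_sub that]]])
    show "continuous_map (fam_top ?C) (fam_top ?C) (\<lambda>q. ?m q r)" if "r \<in> A" for r
      by (rule continuous_compose_right[OF sub[OF subsetD[OF A_sub that]]])
  qed blast
  then obtain V r where V: "?m V V = V" and r: "r \<in> E_face k" "V = ?m r (?m p U)"
    by (auto simp: A_def)
  have VE: "V \<in> E_face k"
    unfolding r(2) by (rule E_face_mult_in[OF r(1) pU])
  have V_apply: "V (e, y) = r (e, p (e, U (e, y)))" if "e \<in> ?C" "y \<in> M" for e y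
    using that E_face_in[OF U] by (simp add: r(2))
  have fixed: "U (e, x) = x" if "e \<in> ?C" for e
    using that x u(3) by (simp add: U_def)
  have UV: "U (e, V (e, x)) = x" if e: "e \<in> ?C" for e
  proof (cases "e = {}")
    case True
    then show ?thesis
      using E_face_empty[OF VE x] fixed[OF e] by simp
  next
    case False
    \<comment> \<open>At a vertex other than \<open>{}\<close> the component of \<open>V\<close>
      ends in \<open>u\<close>, so it lies in the left ideal \<open>J\<close>; being idempotent, it
      is a right identity there.\<close>
    let ?c = "\<lambda>q. \<lambda>z\<in>{()} \<times> M. q (e, snd z)"
    have "?c V = E_mult (E_mult (?c r) (?c p)) u"
    proof
      fix z
      show "?c V z = E_mult (E_mult (?c r) (?c p)) u z"
      proof (cases "z \<in> {()} \<times> M")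
        case True
        then obtain y where z: "z = ((), y)" and y: "y \<in> M" by auto
        have "U (e, y) = u ((), y)"
          using False e y by (simp add: U_def)
        moreover have "u ((), y) \<in> M" "p (e, u ((), y)) \<in> M"
          using y uE E_face_in[OF p(1) e] by simp_all
        ultimately show ?thesis
          using y V_apply[OF e y] by (simp add: z)
      qed (simp add: fam_comp_def)
    qed
    moreover have "E_mult (E_mult (?c r) (?c p)) u \<in> J"
      using E_face_coordinate[OF _ e] r(1) p(1) E_mult_in minimal_left_idealD(4)[OF J] u(1) by simp
    ultimately have cV: "?c V \<in> J" by simp
    have "E_mult (?c V) (?c V) = ?c V"
    proof
      fix z
      show "E_mult (?c V) (?c V) z = ?c V z"
      proof (cases "z \<in> {()} \<times> M")
        case True
        then obtain y where z: "z = ((), y)" and y: "y \<in> M" by auto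
        have "V (e, V (e, y)) = V (e, y)"
          using fam_comp_apply[OF e y, of V V] V by simp
        then show ?thesis
          using y E_face_in[OF VE e y] by (simp add: z)
      qed (simp add: fam_comp_def)
    qed
    then have eq: "E_mult u (?c V) = u"
      by (rule minimal_left_ideal_idempotent_right[OF J u(1) cV])
    have "u ((), V (e, x)) = E_mult u (?c V) ((), x)"
      using x by simp
    also have "\<dots> = x"
      unfolding eq by (rule u(3))
    finally show ?thesis
      using False e E_face_in[OF VE e x] by (simp add: U_def)
  qed
  \<comment> \<open>Since \<open>U\<close> fixes the diagonal point, \<open>V\<close> maps it to
    \<open>r w\<close>; hence \<open>U r\<close> maps \<open>w\<close> back to it.\<close>
  define q where "q = ?m U r"
  have q: "q \<in> E_face k"
    unfolding q_def by (rule E_face_mult_in[OF U r(1)])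
  have qw: "q (e, w e) = x" if "e \<in> ?C" for e
    using that UV[OF that] V_apply[OF that x] fixed[OF that] p(2)[OF that] face_limit_in[OF w that]
    by (simp add: q_def)
  show ?thesis
  proof (rule face_limitI)
    fix W assume W: "\<And>e. e \<in> ?C \<Longrightarrow> openin X (W e) \<and> x \<in> W e"
    obtain g where "g \<in> range sum" "\<And>e. e \<in> ?C \<Longrightarrow> T (g (fst (e, w e))) (snd (e, w e)) \<in> W e"
    proof (rule enveloping_approx_family[OF q, of ?C "\<lambda>e. (e, w e)" W])
      show "openin X (W e) \<and> q (e, w e) \<in> W e" if "e \<in> ?C" for e
        using W[OF that] qw[OF that] by simp
    qed (use w face_limit_in that in auto)
    then show "\<exists>n. \<forall>e\<in>?C. T (sum n e) (w e) \<in> W e"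
      by auto
  qed (use x in auto)
qed

text \<open>Genericity places the lower facet in the orbit closure of the diagonal point, and
  \<open>face_limit_return\<close> brings it back to the diagonal. The same motion with entry
  \<open>0\<close> in direction \<open>Suc k\<close> carries the upper facet along, where the
  coordinate \<open>y\<close> does not move because it sits over \<open>{}\<close>.\<close>

lemma generic_corner:
  assumes x: "x \<in> generic k" and "RP k x y"
  shows "cubical (Suc k) (corner k x y (\<lambda>_. x))"
proof -
  obtain a where a: "cubical (Suc k) (corner k x y a)"
    using assms(2) by (auto simp: RP_def)
  let ?p = "corner k x y a"
  have xX: "x \<in> M" using x by (simp add: generic_def)
  have "face_limit k (\<lambda>_. x) ?p"
    using x cubical_mono[OF a, of k] by (simp add: generic_def corner_def)
  then have ret: "face_limit k ?p (\<lambda>_. x)"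
    by (rule face_limit_return[OF xX])
  have y: "y \<in> M" using RP_in assms(2) by blast
  show ?thesis
  proof (rule cubical_face_limit[OF a face_limitI])
    show "corner k x y (\<lambda>_. x) e \<in> M" if "e \<in> cube_index (Suc k)" for e
      using xX y by (simp add: corner_def)
    fix U assume U: "\<And>e. e \<in> cube_index (Suc k) \<Longrightarrow> openin X (U e) \<and> corner k x y (\<lambda>_. x) e \<in> U e"
    \<comment> \<open>Both facets have to reach their boxes at once, except over \<open>{}\<close>,
      where nothing moves.\<close>
    define V where "V = (\<lambda>e. if e = {} then U {} else U e \<inter> U (insert (Suc k) e))"
    have "openin X (V e) \<and> x \<in> V e" if e: "e \<in> cube_index k" for e
      using U[of e] U[of "insert (Suc k) e"] cube_index_mono[of k "Suc k" e] e
        insert_Suc_cube_index[OF e] corner_lower[OF e, of x y "\<lambda>_. x"] corner_upper[OF e, of x y "\<lambda>_. x"]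
      by (auto simp: V_def split: if_splits)
    then obtain n where n: "\<And>e. e \<in> cube_index k \<Longrightarrow> T (sum n e) (?p e) \<in> V e"
      using face_limit_approx[OF ret, of V] by metis
    have "T (sum (n(Suc k := 0)) e) (?p e) \<in> U e" if e: "e \<in> cube_index (Suc k)" for e
      using e
    proof (cases rule: cube_index_Suc_cases)
      case 1
      then show ?thesis
        using n[of e] by (simp add: sum_upd_cube_index V_def del: fun_upd_apply split: if_splits)
    next
      case (2 e')
      show ?thesis
      proof (cases "e' = {}")
        case True
        then show ?thesis
          using 2 U[OF e] by (simp add: corner_def)
      next
        case False
        then show ?thesis
          using 2 n[of e'] by (simp add: sum_upd_cube_index V_def corner_lower corner_upper del: fun_upd_apply)
      qed
    qed
    then show "\<exists>n. \<forall>e\<in>cube_index (Suc k). T (sum n e) (?p e) \<in> U e"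
      by blast
  qed
qed

text \<open>Reflection moves the exceptional vertex from \<open>{Suc k}\<close> to any prescribed
  \<open>\<sigma>\<close>.\<close>

lemma generic_corner_reflect:
  assumes "x \<in> generic k" "RP k x y" "\<sigma> \<in> cube_index (Suc k)"
  shows "cubical (Suc k) (\<lambda>e. if e = \<sigma> then y else x)"
proof -
  let ?\<tau> = "sym_diff \<sigma> {Suc k}"
  have "?\<tau> \<in> cube_index (Suc k)"
    using assms(3) by (auto simp: cube_index_def)
  then have "cubical (Suc k) (\<lambda>e. corner k x y (\<lambda>_. x) (sym_diff e ?\<tau>))"
    by (rule cubical_reflect[OF generic_corner[OF assms(1,2)]])
  moreover have "corner k x y (\<lambda>_. x) (sym_diff e ?\<tau>) = (if e = \<sigma> then y else x)" for e
  proof -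
    have "sym_diff e ?\<tau> = {Suc k} \<longleftrightarrow> e = \<sigma>"
      by blast
    then show ?thesis
      by (auto simp: corner_def)
  qed
  ultimately show ?thesis by simp
qed

text \<open>Both corners over \<open>x\<close> lie in the orbit closure of the diagonal point, so
  the return property gives a motion from one to the other. It leaves the vertex \<open>{}\<close>
  alone, so there \<open>x\<close> may be exchanged for \<open>y\<close>; the starting point is then
  a doubled \<open>k\<close>-cube, cubical because the corner can be reflected.\<close>

lemma RP_trans_generic:
  assumes x: "x \<in> generic k" "x \<in> generic (Suc k)" and y: "RP k x y" and z: "RP k x z"
  shows "RP k y z"
proof -
  have xX: "x \<in> M" using x by (simp add: generic_def)
  let ?w = "\<lambda>y. corner k x y (\<lambda>_. x)"
  have limit: "face_limit (Suc k) (\<lambda>_. x) (?w y)" if "RP k x y" for y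
    using x(2) generic_corner[OF x(1) that] by (simp add: generic_def corner_def)
  have "face_limit (Suc k) (?w y) (?w z)"
    using face_limit_trans[OF face_limit_return[OF xX limit[OF y]] limit[OF z]]
      face_limit_in[OF limit[OF y]] by blast
  note move = this
  have "cubical k (\<lambda>e. if e = {} then y else x)"
    using cubical_mono[OF generic_corner_reflect[OF x(1) y]] by simp
  then have "cubical (Suc k) (\<lambda>e. if e - {Suc k} = {} then y else x)"
    by (rule cubical_double)
  then have v: "cubical (Suc k) (corner k y y (\<lambda>_. x))"
    by (rule cubical_eq) (auto simp: corner_def)
  have yX: "y \<in> M" "z \<in> M"
    using RP_in y z by blast+
  have "face_limit (Suc k) (corner k y y (\<lambda>_. x)) (corner k y z (\<lambda>_. x))"
  proof (rule face_limitI)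
    fix U assume U: "\<And>e. e \<in> cube_index (Suc k) \<Longrightarrow> openin X (U e) \<and> corner k y z (\<lambda>_. x) e \<in> U e"
    define V where "V = U({} := M)"
    have "openin X (V e) \<and> ?w z e \<in> V e" if "e \<in> cube_index (Suc k)" for e
      using U[OF that] xX by (cases "e = {}"; cases "e = {Suc k}") (simp_all add: V_def corner_def)
    then obtain n where n: "\<And>e. e \<in> cube_index (Suc k) \<Longrightarrow> T (sum n e) (?w y e) \<in> V e"
      using face_limit_approx[OF move, of V] by metis
    have "T (sum n e) (corner k y y (\<lambda>_. x) e) \<in> U e" if "e \<in> cube_index (Suc k)" for e
      using n[OF that] U[OF that] by (cases "e = {}") (auto simp: V_def corner_def)
    then show "\<exists>n. \<forall>e\<in>cube_index (Suc k). T (sum n e) (corner k y y (\<lambda>_. x) e) \<in> U e"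
      by blast
  qed (use xX yX in \<open>auto simp: corner_def\<close>)
  then have "cubical (Suc k) (corner k y z (\<lambda>_. x))"
    by (rule cubical_face_limit[OF v])
  then show ?thesis
    by (auto simp: RP_def)
qed

text \<open>The middle point is moved to a generic one by \<open>q\<close> and back by \<open>r\<close>, where \<open>r q\<close> is an
  idempotent; this replaces the outer points by proximal ones.\<close>

theorem RP_trans:
  assumes xy: "RP k x y" and yz: "RP k y z"
  shows "RP k x z"
proof -
  have X: "x \<in> M" "y \<in> M" "z \<in> M"
    using RP_in xy yz by blast+
  obtain c where c: "c \<in> generic k \<inter> generic (Suc k)" "c \<in> M"
    using residual_in_meets_open[OF compact Hausdorff residual_in_Int[OF residual_generic residual_generic],
        of "M"] X(1) by blast
  obtain J where J: "minimal_left_ideal J"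
    using ex_minimal_left_ideal by blast
  note JE = minimal_left_idealD(3)[OF J, THEN subsetD]
  obtain u where u: "u \<in> J" "E_mult u u = u" "u ((), y) = y"
    using minimal_left_ideal_idempotent_fixing[OF J X(2)] .
  obtain q0 where q0: "q0 \<in> E" "q0 ((), y) = c"
    using E_transitive[OF X(2) c(2)] .
  define q where "q = E_mult q0 u"
  have q: "q \<in> J" "q ((), y) = c"
    using minimal_left_idealD(4)[OF J q0(1) u(1)] q0(2) X(2) u(3) by (simp_all add: q_def)
  obtain r where r: "r \<in> E" "E_mult r q = u"
    using minimal_left_idealD(5)[OF J q(1) u(1)] by blast
  have "RP k c (q ((), x))" "RP k c (q ((), z))"
    using RP_enveloping[OF RP_sym[OF xy] JE[OF q(1)]] RP_enveloping[OF yz JE[OF q(1)]] q(2) by simp_all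
  then have "RP k (q ((), x)) (q ((), z))"
    using RP_trans_generic c by blast
  then have "RP k (r ((), q ((), x))) (r ((), q ((), z)))"
    using RP_enveloping r(1) by blast
  then have ux: "RP k (u ((), x)) (u ((), z))"
    using X fam_comp_apply[of "()" "{()}" x r q] fam_comp_apply[of "()" "{()}" z r q]
    by (simp add: r(2))
  \<comment> \<open>\<open>b\<close> and \<open>u b\<close> are proximal: an idempotent
    \<open>v\<close> of the same ideal fixing \<open>b\<close> satisfies \<open>v u = v\<close>,
    hence sends \<open>u b\<close> to \<open>b\<close>.\<close>
  have proximal: "RP k a b" if ab: "RP k a (u ((), b))" and b: "b \<in> M" for a b
  proof -
    obtain v where v: "v \<in> J" "E_mult v v = v" "v ((), b) = b"
      using minimal_left_ideal_idempotent_fixing[OF J b] .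
    have "v ((), u ((), b)) = E_mult v u ((), b)"
      using b by simp
    also have "\<dots> = b"
      unfolding minimal_left_ideal_idempotent_right[OF J v(1) u(1,2)] by (rule v(3))
    finally show ?thesis
      using RP_idempotent[OF ab JE[OF v(1)] v(2)] by simp
  qed
  have "RP k (u ((), x)) z"
    by (rule proximal[OF ux X(3)])
  then have "RP k z x"
    using proximal[OF RP_sym X(1)] by blast
  then show ?thesis
    by (rule RP_sym)
qed

end

section \<open>Closedness of the relation and agreement with the definition by nets\<close>

lemma closedin_equalizer:
  assumes "Hausdorff_space Y" "continuous_map X Y f" "continuous_map X Y g"
  shows "closedin X {x \<in> topspace X. f x = g x}"
proof -
  have "closedin X {x \<in> topspace X. (f x, g x) \<in> (\<lambda>y. (y, y)) ` topspace Y}"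
    using assms by (intro closedin_continuous_map_preimage[of X "prod_topology Y Y"])
      (auto simp: continuous_map_paired Hausdorff_space_closedin_diagonal)
  moreover have "{x \<in> topspace X. (f x, g x) \<in> (\<lambda>y. (y, y)) ` topspace Y} = {x \<in> topspace X. f x = g x}"
    using continuous_map_image_subset_topspace[OF assms(2)] by auto
  ultimately show ?thesis by simp
qed

context zsys
begin

lemma closedin_cubical:
  "closedin (cube k X) {p \<in> topspace (cube k X). cubical k p}"
proof -
  let ?P = "{p \<in> topspace (cube k X). cubical k p}"
  have "cube k X closure_of ?P \<subseteq> ?P"
  proof
    fix p assume p: "p \<in> cube k X closure_of ?P"
    have "cubical k p"
    proof (rule cubical_closed)
      show "p e \<in> M" if "e \<in> cube_index k" for e
        using p that unfolding cube_def in_closure_of_product_topology[OF finite_cube_index] by auto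
      fix U assume "\<And>e. e \<in> cube_index k \<Longrightarrow> openin X (U e) \<and> p e \<in> U e"
      then show "\<exists>q. cubical k q \<and> (\<forall>e\<in>cube_index k. q e \<in> U e)"
        using p[unfolded cube_def in_closure_of_product_topology[OF finite_cube_index],
            THEN conjunct2, rule_format, of U] by blast
    qed
    then show "p \<in> ?P"
      using p by (simp add: in_closure_of)
  qed
  then show ?thesis
    using closure_of_subset_eq[of ?P "cube k X"] by blast
qed

text \<open>The relation is the projection of a compact set: the cubical points whose two facets
  agree off the base vertices.\<close>

lemma closedin_RP: "closedin (prod_topology X X) {(x, y). RP k x y}"
proof -
  let ?Q = "cube (Suc k) X"
  define K where "K = {p \<in> topspace ?Q. cubical (Suc k) p} \<inter>
    (topspace ?Q \<inter> (\<Inter>e\<in>cube_index k - {{}}. {p \<in> topspace ?Q. p e = p (insert (Suc k) e)}))"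
  have coord: "continuous_map ?Q X (\<lambda>p. p e)" if "e \<in> cube_index (Suc k)" for e
    unfolding cube_def using that by (rule continuous_map_product_projection)
  have top: "{Suc k} \<in> cube_index (Suc k)"
    by (simp add: cube_index_def)
  have "closedin ?Q {p \<in> topspace ?Q. p e = p (insert (Suc k) e)}" if "e \<in> cube_index k" for e
    using that cube_index_mono[of k "Suc k" e] insert_Suc_cube_index[OF that]
    by (intro closedin_equalizer[OF Hausdorff] coord) auto
  then have "closedin ?Q K"
    unfolding K_def
  proof (cases "cube_index k - {{}} = {}")
    case True
    then show "closedin ?Q ({p \<in> topspace ?Q. cubical (Suc k) p} \<inter>
        (topspace ?Q \<inter> (\<Inter>e\<in>cube_index k - {{}}. {p \<in> topspace ?Q. p e = p (insert (Suc k) e)})))"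
      by (simp only: INT_empty Int_UNIV_right) (intro closedin_Int closedin_cubical closedin_topspace)
  qed (intro closedin_Int closedin_cubical closedin_topspace closedin_INT, auto)
  moreover have "compact_space ?Q"
    using compact by (simp add: cube_def compact_space_product_topology)
  moreover have "continuous_map ?Q (prod_topology X X) (\<lambda>p. (p {}, p {Suc k}))"
    using coord top by (simp add: continuous_map_paired)
  ultimately have "compactin (prod_topology X X) ((\<lambda>p. (p {}, p {Suc k})) ` K)"
    using closedin_compact_space image_compactin by blast
  then have "closedin (prod_topology X X) ((\<lambda>p. (p {}, p {Suc k})) ` K)"
    using Hausdorff by (simp add: compactin_imp_closedin Hausdorff_space_prod_topology)
  moreover have "(\<lambda>p. (p {}, p {Suc k})) ` K = {(x, y). RP k x y}"
  proof (intro equalityI subsetI)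
    fix xy assume "xy \<in> (\<lambda>p. (p {}, p {Suc k})) ` K"
    then obtain p where p: "p \<in> K" "xy = (p {}, p {Suc k})" by blast
    have par: "cubical (Suc k) p"
      and eq: "\<And>e. e \<in> cube_index k \<Longrightarrow> e \<noteq> {} \<Longrightarrow> p e = p (insert (Suc k) e)"
      using p(1) by (auto simp: K_def)
    have "cubical (Suc k) (corner k (p {}) (p {Suc k}) p)"
    proof (rule cubical_eq[OF par])
      fix e assume "e \<in> cube_index (Suc k)"
      then show "p e = corner k (p {}) (p {Suc k}) p e"
        by (cases rule: cube_index_Suc_cases) (auto simp: corner_lower corner_upper eq)
    qed
    then show "xy \<in> {(x, y). RP k x y}"
      by (auto simp: RP_def p(2))
  next
    fix xy assume "xy \<in> {(x, y). RP k x y}"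
    then obtain x y a where xy: "xy = (x, y)" and a: "cubical (Suc k) (corner k x y a)"
      by (auto simp: RP_def)
    define p where "p = restrict (corner k x y a) (cube_index (Suc k))"
    have par: "cubical (Suc k) p"
      by (rule cubical_eq[OF a]) (simp add: p_def)
    have "p \<in> topspace ?Q"
      using cubical_in[OF par] by (auto simp: cube_def p_def)
    moreover have "p e = p (insert (Suc k) e)" if "e \<in> cube_index k" "e \<noteq> {}" for e
      using that cube_index_mono[of k "Suc k" e] insert_Suc_cube_index[OF that(1)]
      by (simp add: p_def corner_lower corner_upper)
    ultimately have "p \<in> K"
      using par by (auto simp: K_def)
    moreover have "xy = (p {}, p {Suc k})"
      using top by (simp add: xy p_def corner_def)
    ultimately show "xy \<in> (\<lambda>p. (p {}, p {Suc k})) ` K" by blast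
  qed
  ultimately show ?thesis by simp
qed

end

context minimal_zsys
begin

text \<open>The two nets have unrelated base points \<open>u\<close> and \<open>v\<close>.
  Minimality moves \<open>u\<close> by some \<open>t\<close> into the open set where the same face
  element works as it does for \<open>v\<close>, and \<open>t\<close> becomes the entry in the new
  direction.\<close>

lemma regionally_proximal_imp_RP:
  assumes "(x, y) \<in> regionally_proximal k X S"
  shows "RP k x y"
proof -
  obtain N a where x: "x \<in> M" "y \<in> M" and "N \<noteq> bot"
    and N: "\<forall>\<^sub>F (f, u, v) in N. f \<in> face_group k \<and> u \<in> M \<and> v \<in> M"
    and a: "a \<in> cube_index_star k \<rightarrow>\<^sub>E M"
    and lu: "limitin (cube k X) (\<lambda>(f, u, v). cube_act k X S f (diag k u)) (cube_join k x a) N"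
    and lv: "limitin (cube k X) (\<lambda>(f, u, v). cube_act k X S f (diag k v)) (cube_join k y a) N"
    using assms unfolding regionally_proximal_def by auto
  have aX: "a e \<in> M" if "e \<in> cube_index k" "e \<noteq> {}" for e
    using a that by (auto simp: cube_index_star_def)
  have "cubical (Suc k) (corner k x y a)"
  proof (rule cubicalI)
    show "corner k x y a e \<in> M" if "e \<in> cube_index (Suc k)" for e
      using that by (cases rule: cube_index_Suc_cases) (auto simp: corner_lower corner_upper x aX)
    fix U assume U: "\<And>e. e \<in> cube_index (Suc k) \<Longrightarrow> openin X (U e) \<and> corner k x y a e \<in> U e"
    have U_lower: "openin X (U e)" "cube_join k x a e \<in> U e"
      and U_upper: "openin X (U (insert (Suc k) e))" "cube_join k y a e \<in> U (insert (Suc k) e)"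
      if "e \<in> cube_index k" for e
      using U[OF cube_index_mono[of k "Suc k" e]] U[OF insert_Suc_cube_index] that
      by (simp_all add: corner_lower corner_upper cube_join_def)
    have "\<forall>\<^sub>F (f, u, v) in N. T (f e) u \<in> U e \<and> T (f e) v \<in> U (insert (Suc k) e)"
      if e: "e \<in> cube_index k" for e
    proof -
      have "limitin X (\<lambda>z. (\<lambda>(f, u, v). cube_act k X S f (diag k u)) z e) (cube_join k x a e) N"
        "limitin X (\<lambda>z. (\<lambda>(f, u, v). cube_act k X S f (diag k v)) z e) (cube_join k y a e) N"
        using lu lv e unfolding cube_def limitin_componentwise by blast+
      then have "\<forall>\<^sub>F z in N. (\<lambda>(f, u, v). cube_act k X S f (diag k u)) z e \<in> U e"
        "\<forall>\<^sub>F z in N. (\<lambda>(f, u, v). cube_act k X S f (diag k v)) z e \<in> U (insert (Suc k) e)"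
        using U_lower[OF e] U_upper[OF e] unfolding limitin_def by blast+
      then show ?thesis
        by eventually_elim (use e in \<open>auto simp: cube_act_def diag_def\<close>)
    qed
    then have "\<forall>\<^sub>F z in N. \<forall>e\<in>cube_index k. (\<lambda>(f, u, v). T (f e) u \<in> U e \<and> T (f e) v \<in> U (insert (Suc k) e)) z"
      by (intro eventually_ball_finite) auto
    with N have "\<forall>\<^sub>F z in N. (\<lambda>(f, u, v). f \<in> face_group k \<and> u \<in> M \<and> v \<in> M) z \<and>
        (\<forall>e\<in>cube_index k. (\<lambda>(f, u, v). T (f e) u \<in> U e \<and> T (f e) v \<in> U (insert (Suc k) e)) z)"
      by (rule eventually_conj)
    then obtain f u v where f: "f \<in> face_group k" and uv: "u \<in> M" "v \<in> M"
      and fuv: "\<And>e. e \<in> cube_index k \<Longrightarrow> T (f e) u \<in> U e \<and> T (f e) v \<in> U (insert (Suc k) e)"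
      using eventually_happens[of _ N] \<open>N \<noteq> bot\<close> by fastforce
    obtain n where n: "f = (\<lambda>e\<in>cube_index k. sum n e)"
      using f unfolding face_group_eq by blast
    define V where "V = M \<inter> (\<Inter>e\<in>cube_index k. {x \<in> M. T (sum n e) x \<in> U (insert (Suc k) e)})"
    have "cube_index k \<noteq> {}"
      using empty_in_cube_index[of k] by blast
    then have "openin X V"
      unfolding V_def using U_upper by (intro openin_Int openin_INT2 open_T_preimage) auto
    moreover have "v \<in> V"
      using fuv uv by (simp add: V_def n)
    ultimately obtain t where t: "T t u \<in> V"
      using orbit_meets_open[OF uv(1), of V] by blast
    have "T (sum (n(Suc k := t)) e) u \<in> U e" if "e \<in> cube_index (Suc k)" for e
      using that
    proof (cases rule: cube_index_Suc_cases)
      case 1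
      then show ?thesis
        using fuv[of e] by (simp add: sum_upd_cube_index n del: fun_upd_apply)
    next
      case (2 e')
      then show ?thesis
        using t uv T_add[of u "sum n e'" t] by (simp add: sum_upd_cube_index V_def add.commute del: fun_upd_apply)
    qed
    then show "\<exists>z\<in>M. \<exists>n. \<forall>e\<in>cube_index (Suc k). T (sum n e) z \<in> U e"
      using uv by blast
  qed
  then show ?thesis
    by (auto simp: RP_def)
qed

text \<open>The filter is generated by the boxes around the corner: to each box belong the triples
  that reach it. Such a triple is read off an approximating cube, whose upper facet starts at
  \<open>T (n (Suc k)) z\<close>.\<close>

lemma RP_imp_regionally_proximal:
  assumes "RP k x y"
  shows "(x, y) \<in> regionally_proximal k X S"
proof -
  obtain a where a: "cubical (Suc k) (corner k x y a)"
    using assms by (auto simp: RP_def)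
  have x: "x \<in> M" "y \<in> M"
    using RP_in assms by blast+
  define \<U> where "\<U> = {U. \<forall>e\<in>cube_index (Suc k). openin X (U e) \<and> corner k x y a e \<in> U e}"
  define B where "B = (\<lambda>U. {(f, u, v). f \<in> face_group k \<and> u \<in> M \<and> v \<in> M \<and>
      (\<forall>e\<in>cube_index k. T (f e) u \<in> U e \<and> T (f e) v \<in> U (insert (Suc k) e))})"
  define N where "N = (INF U\<in>\<U>. principal (B U))"
  define L where "L = (\<lambda>(f, u, v::'a). cube_act k X S f (diag k u))"
  define R where "R = (\<lambda>(f, u::'a, v). cube_act k X S f (diag k v))"
  define a' where "a' = restrict a (cube_index_star k)"
  have aX: "a e \<in> M" if "e \<in> cube_index k" "e \<noteq> {}" for e
    using cubical_in[OF a cube_index_mono[of k "Suc k" e]] that by (simp add: corner_lower)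
  have whole: "(\<lambda>_. M) \<in> \<U>"
    using cubical_in[OF a] by (simp add: \<U>_def)
  have ev: "eventually P N \<longleftrightarrow> (\<exists>U\<in>\<U>. \<forall>z\<in>B U. P z)" for P
    unfolding N_def
  proof (subst eventually_INF_base)
    show "\<U> \<noteq> {}" using whole by blast
    fix U V assume "U \<in> \<U>" "V \<in> \<U>"
    then have "(\<lambda>e. U e \<inter> V e) \<in> \<U>"
      by (auto simp: \<U>_def)
    moreover have "B (\<lambda>e. U e \<inter> V e) \<subseteq> B U \<inter> B V"
      by (auto simp: B_def)
    ultimately show "\<exists>W\<in>\<U>. principal (B W) \<le> inf (principal (B U)) (principal (B V))"
      by (intro bexI[of _ "\<lambda>e. U e \<inter> V e"]) auto
  qed (simp add: eventually_principal)
  have "B U \<noteq> {}" if U: "U \<in> \<U>" for U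
  proof -
    obtain z n where z: "z \<in> M" and n: "\<And>e. e \<in> cube_index (Suc k) \<Longrightarrow> T (sum n e) z \<in> U e"
      using cubical_approx[OF a, of U] U unfolding \<U>_def by blast
    have "((\<lambda>e\<in>cube_index k. sum n e), z, T (n (Suc k)) z) \<in> B U"
    proof -
      have "T (sum n e) (T (n (Suc k)) z) \<in> U (insert (Suc k) e)" if e: "e \<in> cube_index k" for e
        using n[OF insert_Suc_cube_index[OF e]] z Suc_notin_cube_index[OF e] cube_index_finite[OF e]
        by (simp add: T_add[symmetric] add.commute)
      then show ?thesis
        using n z cube_index_mono[of k "Suc k"] by (auto simp: B_def face_group_eq)
    qed
    then show ?thesis by blast
  qed
  then have "\<not> eventually (\<lambda>_. False) N"
    unfolding ev by blast
  then have "N \<noteq> bot"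
    by (simp add: trivial_limit_def)
  moreover have "\<forall>\<^sub>F (f, u, v) in N. f \<in> face_group k \<and> u \<in> M \<and> v \<in> M"
    using whole by (subst ev) (auto simp: B_def)
  moreover have "a' \<in> cube_index_star k \<rightarrow>\<^sub>E M"
    using aX by (auto simp: a'_def cube_index_star_def)
  moreover have "limitin (cube k X) L (cube_join k x a') N"
    "limitin (cube k X) R (cube_join k y a') N"
  proof -
    have inX: "\<forall>\<^sub>F z in N. L z \<in> topspace (product_topology (\<lambda>_. X) (cube_index k))"
      "\<forall>\<^sub>F z in N. R z \<in> topspace (product_topology (\<lambda>_. X) (cube_index k))"
      using whole by (auto simp: ev B_def L_def R_def cube_act_def diag_def intro!: bexI[of _ "\<lambda>_. M"])
    have "limitin X (\<lambda>z. L z e) (cube_join k x a' e) N"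
      "limitin X (\<lambda>z. R z e) (cube_join k y a' e) N"
      if e: "e \<in> cube_index k" for e
    proof -
      have join: "cube_join k x a' e = corner k x y a e"
        "cube_join k y a' e = corner k x y a (insert (Suc k) e)"
        using e by (simp_all add: a'_def cube_join_def corner_lower corner_upper cube_index_star_def)
      have upd: "(\<lambda>_. M)(\<delta> := W) \<in> \<U>" if "openin X W" "corner k x y a \<delta> \<in> W" for \<delta> W
        using whole that by (auto simp: \<U>_def)
      have e': "e \<in> cube_index (Suc k)" "insert (Suc k) e \<in> cube_index (Suc k)"
        using e cube_index_mono[of k "Suc k" e] insert_Suc_cube_index by auto
      show "limitin X (\<lambda>z. L z e) (cube_join k x a' e) N"
        unfolding limitin_def join
      proof (intro conjI allI impI)
        fix W assume W: "openin X W \<and> corner k x y a e \<in> W"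
        show "\<forall>\<^sub>F z in N. L z e \<in> W"
          unfolding ev using e W
          by (intro bexI[OF _ upd[of W e]]) (auto simp: B_def L_def R_def cube_act_def diag_def)
      qed (use cubical_in[OF a] e' in auto)
      show "limitin X (\<lambda>z. R z e) (cube_join k y a' e) N"
        unfolding limitin_def join
      proof (intro conjI allI impI)
        fix W assume W: "openin X W \<and> corner k x y a (insert (Suc k) e) \<in> W"
        show "\<forall>\<^sub>F z in N. R z e \<in> W"
          unfolding ev using e W
          by (intro bexI[OF _ upd[of W "insert (Suc k) e"]]) (auto simp: B_def L_def R_def cube_act_def diag_def)
      qed (use cubical_in[OF a] e' in auto)
    qed
    then show "limitin (cube k X) L (cube_join k x a') N"
      "limitin (cube k X) R (cube_join k y a') N"
      unfolding cube_def limitin_componentwise using inX by (auto simp: cube_join_def)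
  qed
  ultimately show ?thesis
    unfolding regionally_proximal_def L_def R_def using x by blast
qed

lemma regionally_proximal_eq: "regionally_proximal k X S = {(x, y). RP k x y}"
  using regionally_proximal_imp_RP RP_imp_regionally_proximal by auto

end

section \<open>Closed sets coded by real sequences\<close>

locale functional_base =
  fixes X :: "'a topology" and f :: "nat \<Rightarrow> 'a \<Rightarrow> real"
  assumes compact_X: "compact_space X" and Hausdorff_X: "Hausdorff_space X"
    and f_cont: "\<And>n. continuous_map X euclideanreal (f n)"
    and f_base: "\<And>U x. openin X U \<Longrightarrow> x \<in> U \<Longrightarrow>
      \<exists>n. \<exists>c\<in>\<rat>. f n x < c \<and> (\<forall>y\<in>topspace X. f n y < c \<longrightarrow> y \<in> U)"

lemma ex_functional_base:
  assumes "compact_space X" "metrizable_space X"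
  obtains f where "functional_base X f"
proof (cases "topspace X = {}")
  case True
  have "functional_base X (\<lambda>_ _. 0)"
  proof
    fix U x assume "openin X U" "x \<in> U"
    then have False
      using True openin_subset by fastforce
    then show "\<exists>n. \<exists>c\<in>\<rat>. (0::real) < c \<and> (\<forall>y\<in>topspace X. 0 < c \<longrightarrow> y \<in> U)" ..
  qed (use assms metrizable_imp_Hausdorff_space in auto)
  then show thesis by (rule that)
next
  case False
  show thesis
  proof (rule compact_metrizable_functional_base[OF assms False])
    fix f :: "nat \<Rightarrow> 'a \<Rightarrow> real"
    assume "\<And>n. continuous_map X euclideanreal (f n)"
      and "\<And>U x. openin X U \<Longrightarrow> x \<in> U \<Longrightarrow>
        \<exists>n. \<exists>c\<in>\<rat>. f n x < c \<and> (\<forall>y\<in>topspace X. f n y < c \<longrightarrow> y \<in> U)"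
    then have "functional_base X f"
      using assms by (simp add: functional_base_def metrizable_imp_Hausdorff_space)
    then show thesis by (rule that)
  qed
qed

abbreviation Rseq :: "(nat \<Rightarrow> real) topology" where
  "Rseq \<equiv> product_topology (\<lambda>_. euclideanreal) UNIV"

lemma metrizable_Rseq: "metrizable_space Rseq"
  by (simp add: metrizable_space_product_topology metrizable_space_euclidean)

lemma Hausdorff_Rseq: "Hausdorff_space Rseq"
  using metrizable_Rseq metrizable_imp_Hausdorff_space by blast

lemma continuous_Rseq_coordinate: "continuous_map Rseq euclideanreal (\<lambda>h. h n)"
  by (rule continuous_map_product_projection) simp

lemma openin_Rseq_less: "openin Rseq {h. h n < c}" and openin_Rseq_greater: "openin Rseq {h. c < h n}"
proof -
  have "openin Rseq {h \<in> topspace Rseq. h n \<in> {..<c}}" "openin Rseq {h \<in> topspace Rseq. h n \<in> {c<..}}"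
    by (intro openin_continuous_map_preimage[OF continuous_Rseq_coordinate]; simp)+
  then show "openin Rseq {h. h n < c}" "openin Rseq {h. c < h n}"
    by simp_all
qed

context functional_base
begin

lemma f_open: "openin X {x \<in> topspace X. f n x < c}" "openin X {x \<in> topspace X. c < f n x}"
  using openin_continuous_map_preimage[OF f_cont[of n], of "{..<c}"]
    openin_continuous_map_preimage[OF f_cont[of n], of "{c<..}"] by simp_all

lemma f_closed: "closedin X {x \<in> topspace X. f n x \<le> c}"
  using closedin_continuous_map_preimage[OF f_cont[of n], of "{..c}"] by simp

text \<open>A nonempty closed set \<open>B\<close> is encoded by the sequence \<open>minima B\<close> of the minima of the \<open>f n\<close> on
  \<open>B\<close> and recovered from it by \<open>below\<close>; the encoding induces the Vietoris topology, and \<open>tight\<close>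
  describes the (closed) set of codes.\<close>

definition below :: "(nat \<Rightarrow> real) \<Rightarrow> 'a set" where
  "below h = {x \<in> topspace X. \<forall>n. h n \<le> f n x}"

definition minima :: "'a set \<Rightarrow> nat \<Rightarrow> real" where
  "minima B = (\<lambda>n. Inf (f n ` B))"

definition tight :: "(nat \<Rightarrow> real) \<Rightarrow> bool" where
  "tight h \<longleftrightarrow> (\<forall>n. \<exists>x\<in>below h. f n x = h n)"

lemma continuous_attains_min:
  assumes g: "continuous_map X euclideanreal g" and B: "closedin X B" "B \<noteq> {}"
  obtains x where "x \<in> B" "g x = Inf (g ` B)" "\<And>y. y \<in> B \<Longrightarrow> g x \<le> g y"
proof -
  have "compactin euclideanreal (g ` B)"
    using closedin_compact_space[OF compact_X B(1)] g image_compactin by blast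
  then have "compact (g ` B)" by simp
  then obtain s where s: "s \<in> g ` B" "\<forall>t\<in>g ` B. s \<le> t"
    using compact_attains_inf[of "g ` B"] B(2) by blast
  then have "Inf (g ` B) = s"
    by (intro cInf_eq_minimum) auto
  moreover obtain x where "x \<in> B" "s = g x"
    using s(1) by blast
  ultimately show thesis
    using s(2) that[of x] by simp
qed

text \<open>A point off \<open>B\<close> has a basic sublevel set missing \<open>B\<close>, so some
  \<open>f n\<close> is smaller there than its minimum over \<open>B\<close>.\<close>

lemma below_minima:
  assumes B: "closedin X B" "B \<noteq> {}"
  shows "below (minima B) = B"
proof
  show "B \<subseteq> below (minima B)"
  proof
    fix y assume y: "y \<in> B"
    have "minima B n \<le> f n y" for n
      using continuous_attains_min[OF f_cont[of n] B] y unfolding minima_def by metis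
    then show "y \<in> below (minima B)"
      using y closedin_subset[OF B(1)] by (auto simp: below_def)
  qed
  show "below (minima B) \<subseteq> B"
  proof (rule ccontr)
    assume "\<not> below (minima B) \<subseteq> B"
    then obtain x where x: "x \<in> below (minima B)" "x \<notin> B" by blast
    have "openin X (topspace X - B)" "x \<in> topspace X - B"
      using B(1) x by (auto simp: below_def)
    then obtain n c where c: "f n x < c" "\<forall>y\<in>topspace X. f n y < c \<longrightarrow> y \<in> topspace X - B"
      using f_base by blast
    obtain y where "y \<in> B" "f n y = minima B n"
      using continuous_attains_min[OF f_cont[of n] B] unfolding minima_def by metis
    moreover have "minima B n \<le> f n x"
      using x(1) by (simp add: below_def)
    ultimately have "y \<in> topspace X - B"
      using c closedin_subset[OF B(1)] by fastforce
    then show False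
      using \<open>y \<in> B\<close> by blast
  qed
qed

lemma tight_minima:
  assumes "closedin X B" "B \<noteq> {}"
  shows "tight (minima B)"
  unfolding tight_def below_minima[OF assms]
  using continuous_attains_min[OF f_cont assms] unfolding minima_def by metis

lemma below_closed: "closedin X (below h)"
proof -
  have "closedin X (topspace X \<inter> (\<Inter>n. {x \<in> topspace X. f n x \<in> {h n..}}))"
    by (intro closedin_Int closedin_topspace closedin_INT closedin_continuous_map_preimage[OF f_cont]) auto
  moreover have "topspace X \<inter> (\<Inter>n. {x \<in> topspace X. f n x \<in> {h n..}}) = below h"
    by (auto simp: below_def)
  ultimately show ?thesis by simp
qed

lemma tight_nonempty: "tight h \<Longrightarrow> below h \<noteq> {}"
  by (auto simp: tight_def)

lemma minima_below:
  assumes "tight h"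
  shows "minima (below h) = h"
proof
  fix n
  obtain x where "x \<in> below h" "f n x = h n"
    using assms by (auto simp: tight_def)
  then have "h n \<in> f n ` below h"
    by (metis imageI)
  then show "minima (below h) n = h n"
    unfolding minima_def by (rule cInf_eq_minimum) (auto simp: below_def)
qed

lemma closedin_below_graph: "closedin (prod_topology X Rseq) {(x, h). x \<in> below h}"
proof -
  let ?P = "prod_topology X Rseq"
  have "closedin ?P {z \<in> topspace ?P. snd z n - f n (fst z) \<in> {..0}}" for n
  proof (rule closedin_continuous_map_preimage)
    have "continuous_map ?P euclideanreal ((\<lambda>h. h n) \<circ> snd)" "continuous_map ?P euclideanreal (f n \<circ> fst)"
      using continuous_map_compose[OF continuous_map_snd continuous_Rseq_coordinate]
        continuous_map_compose[OF continuous_map_fst f_cont] by blast+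
    then show "continuous_map ?P euclideanreal (\<lambda>z. snd z n - f n (fst z))"
      unfolding o_def by (rule continuous_map_diff)
  qed simp
  then have "closedin ?P (topspace ?P \<inter> (\<Inter>n. {z \<in> topspace ?P. snd z n - f n (fst z) \<in> {..0}}))"
    by (intro closedin_Int closedin_topspace closedin_INT) auto
  moreover have "topspace ?P \<inter> (\<Inter>n. {z \<in> topspace ?P. snd z n - f n (fst z) \<in> {..0}})
      = {(x, h). x \<in> below h}"
    by (auto simp: below_def)
  ultimately show ?thesis by simp
qed

text \<open>As \<open>X\<close> is compact, projecting along it is a closed map; this is upper
  semicontinuity of \<open>below\<close>.\<close>

lemma closedin_hits:
  assumes "closedin X C"
  shows "closedin Rseq {h. \<exists>x\<in>C. x \<in> below h}"
proof -
  have "closedin (prod_topology X Rseq) ({(x, h). x \<in> below h} \<inter> C \<times> topspace Rseq)"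
    using assms by (intro closedin_Int closedin_below_graph) (simp only: closedin_prod_Times_iff closedin_topspace, simp)
  then have "closedin Rseq (snd ` ({(x, h). x \<in> below h} \<inter> C \<times> topspace Rseq))"
    using closed_map_snd[OF compact_X, of Rseq] unfolding closed_map_def by blast
  moreover have "snd ` ({(x, h). x \<in> below h} \<inter> C \<times> topspace Rseq) = {h. \<exists>x\<in>C. x \<in> below h}"
    by force
  ultimately show ?thesis by simp
qed

lemma openin_below_subset:
  assumes "openin X G"
  shows "openin Rseq {h. below h \<subseteq> G}"
proof -
  have "closedin Rseq {h. \<exists>x\<in>topspace X - G. x \<in> below h}"
    using assms by (intro closedin_hits) blast
  then have "openin Rseq (topspace Rseq - {h. \<exists>x\<in>topspace X - G. x \<in> below h})"
    by blast
  moreover have "topspace Rseq - {h. \<exists>x\<in>topspace X - G. x \<in> below h} = {h. below h \<subseteq> G}"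
    by (auto simp: below_def)
  ultimately show ?thesis by simp
qed

text \<open>Lower semicontinuity is where tightness enters: a small bound \<open>h' n\<close> yields
  a point of \<open>below h'\<close> in the sublevel set because the bound is attained.\<close>

lemma tight_hits_open:
  assumes "openin X U" "x \<in> U" "x \<in> below h"
  obtains G where "openin Rseq G" "h \<in> G" "\<And>h'. h' \<in> G \<Longrightarrow> tight h' \<Longrightarrow> below h' \<inter> U \<noteq> {}"
proof -
  obtain n c where c: "f n x < c" "\<forall>y\<in>topspace X. f n y < c \<longrightarrow> y \<in> U"
    using f_base assms by blast
  have "below h' \<inter> U \<noteq> {}" if h': "h' \<in> {h. h n < c}" "tight h'" for h'
  proof -
    obtain y where "y \<in> below h'" "f n y = h' n"
      using h'(2) by (auto simp: tight_def)
    then show ?thesis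
      using c(2) h'(1) by (auto simp: below_def)
  qed
  moreover have "h \<in> {h. h n < c}"
    using assms(3) c(1) by (auto simp: below_def intro: le_less_trans)
  ultimately show thesis
    using that openin_Rseq_less by metis
qed

lemma closedin_tight: "closedin Rseq {h. tight h}"
proof -
  let ?P = "prod_topology X Rseq"
  let ?E = "\<lambda>n. {z \<in> topspace ?P. (f n \<circ> fst) z = ((\<lambda>h. h n) \<circ> snd) z}"
  have "closedin Rseq {h. \<exists>x\<in>below h. f n x = h n}" for n
  proof -
    have "continuous_map ?P euclideanreal ((\<lambda>h. h n) \<circ> snd)" "continuous_map ?P euclideanreal (f n \<circ> fst)"
      using continuous_map_compose[OF continuous_map_snd continuous_Rseq_coordinate]
        continuous_map_compose[OF continuous_map_fst f_cont] by blast+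
    then have "closedin ?P (?E n)"
      using closedin_equalizer[of euclideanreal ?P "f n \<circ> fst" "(\<lambda>h. h n) \<circ> snd"] by simp
    then have "closedin ?P ({(x, h). x \<in> below h} \<inter> (?E n))"
      by (intro closedin_Int closedin_below_graph)
    then have "closedin Rseq (snd ` ({(x, h). x \<in> below h} \<inter> (?E n)))"
      using closed_map_snd[OF compact_X, of Rseq] unfolding closed_map_def by blast
    moreover have "snd ` ({(x, h). x \<in> below h} \<inter> (?E n))
        = {h. \<exists>x\<in>below h. f n x = h n}"
      by (force simp: below_def)
    ultimately show ?thesis by simp
  qed
  then have "closedin Rseq (\<Inter>n. {h. \<exists>x\<in>below h. f n x = h n})"
    by (intro closedin_INT) auto
  moreover have "(\<Inter>n. {h. \<exists>x\<in>below h. f n x = h n}) = {h. tight h}"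
    by (auto simp: tight_def)
  ultimately show ?thesis by simp
qed

text \<open>Attained bounds are values of the \<open>f n\<close>, so codes stay in a product of
  compact ranges.\<close>

lemma compactin_tight:
  assumes "closedin Rseq Y" "Y \<subseteq> {h. tight h}"
  shows "compactin Rseq Y"
proof -
  have "compactin euclideanreal (f n ` topspace X)" for n
    using compact_X f_cont image_compactin unfolding compact_space_def by blast
  then have "compactin Rseq (\<Pi>\<^sub>E n\<in>UNIV. f n ` topspace X)"
    by (simp add: compactin_PiE)
  moreover have "Y \<subseteq> (\<Pi>\<^sub>E n\<in>UNIV. f n ` topspace X)"
  proof
    fix h assume "h \<in> Y"
    then have "tight h" using assms(2) by blast
    then have "h n \<in> f n ` topspace X" for n
      unfolding tight_def below_def by (metis (no_types, lifting) image_eqI mem_Collect_eq)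
    then show "h \<in> (\<Pi>\<^sub>E n\<in>UNIV. f n ` topspace X)"
      by (simp add: PiE_iff)
  qed
  ultimately show ?thesis
    using assms(1) closed_compactin by blast
qed

text \<open>Each half of the Vietoris topology gives one of the two semicontinuities. The result is
  applied to \<open>f n\<close> composed with \<open>S\<close>, to see that shifting codes is
  continuous.\<close>

lemma continuous_Inf_below:
  assumes g: "continuous_map X euclideanreal g" and Y: "Y \<subseteq> {h. tight h}"
  shows "continuous_map (subtopology Rseq Y) euclideanreal (\<lambda>h. Inf (g ` below h))"
  unfolding continuous_map_upper_lower_semicontinuous_lt
proof (intro allI conjI)
  fix a
  have minimum: "\<exists>x\<in>below h. g x = Inf (g ` below h) \<and> (\<forall>y\<in>below h. g x \<le> g y)" if "tight h" for h
    using continuous_attains_min[OF g below_closed tight_nonempty[OF that]] by metis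
  have g_open: "openin X {x \<in> topspace X. a < g x}" "openin X {x \<in> topspace X. g x < a}"
    using openin_continuous_map_preimage[OF g, of "{a<..}"]
      openin_continuous_map_preimage[OF g, of "{..<a}"] by simp_all
  have "{h \<in> topspace (subtopology Rseq Y). a < Inf (g ` below h)} = {h. below h \<subseteq> {x \<in> topspace X. a < g x}} \<inter> Y"
  proof (intro equalityI subsetI)
    fix h assume h: "h \<in> {h. below h \<subseteq> {x \<in> topspace X. a < g x}} \<inter> Y"
    then show "h \<in> {h \<in> topspace (subtopology Rseq Y). a < Inf (g ` below h)}"
      using minimum[of h] Y by force
  next
    fix h assume h: "h \<in> {h \<in> topspace (subtopology Rseq Y). a < Inf (g ` below h)}"
    then show "h \<in> {h. below h \<subseteq> {x \<in> topspace X. a < g x}} \<inter> Y"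
      using minimum[of h] Y by (fastforce simp: below_def)
  qed
  then show "openin (subtopology Rseq Y) {h \<in> topspace (subtopology Rseq Y). a < Inf (g ` below h)}"
    using openin_below_subset[OF g_open(1)] by (auto simp: openin_subtopology)
  show "openin (subtopology Rseq Y) {h \<in> topspace (subtopology Rseq Y). Inf (g ` below h) < a}"
  proof (subst openin_subopen, intro ballI)
    fix h assume "h \<in> {h \<in> topspace (subtopology Rseq Y). Inf (g ` below h) < a}"
    then have h: "h \<in> Y" "Inf (g ` below h) < a" by auto
    note h(2)
    moreover obtain x where "x \<in> below h" "g x = Inf (g ` below h)"
      using minimum[of h] Y h(1) by blast
    ultimately have x: "x \<in> below h" "g x < a"
      by auto
    then obtain G where G: "openin Rseq G" "h \<in> G"
      "\<And>h'. h' \<in> G \<Longrightarrow> tight h' \<Longrightarrow> below h' \<inter> {x \<in> topspace X. g x < a} \<noteq> {}"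
      using tight_hits_open[OF g_open(2), of x h] by (auto simp: below_def)
    have "Inf (g ` below h') < a" if "h' \<in> G" "h' \<in> Y" for h'
      using minimum[of h'] G(3)[of h'] that Y by fastforce
    then show "\<exists>T. openin (subtopology Rseq Y) T \<and> h \<in> T \<and>
        T \<subseteq> {h \<in> topspace (subtopology Rseq Y). Inf (g ` below h) < a}"
      using G h by (intro exI[of _ "G \<inter> Y"]) (auto simp: openin_subtopology)
  qed
qed

end

text \<open>The base functions separate points. The embedding serves to move the extension, built on
  pairs of a point and a code, into the type of real sequences.\<close>

lemma compact_metrizable_embedding:
  assumes "compact_space Z" "metrizable_space Z"
  obtains e where "homeomorphic_map Z (subtopology Rseq (e ` topspace Z)) e"
proof -
  obtain f where "functional_base Z f"
    using ex_functional_base[OF assms] .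
  then interpret functional_base Z f .
  let ?e = "\<lambda>z n. f n z"
  have cont: "continuous_map Z Rseq ?e"
    using f_cont by (simp add: continuous_map_componentwise_UNIV)
  have "inj_on ?e (topspace Z)"
  proof
    fix x y assume xy: "x \<in> topspace Z" "y \<in> topspace Z" "?e x = ?e y"
    show "x = y"
    proof (rule ccontr)
      assume "x \<noteq> y"
      then obtain U where "openin Z U" "x \<in> U" "y \<notin> U"
        using Hausdorff_X xy unfolding Hausdorff_space_def disjnt_def by blast
      then obtain n c where "f n x < c" "\<forall>y\<in>topspace Z. f n y < c \<longrightarrow> y \<in> U"
        using f_base by blast
      then show False
        using xy \<open>y \<notin> U\<close> by (metis (no_types, lifting))
    qed
  qed
  then have "homeomorphic_map Z (subtopology Rseq (?e ` topspace Z)) ?e"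
    using compact_X cont Hausdorff_Rseq
    by (intro continuous_imp_homeomorphic_map) (auto simp: continuous_map_in_subtopology Hausdorff_space_subtopology)
  then show thesis by (rule that)
qed

section \<open>Opening the quotient map\<close>

locale open_model = minimal_zsys X S + functional_base X f
  for X :: "'a topology" and S f +
  fixes k :: nat
begin

section \<open>Classes, saturations and saturated open sets\<close>

definition cls :: "'a \<Rightarrow> 'a set" where
  "cls x = {y. RP k x y}"

definition sat :: "'a set \<Rightarrow> 'a set" where
  "sat B = {y. \<exists>x\<in>B. RP k x y}"

lemma cls_subset: "cls x \<subseteq> M"
  using RP_in by (auto simp: cls_def)

lemma cls_refl: "x \<in> M \<Longrightarrow> x \<in> cls x"
  by (simp add: cls_def RP_refl)

lemma cls_eq: "y \<in> cls x \<Longrightarrow> cls y = cls x"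
  unfolding cls_def using RP_sym RP_trans by blast

lemma cls_T: "x \<in> M \<Longrightarrow> y \<in> cls x \<longleftrightarrow> y \<in> M \<and> T t y \<in> cls (T t x)"
  unfolding cls_def using RP_T[of k x y t] RP_T[of k "T t x" "T t y" "- t"] RP_in(2)[of k x y] by auto

lemma sat_mono: "B \<subseteq> C \<Longrightarrow> sat B \<subseteq> sat C"
  by (auto simp: sat_def)

lemma sat_sat: "sat (sat B) = sat B"
  unfolding sat_def using RP_trans RP_sym RP_refl RP_in(2) by blast

lemma subset_sat: "B \<subseteq> M \<Longrightarrow> B \<subseteq> sat B"
  unfolding sat_def using RP_refl by blast

lemma closedin_sat:
  assumes "closedin X B"
  shows "closedin X (sat B)"
proof -
  have "closedin (prod_topology X X) ({(x, y). RP k x y} \<inter> B \<times> M)"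
    using assms by (intro closedin_Int closedin_RP) (simp add: closedin_prod_Times_iff)
  then have "closedin X (snd ` ({(x, y). RP k x y} \<inter> B \<times> M))"
    using closed_map_snd[OF compact, of X] unfolding closed_map_def by blast
  moreover have "snd ` ({(x, y). RP k x y} \<inter> B \<times> M) = sat B"
    using RP_in(2) by (force simp: sat_def)
  ultimately show ?thesis by simp
qed

lemma closedin_cls: "x \<in> M \<Longrightarrow> closedin X (cls x)"
proof -
  assume "x \<in> M"
  then have "closedin X (sat {x})"
    using Hausdorff by (intro closedin_sat) (simp add: closedin_Hausdorff_singleton)
  then show ?thesis
    by (simp add: sat_def cls_def)
qed

lemma openin_cls_subset:
  assumes "openin X G"
  shows "openin X {x \<in> M. cls x \<subseteq> G}"
proof -
  have "openin X (M - sat (M - G))"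
    using assms closedin_sat by blast
  moreover have "M - sat (M - G) = {x \<in> M. cls x \<subseteq> G}"
    unfolding sat_def cls_def using RP_sym RP_in(2) by blast
  ultimately show ?thesis by simp
qed

text \<open>These are the open sets of the quotient, pulled back to \<open>X\<close>.\<close>

definition saturated_open :: "'a set \<Rightarrow> bool" where
  "saturated_open W \<longleftrightarrow> openin X W \<and> (\<forall>x\<in>W. cls x \<subseteq> W)"

lemma saturated_open_diff_sat:
  assumes "saturated_open W" "closedin X B"
  shows "saturated_open (W - sat B)"
proof -
  have "openin X (W - sat B)"
    using assms closedin_sat by (auto simp: saturated_open_def)
  moreover have "cls x \<subseteq> W - sat B" if "x \<in> W - sat B" for x
  proof -
    have "cls x \<subseteq> W"
      using that assms(1) by (auto simp: saturated_open_def)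
    moreover have "y \<notin> sat B" if "y \<in> cls x" for y
    proof
      assume "y \<in> sat B"
      then obtain b where "b \<in> B" "RP k b y" by (auto simp: sat_def)
      moreover have "RP k y x"
        using that RP_sym by (simp add: cls_def)
      ultimately have "RP k b x"
        using RP_trans by blast
      then have "x \<in> sat B"
        using \<open>b \<in> B\<close> by (auto simp: sat_def)
      then show False
        using \<open>x \<in> W - sat B\<close> by blast
    qed
    ultimately show ?thesis by blast
  qed
  ultimately show ?thesis
    by (simp add: saturated_open_def)
qed

text \<open>A finite version of Baire's theorem in the quotient: what the first closed saturated set
  leaves uncovered is saturated open, and if nonempty it is covered by the remaining ones.\<close>

lemma finite_sat_cover:
  assumes "finite F" "\<And>i. i \<in> F \<Longrightarrow> closedin X (B i)"
    and "saturated_open W" "W \<noteq> {}" "W \<subseteq> (\<Union>i\<in>F. sat (B i))"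
  shows "\<exists>i\<in>F. \<exists>V. saturated_open V \<and> V \<noteq> {} \<and> V \<subseteq> sat (B i)"
  using assms
proof (induction F arbitrary: W rule: finite_induct)
  case empty
  then show ?case by simp
next
  case (insert j F)
  show ?case
  proof (cases "W \<subseteq> sat (B j)")
    case True
    then show ?thesis
      using insert.prems by blast
  next
    case False
    have "saturated_open (W - sat (B j))"
      using saturated_open_diff_sat insert.prems by blast
    moreover have "W - sat (B j) \<noteq> {}"
      using False by blast
    moreover have "W - sat (B j) \<subseteq> (\<Union>i\<in>F. sat (B i))"
      using insert.prems(4) by auto
    ultimately have "\<exists>i\<in>F. \<exists>V. saturated_open V \<and> V \<noteq> {} \<and> V \<subseteq> sat (B i)"
      using insert.IH[of "W - sat (B j)"] insert.prems(1) by blast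
    then show ?thesis by blast
  qed
qed

text \<open>Minimality makes the quotient map semi-open: finitely many translates of a set with interior
  cover \<open>X\<close>, so the saturation of one of them, hence of each of them, has interior in the quotient.\<close>

lemma sat_has_interior:
  assumes V: "openin X V" "V \<noteq> {}" and K: "closedin X K" "V \<subseteq> K"
  obtains W where "saturated_open W" "W \<noteq> {}" "W \<subseteq> sat K"
proof -
  let ?V = "\<lambda>t. {x \<in> M. T t x \<in> V}"
  have "M \<subseteq> (\<Union>t. ?V t)"
    using orbit_meets_open[OF _ V] by blast
  moreover have "\<forall>U\<in>range ?V. openin X U"
    using open_T_preimage V(1) by blast
  ultimately obtain \<F> where \<F>: "finite \<F>" "\<F> \<subseteq> range ?V" "M \<subseteq> \<Union>\<F>"
    using compact unfolding compact_space_alt by (metis (no_types, lifting))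
  then obtain F where F: "finite F" "\<F> = ?V ` F"
    by (meson finite_subset_image)
  let ?K = "\<lambda>t. {x \<in> M. T t x \<in> K}"
  have K': "closedin X (?K t)" if "t \<in> F" for t
    by (rule closedin_continuous_map_preimage[OF T_continuous K(1)])
  have sat_top: "saturated_open M"
    using cls_subset by (simp add: saturated_open_def)
  have nonempty: "M \<noteq> {}"
    using V openin_subset by fastforce
  have cover: "M \<subseteq> (\<Union>t\<in>F. sat (?K t))"
  proof
    fix x assume x: "x \<in> M"
    then obtain t where "t \<in> F" "x \<in> ?V t"
      using \<F>(3) F(2) by blast
    then show "x \<in> (\<Union>t\<in>F. sat (?K t))"
      using K(2) subset_sat[of "?K t"] by blast
  qed
  obtain t W where W: "saturated_open W" "W \<noteq> {}" "W \<subseteq> sat (?K t)"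
    using finite_sat_cover[OF F(1) K' sat_top nonempty cover] by blast
  have WX: "W \<subseteq> M"
    using W(1) openin_subset by (auto simp: saturated_open_def)
  \<comment> \<open>The image of \<open>W\<close> under \<open>T t\<close>: this undoes the
    translation and lies in the saturation of \<open>K\<close> itself.\<close>
  let ?W = "{x \<in> M. T (- t) x \<in> W}"
  have "cls x \<subseteq> ?W" if "x \<in> ?W" for x
    using that W(1) cls_T[of x _ "- t"] unfolding saturated_open_def by blast
  then have "saturated_open ?W"
    using W(1) open_T_preimage by (simp add: saturated_open_def)
  moreover obtain w where w: "w \<in> W" using W(2) by blast
  then have "T t w \<in> ?W"
    using WX by auto
  then have "?W \<noteq> {}" by blast
  moreover have "?W \<subseteq> sat K"
  proof
    fix x assume x: "x \<in> ?W"
    then obtain y where y: "y \<in> ?K t" "RP k y (T (- t) x)"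
      using W(3) by (auto simp: sat_def)
    then have "RP k (T t y) x"
      using RP_T[OF y(2), of t] x by simp
    then show "x \<in> sat K"
      using y(1) by (auto simp: sat_def)
  qed
  ultimately show thesis
    using that by blast
qed

text \<open>The points over which the classes, as a function on the quotient, vary continuously; \<open>D\<close> is a
  saturated dense G-delta set of such points.\<close>

definition Cont :: "'a set" where
  "Cont = {x \<in> M. \<forall>V. openin X V \<and> cls x \<inter> V \<noteq> {} \<longrightarrow> cls x \<subseteq> X interior_of (sat V)}"

definition sublevel :: "nat \<times> real \<Rightarrow> 'a set" where
  "sublevel b = {x \<in> M. f (fst b) x \<le> snd b}"

text \<open>Continuity of the class, tested on one closed sublevel set: either the class misses it,
  or its saturation is a neighbourhood of the class. Closedness of the sublevel set makes the first
  alternative open, and restricting to rational levels leaves countably many conditions.\<close>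

definition stable :: "nat \<times> real \<Rightarrow> 'a set" where
  "stable b = {x \<in> M. cls x \<subseteq> M - sublevel b} \<union>
     {x \<in> M. cls x \<subseteq> X interior_of (sat (sublevel b))}"

definition D :: "'a set" where
  "D = M \<inter> \<Inter>(stable ` (UNIV \<times> \<rat>))"

lemma closed_sublevel: "closedin X (sublevel b)"
  unfolding sublevel_def by (rule f_closed)

lemma openin_stable: "openin X (stable b)"
  unfolding stable_def
  by (intro openin_Un openin_cls_subset openin_diff openin_topspace openin_interior_of closed_sublevel)

lemma stable_saturated: "x \<in> stable b \<Longrightarrow> cls x \<subseteq> stable b"
  using cls_subset cls_eq unfolding stable_def by blast

lemma sublevel_base:
  assumes "openin X V" "x \<in> V"
  obtains n c where "c \<in> \<rat>" "f n x < c" "sublevel (n, c) \<subseteq> V"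
proof -
  obtain n c where c: "f n x < c" "\<forall>y\<in>M. f n y < c \<longrightarrow> y \<in> V"
    using f_base[OF assms] by blast
  obtain c' where "c' \<in> \<rat>" "f n x < c'" "c' < c"
    using Rats_dense_in_real[OF c(1)] by blast
  moreover from this have "sublevel (n, c') \<subseteq> V"
    using c(2) by (auto simp: sublevel_def)
  ultimately show thesis
    using that by blast
qed

text \<open>If a nonempty open \<open>V\<close> missed \<open>stable b\<close>, each class of a
  point of \<open>V\<close> would meet the sublevel set. A saturated open set inside the saturation
  of a piece of \<open>V\<close> then lies in the saturation of the sublevel set and contains the
  class of a point of \<open>V\<close>, which is therefore stable after all.\<close>

lemma dense_stable: "X closure_of (stable b) = M"
proof -
  have "stable b \<inter> V \<noteq> {}" if V: "openin X V" "V \<noteq> {}" for V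
  proof (rule ccontr)
    assume disjoint: "\<not> stable b \<inter> V \<noteq> {}"
    have VX: "V \<subseteq> M"
      using V openin_subset by blast
    have V_sat: "V \<subseteq> sat (sublevel b)"
    proof
      fix x assume x: "x \<in> V"
      then have "\<not> cls x \<subseteq> M - sublevel b"
        using disjoint VX by (auto simp: stable_def)
      then obtain y where "y \<in> sublevel b" "y \<in> cls x"
        using cls_subset by blast
      then show "x \<in> sat (sublevel b)"
        using RP_sym by (auto simp: sat_def cls_def)
    qed
    obtain x where x: "x \<in> V" using V by blast
    obtain n c where nc: "f n x < c" "sublevel (n, c) \<subseteq> V"
      using sublevel_base[OF V(1) x] by metis
    obtain W where W: "saturated_open W" "W \<noteq> {}" "W \<subseteq> sat (sublevel (n, c))"
    proof (rule sat_has_interior)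
      show "openin X {y \<in> M. f n y < c}"
        by (rule f_open)
      show "{y \<in> M. f n y < c} \<noteq> {}"
        using x VX nc(1) by blast
      show "closedin X (sublevel (n, c))"
        by (rule closed_sublevel)
      show "{y \<in> M. f n y < c} \<subseteq> sublevel (n, c)"
        by (auto simp: sublevel_def)
    qed
    obtain w where w: "w \<in> W" using W(2) by blast
    then obtain v where v: "v \<in> sublevel (n, c)" "RP k v w"
      using W(3) by (auto simp: sat_def)
    then have vW: "cls v \<subseteq> W"
      using w W(1) cls_eq[of w v] by (auto simp: saturated_open_def cls_def)
    have "W \<subseteq> sat (sublevel b)"
      using W(3) sat_mono[OF nc(2)] sat_mono[OF V_sat] sat_sat by blast
    then have "W \<subseteq> X interior_of (sat (sublevel b))"
      using W(1) by (simp add: interior_of_maximal saturated_open_def)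
    then have "v \<in> stable b"
      using vW RP_in(1)[OF v(2)] by (auto simp: stable_def)
    then show False
      using disjoint v(1) nc(2) by blast
  qed
  then show ?thesis
    using dense_intersects_open[of X "stable b"] openin_subset[OF openin_stable] by auto
qed

lemma dense_gdelta_D: "dense_gdelta X D"
  unfolding D_def
  by (rule dense_gdelta_Inter[OF compact Hausdorff])
    (auto simp: openin_stable dense_stable countable_rat)

lemma D_subset_Cont: "D \<subseteq> Cont"
proof
  fix x assume x: "x \<in> D"
  have "cls x \<subseteq> X interior_of (sat V)" if V: "openin X V" "cls x \<inter> V \<noteq> {}" for V
  proof -
    obtain y where y: "y \<in> cls x" "y \<in> V" using V by blast
    obtain n c where nc: "c \<in> \<rat>" "f n y < c" "sublevel (n, c) \<subseteq> V"
      using sublevel_base[OF V(1) y(2)] by metis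
    have "x \<in> stable (n, c)"
      using x nc(1) by (auto simp: D_def)
    moreover have "y \<in> sublevel (n, c)"
      using nc(2) y(1) cls_subset by (auto simp: sublevel_def)
    ultimately have "cls x \<subseteq> X interior_of (sat (sublevel (n, c)))"
      using y(1) by (auto simp: stable_def)
    then show ?thesis
      using interior_of_mono[OF sat_mono[OF nc(3)], of X] by blast
  qed
  then show "x \<in> Cont"
    using x by (simp add: Cont_def D_def)
qed

lemma D_saturated: "x \<in> D \<Longrightarrow> cls x \<subseteq> D"
  using stable_saturated cls_subset unfolding D_def by blast

text \<open>Invariance is proved for \<open>Cont\<close> rather than for \<open>D\<close>, whose
  definition singles out the levels of the functions \<open>f n\<close>. This is enough to shift
  codes, as \<open>Ys\<close> turns out to contain the codes of all points of
  \<open>Cont\<close>.\<close>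

lemma Cont_T:
  assumes x: "x \<in> Cont"
  shows "T t x \<in> Cont"
proof -
  have xX: "x \<in> M" using x by (simp add: Cont_def)
  have "cls (T t x) \<subseteq> X interior_of (sat V)" if V: "openin X V" "cls (T t x) \<inter> V \<noteq> {}" for V
  proof -
    let ?V = "{y \<in> M. T t y \<in> V}"
    obtain y where y: "y \<in> cls (T t x)" "y \<in> V" using V(2) by blast
    then have yX: "y \<in> M"
      using cls_subset by blast
    then have "T (- t) y \<in> cls x"
      using cls_T[OF xX, of "T (- t) y" t] y(1) by simp
    then have "cls x \<inter> ?V \<noteq> {}"
      using y(2) yX by auto
    then have sub: "cls x \<subseteq> X interior_of (sat ?V)"
      using x open_T_preimage[OF V(1)] by (simp add: Cont_def)
    let ?G = "{y \<in> M. T (- t) y \<in> X interior_of (sat ?V)}"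
    have "?G \<subseteq> sat V"
    proof
      fix z assume z: "z \<in> ?G"
      then have "T (- t) z \<in> sat ?V"
        using interior_of_subset[of X "sat ?V"] by blast
      then obtain y where "y \<in> ?V" "RP k y (T (- t) z)"
        by (auto simp: sat_def)
      then show "z \<in> sat V"
        using RP_T[of k y "T (- t) z" t] z by (auto simp: sat_def)
    qed
    then have "?G \<subseteq> X interior_of (sat V)"
      by (intro interior_of_maximal open_T_preimage) auto
    moreover have "cls (T t x) \<subseteq> ?G"
    proof
      fix z assume z: "z \<in> cls (T t x)"
      then have zX: "z \<in> M"
        using cls_subset by blast
      then have "T (- t) z \<in> cls x"
        using cls_T[OF xX, of "T (- t) z" t] z by simp
      then show "z \<in> ?G"
        using sub zX by blast
    qed
    ultimately show ?thesis by blast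
  qed
  then show ?thesis
    using xX by (simp add: Cont_def)
qed

section \<open>The space of codes and the pairs of a point and a code\<close>

definition code :: "'a \<Rightarrow> nat \<Rightarrow> real" where
  "code x = minima (cls x)"

definition Ys :: "(nat \<Rightarrow> real) set" where
  "Ys = Rseq closure_of (code ` D)"

lemma below_code: "x \<in> M \<Longrightarrow> below (code x) = cls x"
  unfolding code_def using closedin_cls cls_refl by (intro below_minima) auto

lemma tight_code: "x \<in> M \<Longrightarrow> tight (code x)"
  unfolding code_def using closedin_cls cls_refl by (intro tight_minima) auto

lemma D_subset: "D \<subseteq> M"
  by (auto simp: D_def)

lemma closedin_Ys: "closedin Rseq Ys"
  by (simp add: Ys_def)

lemma code_D_in_Ys: "x \<in> D \<Longrightarrow> code x \<in> Ys"
  unfolding Ys_def using closure_of_subset[of "code ` D" Rseq] by auto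

lemma Ys_tight: "Ys \<subseteq> {h. tight h}"
  unfolding Ys_def using tight_code D_subset by (intro closure_of_minimal closedin_tight) auto

lemma compactin_Ys: "compactin Rseq Ys"
  using compactin_tight closedin_Ys Ys_tight by blast

lemma Ys_approx:
  assumes "h \<in> Ys" "openin Rseq G" "h \<in> G"
  obtains x where "x \<in> D" "code x \<in> G"
  using assms unfolding Ys_def in_closure_of by blast

text \<open>The future \<open>X'\<close>, up to a change of type: the fibre of the second projection
  over \<open>h\<close> is a copy of the set coded by \<open>h\<close>, which is why that projection
  is open.\<close>

definition Zs :: "('a \<times> (nat \<Rightarrow> real)) set" where
  "Zs = {(x, h). h \<in> Ys \<and> x \<in> below h}"

lemma Zs_subset: "Zs \<subseteq> M \<times> Ys"
  by (auto simp: Zs_def below_def)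

lemma closedin_Zs: "closedin (prod_topology X Rseq) Zs"
proof -
  have "closedin (prod_topology X Rseq) ({(x, h). x \<in> below h} \<inter> M \<times> Ys)"
    using closedin_Ys by (intro closedin_Int closedin_below_graph) (simp add: closedin_prod_Times_iff)
  moreover have "{(x, h). x \<in> below h} \<inter> M \<times> Ys = Zs"
    by (auto simp: Zs_def below_def)
  ultimately show ?thesis by simp
qed

text \<open>The first projection of \<open>Zs\<close> is closed because \<open>Ys\<close> is
  compact, and it contains the dense set \<open>D\<close>.\<close>

lemma Ys_lift:
  assumes "x \<in> M"
  obtains h where "h \<in> Ys" "x \<in> below h"
proof -
  have "closedin (subtopology (prod_topology X Rseq) (M \<times> Ys)) Zs"
    by (rule closedin_subset_topspace[OF closedin_Zs Zs_subset])
  then have "closedin (prod_topology X (subtopology Rseq Ys)) Zs"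
    by (simp add: subtopology_Times)
  moreover have "compact_space (subtopology Rseq Ys)"
    using compactin_Ys by (simp add: compact_space_subtopology)
  ultimately have closed: "closedin X (fst ` Zs)"
    using closed_map_fst unfolding closed_map_def by blast
  have "D \<subseteq> fst ` Zs"
  proof
    fix x assume x: "x \<in> D"
    then have "(x, code x) \<in> Zs"
      using D_subset code_D_in_Ys below_code cls_refl by (auto simp: Zs_def)
    then show "x \<in> fst ` Zs"
      by force
  qed
  then have "X closure_of D \<subseteq> fst ` Zs"
    using closed by (rule closure_of_minimal)
  then have "x \<in> fst ` Zs"
    using assms dense_gdelta_D by (auto simp: dense_gdelta_def)
  then show thesis
    using that by (auto simp: Zs_def)
qed

text \<open>Two points of a coded limit set are approached by two points of a common class, and
  \<open>RP\<close> is closed.\<close>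

lemma Ys_below_related:
  assumes h: "h \<in> Ys" and a: "a \<in> below h" and b: "b \<in> below h"
  shows "RP k a b"
proof (rule ccontr)
  assume "\<not> RP k a b"
  moreover have "a \<in> M" "b \<in> M"
    using a b by (auto simp: below_def)
  ultimately have "(a, b) \<in> topspace (prod_topology X X) - {(x, y). RP k x y}"
    by simp
  moreover have "openin (prod_topology X X) (topspace (prod_topology X X) - {(x, y). RP k x y})"
    using closedin_RP by blast
  ultimately obtain U V where UV: "openin X U" "openin X V" "a \<in> U" "b \<in> V"
    "U \<times> V \<subseteq> topspace (prod_topology X X) - {(x, y). RP k x y}"
    unfolding openin_prod_topology_alt by meson
  obtain G where G: "openin Rseq G" "h \<in> G" "\<And>h'. h' \<in> G \<Longrightarrow> tight h' \<Longrightarrow> below h' \<inter> U \<noteq> {}"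
    using tight_hits_open[OF UV(1,3) a] by metis
  obtain G' where G': "openin Rseq G'" "h \<in> G'" "\<And>h'. h' \<in> G' \<Longrightarrow> tight h' \<Longrightarrow> below h' \<inter> V \<noteq> {}"
    using tight_hits_open[OF UV(2,4) b] by metis
  obtain x where x: "x \<in> D" "code x \<in> G \<inter> G'"
    using Ys_approx[OF h, of "G \<inter> G'"] G G' by blast
  then obtain u v where "u \<in> cls x" "u \<in> U" "v \<in> cls x" "v \<in> V"
    using G(3) G'(3) tight_code below_code D_subset by blast
  then show False
    using UV(5) RP_sym RP_trans unfolding cls_def by blast
qed

lemma Ys_below_subset_cls: "h \<in> Ys \<Longrightarrow> a \<in> below h \<Longrightarrow> below h \<subseteq> cls a"
  using Ys_below_related by (auto simp: cls_def)

text \<open>Suppose a point \<open>y\<close> of the class were absent from \<open>below h\<close>,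
  with \<open>f n y < c < h n\<close>. By continuity of the class at \<open>x\<close>, every class
  coming near \<open>a\<close> meets \<open>{f n < c}\<close>; but the codes of points of
  \<open>D\<close> near \<open>h\<close> exceed \<open>c\<close> at \<open>n\<close>, although their
  classes come near \<open>a\<close>.\<close>

lemma Ys_unique_over_Cont:
  assumes x: "x \<in> Cont" and h: "h \<in> Ys" and a: "a \<in> below h" "a \<in> cls x"
  shows "h = code x"
proof -
  have xX: "x \<in> M" using x by (simp add: Cont_def)
  have "cls x \<subseteq> below h"
  proof (rule ccontr)
    assume "\<not> cls x \<subseteq> below h"
    then obtain y where y: "y \<in> cls x" "y \<notin> below h" by blast
    then obtain n where "f n y < h n"
      using cls_subset by (force simp: below_def not_le)
    then obtain c where c: "f n y < c" "c < h n"
      using dense by blast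
    let ?V = "{z \<in> M. f n z < c}"
    have "cls x \<inter> ?V \<noteq> {}"
      using y(1) c(1) cls_subset by blast
    then have "a \<in> X interior_of (sat ?V)"
      using x a(2) f_open unfolding Cont_def by blast
    then obtain G where G: "openin Rseq G" "h \<in> G"
      "\<And>h'. h' \<in> G \<Longrightarrow> tight h' \<Longrightarrow> below h' \<inter> X interior_of (sat ?V) \<noteq> {}"
      using tight_hits_open[OF openin_interior_of _ a(1), of "sat ?V"] by blast
    have "openin Rseq (G \<inter> {h. c < h n})" "h \<in> G \<inter> {h. c < h n}"
      using G(1,2) openin_Rseq_greater[of c n] c(2) by auto
    then obtain x' where "x' \<in> D" "code x' \<in> G \<inter> {h. c < h n}"
      by (rule Ys_approx[OF h])
    then have x': "x' \<in> D" "code x' \<in> G" "c < code x' n" "x' \<in> M"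
      using D_subset by auto
    obtain b where b: "b \<in> cls x'" "b \<in> sat ?V"
      using G(3)[OF x'(2) tight_code[OF x'(4)]] below_code[OF x'(4)]
        interior_of_subset[of X "sat ?V"] by blast
    then obtain v where v: "v \<in> ?V" "RP k v b"
      unfolding sat_def by blast
    then have "v \<in> cls x'"
      using b(1) RP_sym RP_trans unfolding cls_def by blast
    then have "code x' n \<le> f n v"
      using below_code[OF x'(4)] by (auto simp: below_def)
    then show False
      using v(1) x'(3) by simp
  qed
  moreover have "below h \<subseteq> cls x"
    using Ys_below_subset_cls[OF h a(1)] cls_eq[OF a(2)] by simp
  ultimately have "below h = cls x" by blast
  then show ?thesis
    using minima_below[of h] h Ys_tight by (auto simp: code_def)
qed

lemma code_in_Ys:
  assumes "x \<in> Cont"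
  shows "code x \<in> Ys"
proof -
  have x: "x \<in> M" using assms by (simp add: Cont_def)
  obtain h where "h \<in> Ys" "x \<in> below h"
    using Ys_lift[OF x] .
  then show ?thesis
    using Ys_unique_over_Cont[OF assms] cls_refl[OF x] by blast
qed

end

section \<open>The systems on codes and on pairs\<close>

lemma equivariant_T:
  assumes "zsys X S" "zsys Y R" and \<phi>: "\<And>x. x \<in> topspace X \<Longrightarrow> \<phi> x \<in> topspace Y"
    and eq: "\<And>x. x \<in> topspace X \<Longrightarrow> \<phi> (S x) = R (\<phi> x)" and x: "x \<in> topspace X"
  shows "\<phi> (int_iter X S t x) = int_iter Y R t (\<phi> x)"
proof -
  interpret X: zsys X S by fact
  interpret Y: zsys Y R by fact
  show ?thesis
  proof (induction t rule: int_induct[where k = 0])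
    case (step1 i)
    then show ?case
      using X.T_succ[OF x] Y.T_succ[OF \<phi>[OF x]] eq x by simp
  next
    case (step2 i)
    have "R (\<phi> (X.T (i - 1) x)) = R (Y.T (i - 1) (\<phi> x))"
      using step2 eq[of "X.T (i - 1) x"] X.T_succ[OF x, of "i - 1"] Y.T_succ[OF \<phi>[OF x], of "i - 1"] x by simp
    then show ?case
      using inj_onD[OF Y.inj_S] \<phi> x by simp
  qed simp
qed

context open_model
begin

lemma closedin_S_image: "closedin X B \<Longrightarrow> closedin X (S ` B)"
  using homeomorphic_imp_closed_map[OF homeo] by (simp add: closed_map_def)

lemma S_image_cls: "x \<in> M \<Longrightarrow> S ` cls x = cls (S x)"
proof (intro equalityI subsetI)
  fix y assume x: "x \<in> M" and "y \<in> S ` cls x"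
  then obtain z where "y = S z" "z \<in> cls x" by blast
  then show "y \<in> cls (S x)"
    using cls_T[OF x, of z 1] by simp
next
  fix y assume x: "x \<in> M" and y: "y \<in> cls (S x)"
  then have "y \<in> M" using cls_subset by blast
  then have "y = S (T (- 1) y)" "T (- 1) y \<in> M"
    using T_inverse(2)[of y 1] by simp_all
  then show "y \<in> S ` cls x"
    using cls_T[OF x, of "T (- 1) y" 1] y by auto
qed

definition shift_code :: "(nat \<Rightarrow> real) \<Rightarrow> nat \<Rightarrow> real" where
  "shift_code h = minima (S ` below h)"

lemma below_shift_code: "tight h \<Longrightarrow> below (shift_code h) = S ` below h"
  unfolding shift_code_def using below_closed tight_nonempty
  by (intro below_minima closedin_S_image) auto

lemma shift_code_code: "x \<in> M \<Longrightarrow> shift_code (code x) = code (S x)"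
  by (simp add: shift_code_def below_code S_image_cls) (simp add: code_def)

lemma continuous_shift_code: "continuous_map (subtopology Rseq Ys) Rseq shift_code"
  unfolding continuous_map_componentwise_UNIV
proof
  fix n
  have "continuous_map X euclideanreal (f n \<circ> S)"
    using f_cont homeo continuous_map_compose homeomorphic_imp_continuous_map by blast
  then have "continuous_map (subtopology Rseq Ys) euclideanreal (\<lambda>h. Inf ((f n \<circ> S) ` below h))"
    by (rule continuous_Inf_below[OF _ Ys_tight])
  then show "continuous_map (subtopology Rseq Ys) euclideanreal (\<lambda>h. shift_code h n)"
    by (simp add: shift_code_def minima_def image_comp)
qed

text \<open>Checked on the codes of \<open>D\<close>: shifting them gives codes of points of
  \<open>Cont\<close>, which belong to \<open>Ys\<close>.\<close>

lemma shift_code_Ys: "shift_code ` Ys \<subseteq> Ys"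
proof -
  have "closedin (subtopology Rseq Ys) {h \<in> topspace (subtopology Rseq Ys). shift_code h \<in> Ys}"
    by (rule closedin_continuous_map_preimage[OF continuous_shift_code closedin_Ys])
  then have "closedin Rseq {h \<in> Ys. shift_code h \<in> Ys}"
    using closedin_closed_subtopology[OF closedin_Ys] by simp
  moreover have "code ` D \<subseteq> {h \<in> Ys. shift_code h \<in> Ys}"
  proof
    fix h assume "h \<in> code ` D"
    then obtain x where x: "x \<in> D" "h = code x" by blast
    then have "x \<in> M" "S x \<in> Cont"
      using D_subset D_subset_Cont Cont_T[of x 1] by auto
    then show "h \<in> {h \<in> Ys. shift_code h \<in> Ys}"
      using x code_D_in_Ys code_in_Ys by (simp add: shift_code_code)
  qed
  ultimately have "Rseq closure_of (code ` D) \<subseteq> {h \<in> Ys. shift_code h \<in> Ys}"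
    by (intro closure_of_minimal)
  then show ?thesis
    unfolding Ys_def[symmetric] by blast
qed

lemma shift_code_onto: "shift_code ` Ys = Ys"
proof
  have "compactin (subtopology Rseq Ys) Ys"
    using compactin_Ys by (simp add: compactin_subtopology)
  then have "compactin Rseq (shift_code ` Ys)"
    using continuous_shift_code image_compactin by blast
  then have "closedin Rseq (shift_code ` Ys)"
    using compactin_imp_closedin Hausdorff_Rseq by blast
  moreover have "code ` D \<subseteq> shift_code ` Ys"
  proof
    fix h assume "h \<in> code ` D"
    then obtain x where x: "x \<in> D" "h = code x" by blast
    then have xX: "x \<in> M" using D_subset by blast
    have "T (- 1) x \<in> Cont"
      using x(1) D_subset_Cont Cont_T by blast
    moreover have "shift_code (code (T (- 1) x)) = code x"
      using shift_code_code[of "T (- 1) x"] T_inverse(2)[OF xX, of 1] xX by simp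
    ultimately show "h \<in> shift_code ` Ys"
      using x(2) code_in_Ys by (metis imageI)
  qed
  ultimately have "Rseq closure_of (code ` D) \<subseteq> shift_code ` Ys"
    by (intro closure_of_minimal)
  then show "Ys \<subseteq> shift_code ` Ys"
    unfolding Ys_def[symmetric] .
qed (rule shift_code_Ys)

lemma inj_shift_code: "inj_on shift_code Ys"
proof
  fix h h' assume h: "h \<in> Ys" "h' \<in> Ys" "shift_code h = shift_code h'"
  have t: "tight h" "tight h'" using h Ys_tight by auto
  then have "S ` below h = S ` below h'"
    using below_shift_code h(3) by metis
  moreover have "below h \<subseteq> M" "below h' \<subseteq> M"
    by (auto simp: below_def)
  ultimately have "below h = below h'"
    using inj_on_image_eq_iff[OF inj_S] by blast
  then show "h = h'"
    using minima_below t by metis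
qed

abbreviation Yt :: "(nat \<Rightarrow> real) topology" where
  "Yt \<equiv> subtopology Rseq Ys"

lemma metric_system_Yt: "metric_system Yt shift_code"
  unfolding metric_system_def
proof (intro conjI)
  show c: "compact_space Yt"
    using compactin_Ys by (simp add: compact_space_subtopology)
  show "metrizable_space Yt"
    by (simp add: metrizable_Rseq metrizable_space_subtopology)
  have "continuous_map Yt Yt shift_code"
    using continuous_shift_code shift_code_Ys by (auto simp: continuous_map_in_subtopology)
  then show "homeomorphic_map Yt Yt shift_code"
    using c Hausdorff_Rseq inj_shift_code shift_code_onto
    by (intro continuous_imp_homeomorphic_map) (auto simp: Hausdorff_space_subtopology)
qed

definition shift_Z :: "'a \<times> (nat \<Rightarrow> real) \<Rightarrow> 'a \<times> (nat \<Rightarrow> real)" where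
  "shift_Z = (\<lambda>z. (S (fst z), shift_code (snd z)))"

abbreviation Zt :: "('a \<times> (nat \<Rightarrow> real)) topology" where
  "Zt \<equiv> subtopology (prod_topology X Rseq) Zs"

lemma topspace_Zt: "topspace Zt = Zs"
  by (auto simp: Zs_def below_def)

lemma compact_Zt: "compact_space Zt"
proof -
  have "compactin (prod_topology X Rseq) (M \<times> Ys)"
    using compact compactin_Ys by (simp add: compactin_Times compact_space_def)
  then have "compactin (prod_topology X Rseq) Zs"
    using closed_compactin Zs_subset closedin_Zs by blast
  then show ?thesis
    by (simp add: compact_space_subtopology)
qed

lemma continuous_fst_Zt: "continuous_map Zt X fst"
  and continuous_snd_Zt: "continuous_map Zt Yt snd"
  by (auto simp: continuous_map_in_subtopology Zs_def intro: continuous_map_from_subtopology continuous_map_fst continuous_map_snd)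

lemma metric_system_Zt: "metric_system Zt shift_Z"
  unfolding metric_system_def
proof (intro conjI)
  show c: "compact_space Zt" by (rule compact_Zt)
  show "metrizable_space Zt"
    using metrizable metrizable_Rseq by (simp add: metrizable_space_prod_topology metrizable_space_subtopology)
  then have H: "Hausdorff_space Zt"
    by (rule metrizable_imp_Hausdorff_space)
  have "continuous_map Zt (prod_topology X Rseq) (\<lambda>z. ((S \<circ> fst) z, (shift_code \<circ> snd) z))"
    unfolding continuous_map_paired
    using continuous_map_compose[OF continuous_fst_Zt homeomorphic_imp_continuous_map[OF homeo]]
      continuous_map_compose[OF continuous_snd_Zt continuous_shift_code] by blast
  then have "continuous_map Zt (prod_topology X Rseq) shift_Z"
    by (simp add: shift_Z_def)
  moreover have onto: "shift_Z ` Zs = Zs"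
  proof (intro equalityI subsetI)
    fix z assume "z \<in> shift_Z ` Zs"
    then obtain x h where "z = (S x, shift_code h)" "h \<in> Ys" "x \<in> below h"
      by (auto simp: shift_Z_def Zs_def)
    then show "z \<in> Zs"
      using shift_code_Ys below_shift_code Ys_tight by (auto simp: Zs_def)
  next
    fix z assume "z \<in> Zs"
    then obtain x h where z: "z = (x, h)" "h \<in> Ys" "x \<in> below h"
      by (auto simp: Zs_def)
    then obtain h' where h': "h' \<in> Ys" "h = shift_code h'"
      using shift_code_onto by blast
    then have "x \<in> S ` below h'"
      using z(3) below_shift_code Ys_tight by blast
    then obtain x' where "x' \<in> below h'" "x = S x'" by blast
    then have "(x', h') \<in> Zs" "z = shift_Z (x', h')"
      using z(1) h' by (auto simp: Zs_def shift_Z_def)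
    then show "z \<in> shift_Z ` Zs" by blast
  qed
  ultimately have "continuous_map Zt Zt shift_Z"
    using topspace_Zt by (auto simp: continuous_map_in_subtopology)
  moreover have "inj_on shift_Z Zs"
    using inj_S inj_shift_code unfolding inj_on_def by (auto simp: shift_Z_def Zs_def below_def)
  ultimately show "homeomorphic_map Zt Zt shift_Z"
    using c H onto by (intro continuous_imp_homeomorphic_map) (simp_all only: topspace_Zt)
qed

text \<open>On \<open>Ys\<close> all classes in the union coincide, so the union names that class
  without choosing a point.\<close>

definition class_of_code :: "(nat \<Rightarrow> real) \<Rightarrow> 'a set" where
  "class_of_code h = (\<Union>a\<in>below h. cls a)"

lemma class_of_code_eq: "h \<in> Ys \<Longrightarrow> a \<in> below h \<Longrightarrow> class_of_code h = cls a"
  unfolding class_of_code_def using Ys_below_subset_cls cls_eq by blast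

lemma cls_eq_Image: "regionally_proximal k X S `` {x} = cls x"
  by (auto simp: regionally_proximal_eq cls_def)

lemma Ys_below_nonempty:
  assumes "h \<in> Ys"
  obtains a where "a \<in> below h" "a \<in> M"
  using assms Ys_tight tight_nonempty by (fastforce simp: below_def)

lemma extension_class_of_code: "extension Yt shift_code (max_factor k X S) (image S) class_of_code"
  unfolding extension_def
proof (intro conjI ballI)
  have quot: "topspace (max_factor k X S) = cls ` M"
    by (auto simp: max_factor_def topspace_quotient_topology quotient_def cls_eq_Image)
  show onto: "class_of_code ` topspace Yt = topspace (max_factor k X S)"
  proof (intro equalityI subsetI)
    fix c assume "c \<in> class_of_code ` topspace Yt"
    then obtain h where h: "h \<in> Ys" "c = class_of_code h" by auto
    obtain a where "a \<in> below h" "a \<in> M"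
      using Ys_below_nonempty[OF h(1)] .
    then show "c \<in> topspace (max_factor k X S)"
      using h class_of_code_eq by (auto simp: quot)
  next
    fix c assume "c \<in> topspace (max_factor k X S)"
    then obtain x where x: "x \<in> M" "c = cls x" by (auto simp: quot)
    obtain h where "h \<in> Ys" "x \<in> below h"
      using Ys_lift[OF x(1)] .
    then show "c \<in> class_of_code ` topspace Yt"
      using x(2) class_of_code_eq by force
  qed
  show "continuous_map Yt (max_factor k X S) class_of_code"
    unfolding continuous_map_def
  proof (intro conjI allI impI)
    show "class_of_code \<in> topspace Yt \<rightarrow> topspace (max_factor k X S)"
      using onto by blast
    fix U assume "openin (max_factor k X S) U"
    then have U: "openin X {x \<in> M. cls x \<in> U}"
      by (simp add: max_factor_def openin_quotient_topology cls_eq_Image)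
    \<comment> \<open>Openness in the quotient becomes inclusion of the coded set in a saturated
      open set, an open condition on codes.\<close>
    have "{h \<in> topspace Yt. class_of_code h \<in> U} = {h. below h \<subseteq> {x \<in> M. cls x \<in> U}} \<inter> Ys"
    proof (intro equalityI subsetI)
      fix h assume h: "h \<in> {h \<in> topspace Yt. class_of_code h \<in> U}"
      then show "h \<in> {h. below h \<subseteq> {x \<in> M. cls x \<in> U}} \<inter> Ys"
        using class_of_code_eq[of h] by (auto simp: below_def)
    next
      fix h assume h: "h \<in> {h. below h \<subseteq> {x \<in> M. cls x \<in> U}} \<inter> Ys"
      then obtain a where "a \<in> below h"
        using Ys_below_nonempty by blast
      then show "h \<in> {h \<in> topspace Yt. class_of_code h \<in> U}"
        using h class_of_code_eq[of h a] by auto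
    qed
    then show "openin Yt {h \<in> topspace Yt. class_of_code h \<in> U}"
      using openin_below_subset[OF U] by (auto simp: openin_subtopology)
  qed
  fix h assume "h \<in> topspace Yt"
  then have h: "h \<in> Ys" by simp
  obtain a where a: "a \<in> below h" "a \<in> M"
    using Ys_below_nonempty[OF h] .
  have "S a \<in> below (shift_code h)"
    using a(1) h below_shift_code Ys_tight by blast
  then have "class_of_code (shift_code h) = cls (S a)"
    using h shift_code_Ys by (intro class_of_code_eq) auto
  then show "class_of_code (shift_code h) = S ` class_of_code h"
    using class_of_code_eq[OF h a(1)] S_image_cls[OF a(2)] by simp
qed

text \<open>Direct images of G-delta sets need not be G-delta; this description exhibits the image
  as one. If \<open>below h\<close> lies in all the sets \<open>stable b\<close> with rational
  level, then any of its points lies in \<open>D\<close>, and uniqueness over \<open>Cont\<close>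
  makes \<open>h\<close> its code.\<close>

lemma code_D_eq: "code ` D = Ys \<inter> \<Inter>((\<lambda>b. {h. below h \<subseteq> stable b}) ` (UNIV \<times> \<rat>))"
proof (intro equalityI subsetI)
  fix h assume "h \<in> code ` D"
  then obtain x where x: "x \<in> D" "h = code x" by blast
  then have "below h = cls x" "h \<in> Ys"
    using below_code D_subset code_D_in_Ys by auto
  then show "h \<in> Ys \<inter> \<Inter>((\<lambda>b. {h. below h \<subseteq> stable b}) ` (UNIV \<times> \<rat>))"
    using D_saturated[OF x(1)] by (auto simp: D_def)
next
  fix h assume h: "h \<in> Ys \<inter> \<Inter>((\<lambda>b. {h. below h \<subseteq> stable b}) ` (UNIV \<times> \<rat>))"
  then obtain a where a: "a \<in> below h" "a \<in> M"
    using Ys_below_nonempty by blast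
  then have "a \<in> D"
    using h by (auto simp: D_def)
  moreover have "h = code a"
    using Ys_unique_over_Cont[of a h a] h a cls_refl D_subset_Cont \<open>a \<in> D\<close> by blast
  ultimately show "h \<in> code ` D" by blast
qed

lemma almost_one_to_one_class_of_code:
  "almost_one_to_one_extension Yt shift_code (max_factor k X S) (image S) class_of_code"
  unfolding almost_one_to_one_extension_def
proof (intro conjI exI ballI)
  show "extension Yt shift_code (max_factor k X S) (image S) class_of_code"
    by (rule extension_class_of_code)
  have sub: "code ` D \<subseteq> Ys"
    using code_D_in_Ys by blast
  have "gdelta_in Rseq (\<Inter>(insert UNIV ((\<lambda>b. {h. below h \<subseteq> stable b}) ` (UNIV \<times> \<rat>))))"
    using openin_below_subset openin_stable openin_topspace[of Rseq]
    by (intro gdelta_in_Inter) (auto simp: countable_rat intro: open_imp_gdelta_in)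
  then have "gdelta_in Yt (Ys \<inter> \<Inter>((\<lambda>b. {h. below h \<subseteq> stable b}) ` (UNIV \<times> \<rat>)))"
    by (auto simp: gdelta_in_subtopology)
  moreover have "Yt closure_of (code ` D) = topspace Yt"
    using sub by (simp add: closure_of_subtopology inf.absorb2 Ys_def[symmetric])
  ultimately show "dense_gdelta Yt (code ` D)"
    unfolding dense_gdelta_def code_D_eq[symmetric] by blast
  fix h assume "h \<in> code ` D"
  then obtain x where x: "x \<in> D" "h = code x" by blast
  then have xX: "x \<in> M" and h: "h \<in> Ys"
    using D_subset sub by auto
  have "h' = h" if h': "h' \<in> Ys" "class_of_code h' = class_of_code h" for h'
  proof -
    obtain a where a: "a \<in> below h'" "a \<in> M"
      using Ys_below_nonempty[OF h'(1)] .
    have "x \<in> below h"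
      using below_code[OF xX] cls_refl[OF xX] x(2) by simp
    then have "cls a = cls x"
      using class_of_code_eq[OF h] class_of_code_eq[OF h'(1) a(1)] h'(2) by simp
    then have "a \<in> cls x"
      using cls_refl[OF a(2)] by simp
    then show ?thesis
      using Ys_unique_over_Cont[OF _ h'(1) a(1)] x D_subset_Cont by blast
  qed
  then show "{z \<in> topspace Yt. class_of_code z = class_of_code h} = {h}"
    using h by auto
qed

lemma residual_D: "residual_in X D"
  unfolding residual_in_def
  by (intro exI[of _ "stable ` (UNIV \<times> \<rat>)"]) (auto simp: openin_stable dense_stable D_def countable_rat)

end

section \<open>Saturation\<close>

text \<open>The properties of the space of pairs that the saturation argument uses.
  \<open>lift_exists\<close> and \<open>lift_base\<close> say that \<open>X'\<close> realises every
  admissible pair and carries the topology induced by the two maps, so the argument is independent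
  of the type in which \<open>X'\<close> is realised.\<close>

locale lifted_model = open_model X S f k + lift: zsys X' S'
  for X :: "'a topology" and S f k and X' :: "'c topology" and S' +
  fixes \<theta>' :: "'c \<Rightarrow> 'a" and \<pi>' :: "'c \<Rightarrow> nat \<Rightarrow> real"
  assumes \<theta>'_cont: "continuous_map X' X \<theta>'" and \<pi>'_cont: "continuous_map X' Yt \<pi>'"
    and \<theta>'_equiv: "\<And>z. z \<in> topspace X' \<Longrightarrow> \<theta>' (S' z) = S (\<theta>' z)"
    and \<pi>'_equiv: "\<And>z. z \<in> topspace X' \<Longrightarrow> \<pi>' (S' z) = shift_code (\<pi>' z)"
    and below_\<pi>': "\<And>z. z \<in> topspace X' \<Longrightarrow> \<theta>' z \<in> below (\<pi>' z)"
    and lift_exists: "\<And>x h. h \<in> Ys \<Longrightarrow> x \<in> below h \<Longrightarrow> \<exists>z\<in>topspace X'. \<theta>' z = x \<and> \<pi>' z = h"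
    and lift_base: "\<And>G z. openin X' G \<Longrightarrow> z \<in> G \<Longrightarrow> \<exists>U V. openin X U \<and> openin Rseq V \<and> \<theta>' z \<in> U \<and> \<pi>' z \<in> V \<and>
      (\<forall>z'\<in>topspace X'. \<theta>' z' \<in> U \<and> \<pi>' z' \<in> V \<longrightarrow> z' \<in> G)"
begin

lemma \<theta>'_in [simp]: "z \<in> topspace X' \<Longrightarrow> \<theta>' z \<in> M"
  using continuous_map_image_subset_topspace[OF \<theta>'_cont] by blast

lemma \<pi>'_in [simp]: "z \<in> topspace X' \<Longrightarrow> \<pi>' z \<in> Ys"
  using continuous_map_image_subset_topspace[OF \<pi>'_cont] by auto

lemma \<theta>'_T: "z \<in> topspace X' \<Longrightarrow> \<theta>' (lift.T t z) = T t (\<theta>' z)"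
  by (rule equivariant_T[OF lift.zsys_axioms zsys_axioms]) (auto simp: \<theta>'_equiv)

lemma \<theta>'_onto:
  assumes "x \<in> M"
  obtains z where "z \<in> topspace X'" "\<theta>' z = x"
  using Ys_lift[OF assms] lift_exists by metis

lemma injective:
  assumes z: "z \<in> topspace X'" "z' \<in> topspace X'" and eq: "\<theta>' z = \<theta>' z'" "\<pi>' z = \<pi>' z'"
  shows "z = z'"
proof (rule ccontr)
  assume "z \<noteq> z'"
  then obtain G where G: "openin X' G" "z \<in> G" "z' \<notin> G"
    using lift.Hausdorff z unfolding Hausdorff_space_def disjnt_def by blast
  then show False
    using lift_base[OF G(1,2)] z eq by auto
qed

lemma fibre_over_Cont:
  assumes "z \<in> topspace X'" "z' \<in> topspace X'" "\<theta>' z' = \<theta>' z" "\<theta>' z \<in> Cont"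
  shows "z' = z"
proof -
  have "\<pi>' w = code (\<theta>' z)" if "w \<in> topspace X'" "\<theta>' w = \<theta>' z" for w
    using that below_\<pi>'[of w] assms(1) by (intro Ys_unique_over_Cont[OF assms(4), of _ "\<theta>' z"]) (auto simp: cls_refl)
  then show ?thesis
    using assms injective by metis
qed

text \<open>For a closed map with a singleton fibre, preimages of small neighbourhoods are small.
  This is what lifts approximations from \<open>X\<close> to \<open>X'\<close>.\<close>

lemma lifts_near:
  assumes z: "z \<in> topspace X'" "\<theta>' z \<in> Cont" and G: "openin X' G" "z \<in> G"
  obtains U where "openin X U" "\<theta>' z \<in> U" "\<And>z'. z' \<in> topspace X' \<Longrightarrow> \<theta>' z' \<in> U \<Longrightarrow> z' \<in> G"
proof -
  have "closed_map X' X \<theta>'"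
    using \<theta>'_cont lift.compact Hausdorff continuous_imp_closed_map by blast
  then have "closedin X (\<theta>' ` (topspace X' - G))"
    using G(1) unfolding closed_map_def by blast
  then have "openin X (M - \<theta>' ` (topspace X' - G))"
    by blast
  moreover have "w \<in> G" if "w \<in> topspace X'" "\<theta>' z = \<theta>' w" for w
    using fibre_over_Cont[OF z(1) that(1) that(2)[symmetric] z(2)] G(2) by simp
  then have "\<theta>' z \<in> M - \<theta>' ` (topspace X' - G)"
    using z(1) by auto
  ultimately show thesis
    using that[of "M - \<theta>' ` (topspace X' - G)"] by blast
qed

text \<open>The code is approximated first, by that of a point of \<open>D\<close>; tightness then
  supplies a point \<open>y\<close> of that class near \<open>\<theta>' z\<close>, and
  \<open>y\<close> is in \<open>D\<close> because \<open>D\<close> is saturated.\<close>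

lemma dense_over_D:
  assumes G: "openin X' G" "z \<in> G"
  obtains z' where "z' \<in> G" "\<theta>' z' \<in> D"
proof -
  have z: "z \<in> topspace X'" using G openin_subset by blast
  obtain U V where UV: "openin X U" "openin Rseq V" "\<theta>' z \<in> U" "\<pi>' z \<in> V"
    "\<And>z'. z' \<in> topspace X' \<Longrightarrow> \<theta>' z' \<in> U \<Longrightarrow> \<pi>' z' \<in> V \<Longrightarrow> z' \<in> G"
    using lift_base[OF G] by blast
  obtain W where W: "openin Rseq W" "\<pi>' z \<in> W" "\<And>h'. h' \<in> W \<Longrightarrow> tight h' \<Longrightarrow> below h' \<inter> U \<noteq> {}"
    using tight_hits_open[OF UV(1,3) below_\<pi>'[OF z]] by blast
  obtain x where "x \<in> D" "code x \<in> V \<inter> W"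
    using Ys_approx[OF \<pi>'_in[OF z], of "V \<inter> W"] UV(2,4) W(1,2) by blast
  then have x: "x \<in> D" "code x \<in> V" "code x \<in> W" "x \<in> M"
    using D_subset by auto
  obtain y where y: "y \<in> below (code x)" "y \<in> U"
    using W(3)[OF x(3) tight_code[OF x(4)]] by blast
  obtain z' where z': "z' \<in> topspace X'" "\<theta>' z' = y" "\<pi>' z' = code x"
    using lift_exists[OF code_D_in_Ys[OF x(1)] y(1)] by blast
  have "y \<in> D"
    using D_saturated[OF x(1)] y(1) below_code[OF x(4)] by blast
  moreover have "z' \<in> G"
    using UV(5)[OF z'(1)] z'(2,3) y(2) x(2) by simp
  ultimately show thesis
    using that[of z'] z'(2) by simp
qed

lemma almost_one_to_one_\<theta>': "almost_one_to_one_extension X' S' X S \<theta>'"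
  unfolding almost_one_to_one_extension_def
proof (intro conjI exI ballI)
  show "extension X' S' X S \<theta>'"
    unfolding extension_def
  proof (intro conjI ballI)
    show "\<theta>' ` topspace X' = M"
      using \<theta>'_onto \<theta>'_in by (metis (no_types, lifting) image_subset_iff subsetI subset_antisym imageI)
  qed (use \<theta>'_cont \<theta>'_equiv in auto)
  have "X' closure_of {z \<in> topspace X'. \<theta>' z \<in> D} = topspace X'"
  proof -
    have "topspace X' \<subseteq> X' closure_of {z \<in> topspace X'. \<theta>' z \<in> D}"
    proof
      fix z assume z: "z \<in> topspace X'"
      show "z \<in> X' closure_of {z \<in> topspace X'. \<theta>' z \<in> D}"
        unfolding in_closure_of
      proof (intro conjI allI impI)
        fix G assume G: "z \<in> G \<and> openin X' G"
        then obtain z' where "z' \<in> G" "\<theta>' z' \<in> D"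
          using dense_over_D[of G z] by blast
        then show "\<exists>y. y \<in> {z \<in> topspace X'. \<theta>' z \<in> D} \<and> y \<in> G"
          using G openin_subset by blast
      qed (rule z)
    qed
    then show ?thesis
      by (simp add: closure_of_subset_topspace subset_antisym)
  qed
  moreover have "gdelta_in X' {z \<in> topspace X'. \<theta>' z \<in> D}"
  proof -
    have "gdelta_in X' (\<Inter>(insert (topspace X') ((\<lambda>b. {z \<in> topspace X'. \<theta>' z \<in> stable b}) ` (UNIV \<times> \<rat>))))"
      using openin_continuous_map_preimage[OF \<theta>'_cont openin_stable]
      by (intro gdelta_in_Inter) (auto simp: countable_rat intro: open_imp_gdelta_in)
    moreover have "\<Inter>(insert (topspace X') ((\<lambda>b. {z \<in> topspace X'. \<theta>' z \<in> stable b}) ` (UNIV \<times> \<rat>)))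
        = {z \<in> topspace X'. \<theta>' z \<in> D}"
      by (auto simp: D_def)
    ultimately show ?thesis by simp
  qed
  ultimately show "dense_gdelta X' {z \<in> topspace X'. \<theta>' z \<in> D}"
    by (simp add: dense_gdelta_def)
  fix z assume "z \<in> {z \<in> topspace X'. \<theta>' z \<in> D}"
  then show "{z' \<in> topspace X'. \<theta>' z' = \<theta>' z} = {z}"
    using fibre_over_Cont D_subset_Cont by blast
qed

lemma extension_\<pi>': "extension X' S' Yt shift_code \<pi>'"
  unfolding extension_def
proof (intro conjI ballI equalityI subsetI)
  fix h assume "h \<in> topspace Yt"
  then have h: "h \<in> Ys" by simp
  obtain a where "a \<in> below h"
    using Ys_below_nonempty[OF h] by blast
  then show "h \<in> \<pi>' ` topspace X'"
    using lift_exists[OF h] by blast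
qed (use \<pi>'_cont \<pi>'_equiv in auto)

lemma class_of_\<pi>': "z \<in> topspace X' \<Longrightarrow> max_factor_proj k X S (\<theta>' z) = class_of_code (\<pi>' z)"
  using class_of_code_eq[of "\<pi>' z" "\<theta>' z"] below_\<pi>' by (simp add: max_factor_proj_def cls_eq_Image)

text \<open>Openness of \<open>\<pi>'\<close>, in the form needed for moving along fibres: for codes
  near that of \<open>y\<close>, the coded set still meets the neighbourhood of
  \<open>\<theta>' y\<close>.\<close>

lemma \<pi>'_open:
  assumes V: "openin X' V" "y \<in> V" and p: "p \<in> topspace X'" "\<pi>' p = \<pi>' y"
  obtains G where "openin X' G" "p \<in> G" "\<And>z. z \<in> G \<Longrightarrow> \<exists>y'\<in>V. \<pi>' y' = \<pi>' z"
proof -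
  have y: "y \<in> topspace X'" using V openin_subset by blast
  obtain U1 V1 where UV: "openin X U1" "openin Rseq V1" "\<theta>' y \<in> U1" "\<pi>' y \<in> V1"
    "\<And>z'. z' \<in> topspace X' \<Longrightarrow> \<theta>' z' \<in> U1 \<Longrightarrow> \<pi>' z' \<in> V1 \<Longrightarrow> z' \<in> V"
    using lift_base[OF V] by blast
  obtain W where W: "openin Rseq W" "\<pi>' y \<in> W" "\<And>h'. h' \<in> W \<Longrightarrow> tight h' \<Longrightarrow> below h' \<inter> U1 \<noteq> {}"
    using tight_hits_open[OF UV(1,3) below_\<pi>'[OF y]] by blast
  let ?G = "{z \<in> topspace X'. \<pi>' z \<in> V1 \<inter> W}"
  have "continuous_map X' Rseq \<pi>'"
    using \<pi>'_cont by (simp add: continuous_map_in_subtopology)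
  then have "openin X' ?G"
    using UV(2) W(1) by (intro openin_continuous_map_preimage) auto
  moreover have "p \<in> ?G"
    using p UV(4) W(2) by simp
  moreover have "\<exists>y'\<in>V. \<pi>' y' = \<pi>' z" if z: "z \<in> ?G" for z
  proof -
    have "\<pi>' z \<in> Ys"
      using z by (intro \<pi>'_in) simp
    then have "tight (\<pi>' z)"
      using Ys_tight by blast
    then obtain x where x: "x \<in> below (\<pi>' z)" "x \<in> U1"
      using W(3)[of "\<pi>' z"] z by blast
    obtain y' where "y' \<in> topspace X'" "\<theta>' y' = x" "\<pi>' y' = \<pi>' z"
      using lift_exists[OF \<open>\<pi>' z \<in> Ys\<close> x(1)] by blast
    then show ?thesis
      using UV(5)[of y'] x(2) z by auto
  qed
  ultimately show thesis
    by (rule that)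
qed

text \<open>Near \<open>p {}\<close> we find \<open>z1\<close> generic and \<open>y1\<close> near \<open>y\<close> in the fibre of \<open>z1\<close>. Genericity turns the
  relation between their images into a cubical point with \<open>y1\<close> at the empty set and \<open>z1\<close> elsewhere,
  which is then moved along the given one.\<close>

lemma cubical_replace_empty:
  assumes p: "lift.cubical (Suc k) p" and y: "y \<in> topspace X'" "\<pi>' y = \<pi>' (p {})"
  shows "lift.cubical (Suc k) (p({} := y))"
proof (rule lift.cubicalI)
  let ?C = "cube_index (Suc k)"
  show "(p({} := y)) e \<in> topspace X'" if "e \<in> ?C" for e
    using y lift.cubical_in[OF p that] by simp
  fix U assume U: "\<And>e. e \<in> ?C \<Longrightarrow> openin X' (U e) \<and> (p({} := y)) e \<in> U e"
  have V: "openin X' (U {})" "y \<in> U {}"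
    using U[of "{}"] by auto
  have p0: "p {} \<in> topspace X'"
    using lift.cubical_in[OF p] by simp
  obtain G where G: "openin X' G" "p {} \<in> G" "\<And>z. z \<in> G \<Longrightarrow> \<exists>y'\<in>U {}. \<pi>' y' = \<pi>' z"
    using \<pi>'_open[OF V p0 y(2)[symmetric]] by blast
  have "openin X' ((U({} := G)) e) \<and> p e \<in> (U({} := G)) e" if "e \<in> ?C" for e
    using U[OF that] G(1,2) by (cases "e = {}") simp_all
  then obtain z n where z: "z \<in> topspace X'" and n: "\<And>e. e \<in> ?C \<Longrightarrow> lift.T (sum n e) z \<in> (U({} := G)) e"
    using lift.cubical_approx[OF p, of "U({} := G)"] by metis
  \<comment> \<open>The base points for which the fixed motion \<open>n\<close> keeps every
    coordinate other than \<open>{}\<close> in its box.\<close>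
  define O3 where "O3 = topspace X' \<inter> (\<Inter>e\<in>?C - {{}}. {z \<in> topspace X'. lift.T (sum n e) z \<in> U e})"
  have O3: "openin X' O3"
  proof -
    have "?C - {{}} \<noteq> {}"
      using insert_Suc_cube_index[of "{}" k] by auto
    then show ?thesis
      unfolding O3_def using U by (intro openin_Int openin_topspace openin_INT2 lift.open_T_preimage) auto
  qed
  have "lift.T (sum n e) z \<in> U e" if "e \<in> ?C - {{}}" for e
    using n[of e] that by simp
  then have "z \<in> O3"
    using z by (auto simp: O3_def)
  moreover have "z \<in> G"
    using n[of "{}"] by simp
  \<comment> \<open>Passing to a point over \<open>D\<close> makes its neighbourhood in
    \<open>X'\<close> visible in \<open>X\<close>, where a generic point can be chosen.\<close>
  ultimately obtain z0 where z0: "z0 \<in> O3 \<inter> G" "\<theta>' z0 \<in> D"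
    using dense_over_D[of "O3 \<inter> G" z] O3 G(1) by blast
  then have z0X: "z0 \<in> topspace X'" by (auto simp: O3_def)
  obtain U0 where U0: "openin X U0" "\<theta>' z0 \<in> U0"
    "\<And>z'. z' \<in> topspace X' \<Longrightarrow> \<theta>' z' \<in> U0 \<Longrightarrow> z' \<in> O3 \<inter> G"
    using lifts_near[OF z0X _ _ z0(1)] z0(2) D_subset_Cont O3 G(1) by blast
  obtain x1 where x1: "x1 \<in> D" "x1 \<in> generic k" "x1 \<in> U0"
    using residual_in_meets_open[OF compact Hausdorff residual_in_Int[OF residual_D residual_generic] U0(1)]
      U0(2) by blast
  obtain z1 where z1: "z1 \<in> topspace X'" "\<theta>' z1 = x1"
    using \<theta>'_onto x1(1) D_subset by blast
  then have z1': "z1 \<in> O3" "z1 \<in> G"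
    using U0(3) x1(3) by auto
  obtain y1 where y1: "y1 \<in> U {}" "\<pi>' y1 = \<pi>' z1"
    using G(3)[OF z1'(2)] by blast
  then have y1X: "y1 \<in> topspace X'"
    using V(1) openin_subset by blast
  have "\<theta>' z1 \<in> below (\<pi>' z1)" "\<theta>' y1 \<in> below (\<pi>' z1)"
    using below_\<pi>'[OF z1(1)] below_\<pi>'[OF y1X] y1(2) by simp_all
  then have RP: "RP k x1 (\<theta>' y1)"
    using Ys_below_related[OF \<pi>'_in[OF z1(1)]] z1(2) by blast
  \<comment> \<open>Since \<open>D\<close> is saturated, neighbourhoods of \<open>y1\<close> too are
    controlled from \<open>X\<close>.\<close>
  then have "\<theta>' y1 \<in> D"
    using D_saturated[OF x1(1)] by (auto simp: cls_def)
  then obtain U2 where U2: "openin X U2" "\<theta>' y1 \<in> U2" "\<And>z'. z' \<in> topspace X' \<Longrightarrow> \<theta>' z' \<in> U2 \<Longrightarrow> z' \<in> U {}"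
    using lifts_near[OF y1X _ V(1) y1(1)] D_subset_Cont by blast
  obtain U3 where U3: "openin X U3" "x1 \<in> U3" "\<And>z'. z' \<in> topspace X' \<Longrightarrow> \<theta>' z' \<in> U3 \<Longrightarrow> z' \<in> O3"
    using lifts_near[OF z1(1) _ O3 z1'(1)] z1(2) x1(1) D_subset_Cont by blast
  have "cubical (Suc k) (\<lambda>e. if e = {} then \<theta>' y1 else x1)"
    by (rule generic_corner_reflect[OF x1(2) RP]) simp
  note approx = cubical_approx[OF this, of "\<lambda>e. if e = {} then U2 else U3"]
  obtain w m where w: "w \<in> M"
    and m: "\<And>e. e \<in> ?C \<Longrightarrow> T (sum m e) w \<in> (if e = {} then U2 else U3)"
    by (rule approx) (use U2(1,2) U3(1,2) in auto)
  obtain v where v: "v \<in> topspace X'" "\<theta>' v = w"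
    using \<theta>'_onto[OF w] .
  \<comment> \<open>At \<open>{}\<close> both sums vanish and \<open>v\<close> itself lies in the
    box; at the other vertices \<open>m\<close> leads into \<open>O3\<close>, and from there
    \<open>n\<close> leads into the box.\<close>
  have "lift.T (sum (\<lambda>j. n j + m j) e) v \<in> U e" if e: "e \<in> ?C" for e
  proof (cases "e = {}")
    case True
    then show ?thesis
      using U2(3)[OF v(1)] m[OF e] v(2) by simp
  next
    case False
    then have "lift.T (sum m e) v \<in> O3"
      using m[OF e] v by (intro U3(3)) (simp_all add: \<theta>'_T)
    then have "lift.T (sum n e) (lift.T (sum m e) v) \<in> U e"
      using e False by (auto simp: O3_def)
    then show ?thesis
      using v(1) by (simp add: lift.T_add sum.distrib)
  qed
  then show "\<exists>z\<in>topspace X'. \<exists>n. \<forall>e\<in>?C. lift.T (sum n e) z \<in> U e"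
    using v(1) by blast
qed

lemma cubical_replace:
  assumes p: "lift.cubical (Suc k) p" and \<sigma>: "\<sigma> \<in> cube_index (Suc k)"
    and y: "y \<in> topspace X'" "\<pi>' y = \<pi>' (p \<sigma>)"
  shows "lift.cubical (Suc k) (p(\<sigma> := y))"
proof -
  let ?q = "\<lambda>e. p (sym_diff e \<sigma>)"
  have "lift.cubical (Suc k) (?q({} := y))"
    using y by (intro cubical_replace_empty lift.cubical_reflect p \<sigma>) auto
  then have reflected: "lift.cubical (Suc k) (\<lambda>e. (?q({} := y)) (sym_diff e \<sigma>))"
    by (rule lift.cubical_reflect[OF _ \<sigma>])
  have eq: "(?q({} := y)) (sym_diff e \<sigma>) = (p(\<sigma> := y)) e" for e
  proof -
    have "sym_diff e \<sigma> = {} \<longleftrightarrow> e = \<sigma>" "sym_diff (sym_diff e \<sigma>) \<sigma> = e"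
      by auto
    then show ?thesis
      by (simp only: fun_upd_apply)
  qed
  show ?thesis
    by (rule lift.cubical_eq[OF reflected]) (rule eq)
qed

lemma cubical_saturated:
  assumes p: "lift.cubical (Suc k) p"
    and q: "\<And>e. e \<in> cube_index (Suc k) \<Longrightarrow> q e \<in> topspace X' \<and> \<pi>' (q e) = \<pi>' (p e)"
  shows "lift.cubical (Suc k) q"
proof -
  have "lift.cubical (Suc k) (\<lambda>e. if e \<in> F then q e else p e)" if "F \<subseteq> cube_index (Suc k)" for F
    using finite_subset[OF that finite_cube_index] that
  proof (induction F rule: finite_induct)
    case empty
    then show ?case using p by simp
  next
    case (insert \<sigma> F)
    let ?r = "\<lambda>e. if e \<in> F then q e else p e"
    have "lift.cubical (Suc k) (?r(\<sigma> := q \<sigma>))"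
      using insert q by (intro cubical_replace) auto
    moreover have "?r(\<sigma> := q \<sigma>) = (\<lambda>e. if e \<in> insert \<sigma> F then q e else p e)"
      by auto
    ultimately show ?case by simp
  qed
  from lift.cubical_eq[OF this[OF subset_refl], of q] show ?thesis
    by simp
qed

text \<open>Over a generic \<open>x\<close> the orbit closure consists of the cubical points with
  \<open>x\<close> at \<open>{}\<close>. Changing the other coordinates within the fibres keeps both
  properties, which is saturation.\<close>

lemma cubic_characteristic_\<pi>': "cubic_characteristic_factor (Suc k) X' S' Yt shift_code \<pi>'"
  unfolding cubic_characteristic_factor_def
proof (intro conjI)
  let ?C = "cube_index (Suc k)" and ?C' = "cube_index_star (Suc k)"
  show "extension X' S' Yt shift_code \<pi>'"
    by (rule extension_\<pi>')
  obtain G where G: "dense_gdelta X' G" "G \<subseteq> lift.generic (Suc k)"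
    using residual_in_dense_gdelta[OF lift.compact lift.Hausdorff lift.residual_generic] by blast
  have "saturated (?C' \<rightarrow>\<^sub>E topspace X') (\<lambda>p. \<lambda>e\<in>?C'. \<pi>' (p e))
      ((\<lambda>p. restrict p ?C') ` cube_orbit_closure (Suc k) X' S' x)" (is "saturated ?A ?\<Phi> ?L") if "x \<in> G" for x
    unfolding saturated_def
  proof (intro conjI equalityI subsetI)
    have x: "x \<in> lift.generic (Suc k)" "x \<in> topspace X'"
      using that G(2) by (auto simp: lift.generic_def)
    have sub: "?C' \<subseteq> ?C"
      by (auto simp: cube_index_star_def)
    have closure: "p \<in> cube_orbit_closure (Suc k) X' S' x \<longleftrightarrow>
        p \<in> (?C \<rightarrow>\<^sub>E topspace X') \<and> lift.face_limit (Suc k) (\<lambda>_. x) p" for p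
      by (rule lift.in_cube_orbit_closure_iff[OF x(2)])
    show L: "a \<in> ?A" if aL: "a \<in> ?L" for a
    proof -
      obtain p where "p \<in> cube_orbit_closure (Suc k) X' S' x" "a = restrict p ?C'"
        using aL by blast
      then show ?thesis
        using sub closure[of p] by (auto simp: PiE_iff)
    qed
    then show "a \<in> {a \<in> ?A. ?\<Phi> a \<in> ?\<Phi> ` ?L}" if "a \<in> ?L" for a
      using that by blast
    fix a assume "a \<in> {a \<in> ?A. ?\<Phi> a \<in> ?\<Phi> ` ?L}"
    then obtain b where a: "a \<in> ?A" and b: "b \<in> ?L" "?\<Phi> a = ?\<Phi> b"
      by blast
    then obtain p where "p \<in> cube_orbit_closure (Suc k) X' S' x" and bp: "b = restrict p ?C'"
      by blast
    then have p: "lift.face_limit (Suc k) (\<lambda>_. x) p"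
      by (simp add: closure)
    \<comment> \<open>Face group elements fix the coordinate \<open>{}\<close>, and this persists in
      the closure.\<close>
    have "p {} = x"
    proof (rule ccontr)
      assume "p {} \<noteq> x"
      moreover have "p {} \<in> topspace X'"
        using lift.face_limit_in[OF p] by simp
      ultimately obtain W where W: "openin X' W" "p {} \<in> W" "x \<notin> W"
        using lift.Hausdorff x(2) unfolding Hausdorff_space_def disjnt_def by blast
      have "openin X' ((\<lambda>e. if e = {} then W else topspace X') e) \<and>
          p e \<in> (\<lambda>e. if e = {} then W else topspace X') e" if "e \<in> ?C" for e
        using W lift.face_limit_in[OF p that] by simp
      then obtain n where "\<And>e. e \<in> ?C \<Longrightarrow> lift.T (sum n e) x \<in> (\<lambda>e. if e = {} then W else topspace X') e"
        using lift.face_limit_approx[OF p, of "\<lambda>e. if e = {} then W else topspace X'"] by metis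
      from this[of "{}"] W(3) show False
        by simp
    qed
    define q where "q = (\<lambda>e\<in>?C. if e = {} then x else a e)"
    have "q e \<in> topspace X' \<and> \<pi>' (q e) = \<pi>' (p e)" if "e \<in> ?C" for e
    proof (cases "e = {}")
      case True
      then show ?thesis
        using x(2) \<open>p {} = x\<close> by (simp add: q_def)
    next
      case False
      then have e: "e \<in> ?C'"
        using that by (simp add: cube_index_star_def)
      have "?\<Phi> a e = ?\<Phi> b e"
        using b(2) by (rule fun_cong)
      then show ?thesis
        using False e a that by (auto simp: q_def bp PiE_iff)
    qed
    then have "lift.cubical (Suc k) q"
      using cubical_saturated[OF lift.face_limit_imp_cubical[OF x(2) p]] by blast
    moreover have "q {} = x"
      by (simp add: q_def)
    ultimately have "lift.face_limit (Suc k) (\<lambda>_. x) q"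
      using x(1) unfolding lift.generic_def by blast
    moreover have "q \<in> (?C \<rightarrow>\<^sub>E topspace X')"
      using \<open>\<And>e. e \<in> ?C \<Longrightarrow> q e \<in> topspace X' \<and> _ e\<close> by (simp add: PiE_iff q_def extensional_def)
    ultimately have "q \<in> cube_orbit_closure (Suc k) X' S' x"
      by (simp add: closure)
    moreover have "restrict q ?C' = a"
    proof
      fix e
      show "restrict q ?C' e = a e"
        using a by (cases "e \<in> ?C'") (auto simp: q_def cube_index_star_def PiE_iff extensional_def)
    qed
    ultimately show "a \<in> ?L"
      by (intro image_eqI[of _ _ q]) simp_all
  qed
  then show "\<exists>X\<^sub>0. dense_gdelta X' X\<^sub>0 \<and> (\<forall>x\<in>X\<^sub>0. saturated (?C' \<rightarrow>\<^sub>E topspace X') (\<lambda>p. \<lambda>e\<in>?C'. \<pi>' (p e))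
      ((\<lambda>p. restrict p ?C') ` cube_orbit_closure (Suc k) X' S' x))"
    using G(1) by blast
qed

end

section \<open>Transport to real sequences and assembly\<close>

theorem proposition5p20:
  fixes X :: "'a topology" and S :: "'a \<Rightarrow> 'a" and d :: nat
  assumes "metric_system X S" and "minimal_system X S" and "d \<ge> 2"
  shows "\<exists>(X' :: (nat \<Rightarrow> real) topology) S' (Y' :: (nat \<Rightarrow> real) topology) R' \<theta>' \<pi>' \<theta>.
           metric_system X' S' \<and> metric_system Y' R' \<and>
           almost_one_to_one_extension X' S' X S \<theta>' \<and>
           almost_one_to_one_extension Y' R' (max_factor (d - 1) X S) (image S) \<theta> \<and>
           extension X' S' Y' R' \<pi>' \<and>
           (\<forall>z\<in>topspace X'. max_factor_proj (d - 1) X S (\<theta>' z) = \<theta> (\<pi>' z)) \<and>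
           cubic_characteristic_factor d X' S' Y' R' \<pi>'"
proof -
  obtain f where "functional_base X f"
    using ex_functional_base assms(1) unfolding metric_system_def by blast
  define k where "k = d - 1"
  have d: "d = Suc k" using assms(3) by (simp add: k_def)
  have "minimal_zsys X S"
    using assms(1,2) by (intro minimal_zsys.intro minimal_zsys_axioms.intro zsys.intro)
  then interpret open_model X S f k
    using \<open>functional_base X f\<close> by (rule open_model.intro)
  \<comment> \<open>The pairs live in a product type; \<open>e\<close> transports them to real
    sequences, as the statement requires.\<close>
  obtain e where e: "homeomorphic_map Zt (subtopology Rseq (e ` topspace Zt)) e"
    using compact_metrizable_embedding[OF compact_Zt] metric_system_Zt unfolding metric_system_def by blast
  define X' where "X' = subtopology Rseq (e ` topspace Zt)"
  obtain g where g: "homeomorphic_maps Zt X' e g"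
    using e unfolding X'_def[symmetric] homeomorphic_map_maps by blast
  have ge: "g (e z) = z" "e z \<in> topspace X'" if "z \<in> Zs" for z
    using g that topspace_Zt unfolding homeomorphic_maps_def continuous_map_def by auto
  have eg: "e (g z) = z" "g z \<in> Zs" if "z \<in> topspace X'" for z
    using g that topspace_Zt unfolding homeomorphic_maps_def continuous_map_def by auto
  have e_cont: "continuous_map Zt X' e" and g_cont: "continuous_map X' Zt g"
    using g by (auto simp: homeomorphic_maps_def)
  have g_homeo: "homeomorphic_map X' Zt g" and e_homeo: "homeomorphic_map Zt X' e"
    using g homeomorphic_maps_sym homeomorphic_map_maps by blast+
  define S' where "S' = e \<circ> shift_Z \<circ> g"
  have X': "metric_system X' S'"
    unfolding metric_system_def
  proof (intro conjI)
    show "compact_space X'"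
      using e_homeo compact_Zt homeomorphic_compact_space homeomorphic_space by blast
    show "metrizable_space X'"
      by (simp add: X'_def metrizable_Rseq metrizable_space_subtopology)
    show "homeomorphic_map X' X' S'"
      unfolding S'_def using g_homeo e_homeo metric_system_Zt
      by (intro homeomorphic_map_compose) (auto simp: metric_system_def)
  qed
  define \<theta>' where "\<theta>' = fst \<circ> g"
  define \<pi>' where "\<pi>' = snd \<circ> g"
  have shift_Zs: "shift_Z z \<in> Zs" if "z \<in> Zs" for z
    using homeomorphic_imp_surjective_map[of Zt Zt shift_Z] metric_system_Zt that topspace_Zt
    unfolding metric_system_def by blast
  interpret lifted_model X S f k X' S' \<theta>' \<pi>'
  proof
    show "metric_system X' S'" by (rule X')
    show "continuous_map X' X \<theta>'" "continuous_map X' Yt \<pi>'"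
      unfolding \<theta>'_def \<pi>'_def
      using g_cont continuous_fst_Zt continuous_snd_Zt continuous_map_compose by blast+
    show "\<theta>' (S' z) = S (\<theta>' z)" "\<pi>' (S' z) = shift_code (\<pi>' z)" if "z \<in> topspace X'" for z
      using ge(1)[OF shift_Zs[OF eg(2)[OF that]]] by (simp_all add: \<theta>'_def \<pi>'_def S'_def shift_Z_def)
    show "\<theta>' z \<in> below (\<pi>' z)" if "z \<in> topspace X'" for z
      using eg(2)[OF that] by (auto simp: \<theta>'_def \<pi>'_def Zs_def)
    show "\<exists>z\<in>topspace X'. \<theta>' z = x \<and> \<pi>' z = h" if "h \<in> Ys" "x \<in> below h" for x h
      using that ge[of "(x, h)"] by (intro bexI[of _ "e (x, h)"]) (auto simp: \<theta>'_def \<pi>'_def Zs_def)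
    fix G z assume G: "openin X' G" "z \<in> G"
    have z: "z \<in> topspace X'" using G openin_subset by blast
    have "openin Zt {w \<in> topspace Zt. e w \<in> G}"
      by (rule openin_continuous_map_preimage[OF e_cont G(1)])
    then obtain W where W: "openin (prod_topology X Rseq) W" "{w \<in> topspace Zt. e w \<in> G} = W \<inter> Zs"
      by (auto simp: openin_subtopology)
    have "g z \<in> {w \<in> topspace Zt. e w \<in> G}"
      using eg[OF z] G(2) topspace_Zt by simp
    then have "g z \<in> W"
      using W(2) by blast
    then have "(fst (g z), snd (g z)) \<in> W"
      by simp
    then obtain U V where UV: "openin X U" "openin Rseq V" "fst (g z) \<in> U" "snd (g z) \<in> V" "U \<times> V \<subseteq> W"
      using W(1) unfolding openin_prod_topology_alt by meson
    have "z' \<in> G" if z': "z' \<in> topspace X'" "\<theta>' z' \<in> U" "\<pi>' z' \<in> V" for z'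
    proof -
      have "g z' \<in> U \<times> V"
        using z'(2,3) by (simp add: \<theta>'_def \<pi>'_def mem_Times_iff)
      then have "g z' \<in> W \<inter> Zs"
        using subsetD[OF UV(5)] eg(2)[OF z'(1)] by simp
      then have "e (g z') \<in> G"
        using W(2) by blast
      then show ?thesis
        using eg(1)[OF z'(1)] by simp
    qed
    then show "\<exists>U V. openin X U \<and> openin Rseq V \<and> \<theta>' z \<in> U \<and> \<pi>' z \<in> V \<and>
        (\<forall>z'\<in>topspace X'. \<theta>' z' \<in> U \<and> \<pi>' z' \<in> V \<longrightarrow> z' \<in> G)"
      using UV by (intro exI[of _ U] exI[of _ V]) (simp add: \<theta>'_def \<pi>'_def)
  qed
  have "metric_system X' S' \<and> metric_system Yt shift_code \<and>
      almost_one_to_one_extension X' S' X S \<theta>' \<and>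
      almost_one_to_one_extension Yt shift_code (max_factor k X S) (image S) class_of_code \<and>
      extension X' S' Yt shift_code \<pi>' \<and>
      (\<forall>z\<in>topspace X'. max_factor_proj k X S (\<theta>' z) = class_of_code (\<pi>' z)) \<and>
      cubic_characteristic_factor d X' S' Yt shift_code \<pi>'"
    unfolding d
    by (intro conjI ballI X' metric_system_Yt almost_one_to_one_\<theta>' almost_one_to_one_class_of_code
        extension_\<pi>' class_of_\<pi>' cubic_characteristic_\<pi>')
  then show ?thesis
    unfolding k_def by (intro exI)
qed

end
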